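(* Let $f\in\mathbb{K}[x,y]$ be a minimal polynomial such that $d_y=\deg_y f$ is a prime number. Then there exists $g\in \mathbb{K}[y]$ of degree $d_y$ such that \[ f(x,y)\equiv g(y)+x. \] In particular, $f$ is $G$-equivalent to a monic polynomial, hence to a coordinate polynomial.
   Context: $\mathbb{K}$ is an algebraically closed field of characteristic zero. For $f\in\mathbb{K}[x,y]$ put $d_y=\deg_y f$ and let $\Delta_y(f)\in\mathbb{K}[x]$ be its discriminant with respect to $y$. A polynomial $f$ is minimal if it is irreducible and $\deg_x\Delta_y(f)=d_y-1$. It is monic if its leading coefficient with respect to $y$ is a nonzero constant. A coordinate polynomial is an element $f\in\mathbb{K}[x,y]$ for which there is $h\in\mathbb{K}[x,y]$ with $\mathbb{K}[f,h]=\mathbb{K}[x,y]$. Let $G=GL_2(\mathbb{K}[x])$. It acts on irreducible polynomials $f$ with $d_y>1$ by \[ \begin{pmatrix} a & b \\ c & d \end{pmatrix}(f)=(cy+d)^{d_y} f\Big(x,\frac{ay+b}{cy+d}\Big). \] Two such irreducible polynomials $f,g$ (of $y$-degree $>1$) are $G$-equivalent, written $f\equiv g$, if $f=\sigma(g)$ for some $\sigma\in G$. *)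

theory Defs
  imports
    "HOL-Computational_Algebra.Computational_Algebra"
    "Subresultants.Resultant_Prelim"
begin

text \<open>
  An element of \<open>K[x,y]\<close> is a value of type \<open>'a poly poly\<close>, read as an element of \<open>K[x][y]\<close>:
  the outer variable is \<open>y\<close> and the coefficients lie in \<open>K[x]\<close>. So \<open>degree\<close> is the degree in
  \<open>y\<close>, \<open>lead_coeff\<close> the leading coefficient with respect to \<open>y\<close>, and \<open>pderiv\<close> the derivative
  with respect to \<open>y\<close>.
\<close>

definition bivar_x :: "'a::comm_semiring_1 poly poly" where
  "bivar_x = [:[:0, 1:]:]"

definition poly_in_y :: "'a::comm_semiring_1 poly \<Rightarrow> 'a poly poly" where
  "poly_in_y g = map_poly (\<lambda>c. [:c:]) g"

text \<open>
  The discriminant with respect to \<open>y\<close>, from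
  \<open>Res\<^sub>y(f, f\<^sub>y) = (-1)^(d(d-1)/2) * lc\<^sub>y(f) * \<Delta>\<^sub>y(f)\<close> with \<open>d = deg\<^sub>y f\<close>.
  The division is exact, see \<open>lead_coeff_dvd_resultant_pderiv\<close>.
\<close>

definition disc_y :: "'a::field_char_0 poly poly \<Rightarrow> 'a poly" where
  "disc_y f =
     (- 1) ^ (degree f * (degree f - 1) div 2) * (resultant f (pderiv f) div lead_coeff f)"

lemma lead_coeff_dvd_resultant_pderiv:
  fixes f :: "'a::field_char_0 poly poly"
  assumes "degree f > 0"
  shows "lead_coeff f dvd resultant f (pderiv f)"
proof -
  let ?A = "sylvester_mat f (pderiv f)"
  let ?m = "degree f" and ?n = "degree (pderiv f)"
  have A: "?A \<in> carrier_mat (?m + ?n) (?m + ?n)" by (rule sylvester_carrier_mat)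
  have n: "?n = ?m - 1" by (rule degree_pderiv)
  have lc: "coeff (pderiv f) ?n = of_nat ?m * lead_coeff f"
    using assms by (simp add: n coeff_pderiv)
  have col: "lead_coeff f dvd ?A $$ (i, 0)" if "i < ?m + ?n" for i
    using that assms lc by (auto simp: sylvester_index_mat)
  have "det ?A = (\<Sum>i<?m + ?n. ?A $$ (i, 0) * cofactor ?A i 0)"
    using assms by (intro laplace_expansion_column[OF A]) auto
  also have "lead_coeff f dvd \<dots>"
    by (intro dvd_sum dvd_mult2 col) auto
  finally show ?thesis by (simp add: resultant_def)
qed

text \<open>
  The degree condition is \<open>deg\<^sub>x \<Delta>\<^sub>y(f) = d\<^sub>y - 1\<close>, with the \<open>1\<close> moved to the other side to
  avoid truncated subtraction on \<open>nat\<close>.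
\<close>

definition minimal_poly :: "'a::field_char_0 poly poly \<Rightarrow> bool" where
  "minimal_poly f \<longleftrightarrow> irreducible f \<and> degree (disc_y f) + 1 = degree f"

definition monic_y :: "'a::comm_semiring_1 poly poly \<Rightarrow> bool" where
  "monic_y f \<longleftrightarrow> (\<exists>c. c \<noteq> 0 \<and> lead_coeff f = [:c:])"

text \<open>\<open>subst2 f h P\<close> is \<open>P(f, h)\<close>, that is, \<open>x\<close> is replaced by \<open>f\<close> and \<open>y\<close> by \<open>h\<close> in \<open>P\<close>.\<close>

definition subst2 ::
    "'a::comm_semiring_1 poly poly \<Rightarrow> 'a poly poly \<Rightarrow> 'a poly poly \<Rightarrow> 'a poly poly" where
  "subst2 f h P = poly (map_poly (\<lambda>q. poly (map_poly (\<lambda>c. [:[:c:]:]) q) f) P) h"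

definition generated_subalgebra ::
    "'a::comm_semiring_1 poly poly \<Rightarrow> 'a poly poly \<Rightarrow> 'a poly poly set" where
  "generated_subalgebra f h = range (subst2 f h)"

definition coordinate_poly :: "'a::comm_semiring_1 poly poly \<Rightarrow> bool" where
  "coordinate_poly f \<longleftrightarrow> (\<exists>h. generated_subalgebra f h = UNIV)"

definition GL2 :: "'a::comm_ring_1 poly mat set" where
  "GL2 = {A \<in> carrier_mat 2 2. invertible_mat A}"

text \<open>
  The denominators in \<open>(c y + d)^d\<^sub>y * f(x, (a y + b) / (c y + d))\<close> are cleared term by term;
  \<open>to_fract_G_act\<close> is the formula with the quotient.
\<close>

definition G_act :: "'a::comm_ring_1 poly mat \<Rightarrow> 'a poly poly \<Rightarrow> 'a poly poly" where
  "G_act A f =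
     (\<Sum>i\<le>degree f. [:coeff f i:] *
        ([:A $$ (0, 1), A $$ (0, 0):] ^ i * [:A $$ (1, 1), A $$ (1, 0):] ^ (degree f - i)))"

lemma to_fract_G_act:
  fixes f :: "'a::field poly poly" and A :: "'a poly mat"
  assumes "A \<in> GL2"
  defines "u \<equiv> to_fract [:A $$ (0, 1), A $$ (0, 0):]"
    and "v \<equiv> to_fract [:A $$ (1, 1), A $$ (1, 0):]"
  shows "to_fract (G_act A f) = v ^ degree f * poly (map_poly (\<lambda>q. to_fract [:q:]) f) (u / v)"
proof -
  have pow: "to_fract (p ^ n) = to_fract p ^ n" for p :: "'a poly poly" and n
    by (induction n) auto
  have sum: "to_fract (\<Sum>i\<in>S. g i) = (\<Sum>i\<in>S. to_fract (g i))"
    for g :: "nat \<Rightarrow> 'a poly poly" and S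
    by (induction S rule: infinite_finite_induct) auto
  have v: "v \<noteq> 0"
  proof
    assume "v = 0"
    then have row: "A $$ (1, 0) = 0" "A $$ (1, 1) = 0" by (auto simp: v_def)
    from assms(1) have A: "A \<in> carrier_mat 2 2" by (simp add: GL2_def)
    from assms(1) A have "\<exists>B. A * B = 1\<^sub>m 2 \<and> B * A = 1\<^sub>m (dim_row B)"
      by (auto simp: GL2_def invertible_mat_def inverts_mat_def)
    then obtain C where C: "A * C = 1\<^sub>m 2" "C * A = 1\<^sub>m (dim_row C)" by blast
    have dC: "C \<in> carrier_mat 2 2"
      using C A by (metis carrier_matD(2) carrier_matI index_mult_mat(3) index_one_mat(3))
    have "(A * C) $$ (1, 1) = A $$ (1, 0) * C $$ (0, 1) + A $$ (1, 1) * C $$ (1, 1)"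
      using A dC by (simp add: scalar_prod_def numeral_2_eq_2)
    then show False using row C by simp
  qed
  have "to_fract (G_act A f)
      = (\<Sum>i\<le>degree f. to_fract [:coeff f i:] * (u ^ i * v ^ (degree f - i)))"
    by (simp add: G_act_def sum u_def v_def flip: pow to_fract_mult)
  also have "\<dots> = (\<Sum>i\<le>degree f. v ^ degree f * (to_fract [:coeff f i:] * (u / v) ^ i))"
    using v by (intro sum.cong refl) (simp add: field_simps flip: power_add)
  also have "\<dots> = v ^ degree f * (\<Sum>i\<le>degree f. to_fract [:coeff f i:] * (u / v) ^ i)"
    by (simp add: sum_distrib_left)
  also have "(\<Sum>i\<le>degree f. to_fract [:coeff f i:] * (u / v) ^ i)
      = poly (map_poly (\<lambda>q. to_fract [:q:]) f) (u / v)"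
    by (simp add: poly_altdef coeff_map_poly degree_map_poly)
  finally show ?thesis .
qed

definition G_equivalent :: "'a::field poly poly \<Rightarrow> 'a poly poly \<Rightarrow> bool"
    (infix "\<equiv>\<^sub>G" 50) where
  "f \<equiv>\<^sub>G g \<longleftrightarrow>
     irreducible f \<and> degree f > 1 \<and> irreducible g \<and> degree g > 1 \<and> (\<exists>A\<in>GL2. f = G_act A g)"

end

theory Submission
  imports Defs
begin

text \<open>
  Let \<open>d\<close> be the degree of \<open>f\<close> in \<open>y\<close>. The proof studies the roots of \<open>f\<close> at \<open>x = \<infinity>\<close>: by the Newton--Puiseux theorem
  \<open>f\<close> splits over \<open>K((u))\<close> for some \<open>n\<close> and \<open>u\<close> with \<open>x = u^(-n)\<close>, and the \<open>n\<close>-th roots of unity \<open>\<zeta>\<close> permute the roots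
  by \<open>u \<mapsto> \<zeta> * u\<close>.

  The first half shows that they do so transitively (\<open>rotations_transitive_on_roots\<close>). Geometrically, \<open>d - 1\<close> is
  the lower bound for the degree of the discriminant that follows from the Riemann--Hurwitz formula, and equality forces total
  ramification at infinity. Here this is a statement about lattices. The form \<open>f\<close> carries a ring of rank \<open>d\<close>
  over \<open>K[x]\<close> with discriminant \<open>\<Delta>\<^sub>y(f)\<close>. Measured by its pole orders at infinity, it has a reduced basis, one whose
  leading coefficients at the \<open>d\<close> roots form a nonsingular matrix (\<open>reduced_basis_exists\<close>). The pole orders \<open>N\<close> in such a
  basis satisfy \<open>2 * \<Sum> N = n * (d - 1)\<close>, and the trace form pairs its members in such a way that the orders of partners add up to
  multiples of \<open>n\<close>. As \<open>f\<close> is irreducible, only constants have order 0 (\<open>bounded_imp_const\<close>). Together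
  this leaves a single member whose order is divisible by \<open>n\<close>, so that functions on the set of roots that are invariant
  under rotation are constant.

  For the second half, choose in the orbit of \<open>f\<close> a polynomial \<open>h\<close> for which the sum of the degrees of the leading and of the
  constant coefficient is minimal. By transitivity all its roots have the same pole order \<open>\<rho>\<close>, and \<open>\<rho> \<ge> 0\<close> may be assumed, since
  \<open>y \<mapsto> 1/y\<close> exchanges the two coefficients. If \<open>n\<close> divided \<open>\<rho>\<close>, all roots would have the same leading term
  \<open>\<kappa> * x^(\<rho>/n)\<close>, and a translation of \<open>y\<close> by this term would make \<open>h\<close> smaller. So \<open>n\<close> does not divide \<open>\<rho>\<close>, and as \<open>d\<close> is
  prime, the leading coefficients of the \<open>d\<close> roots are all different (\<open>leading_coeffs_distinct\<close>). Now
  the degree of the discriminant can be read off from the differences of the roots, and comparison with \<open>d - 1\<close> gives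
  a constant leading coefficient and roots that grow like \<open>x^(1/d)\<close> (\<open>normal_form_of_fractional_slope\<close>). Hence the
  constant coefficient of \<open>h\<close> is linear in \<open>x\<close> and all others are constants, that is, \<open>h = \<alpha> * (g(y) + x)\<close>. The factor \<open>\<alpha>\<close> is the
  effect of a scalar matrix.
\<close>

hide_const (open) module.smult

section \<open>Hensel's lemma\<close>

text \<open>
  Modulo the linear factor, \<open>h\<close> is the nonzero constant \<open>poly h x\<close>, which is a Bezout identity
  for \<open>m = 1\<close>; products of Bezout identities give the powers.
\<close>

lemma bezout_linear_power:
  fixes h :: "'a::field poly"
  assumes "poly h x \<noteq> 0"
  shows "\<exists>a b. a * [:-x, 1:] ^ m + b * h = 1"
proof -
  let ?u = "[:-x, 1:]"
  have "poly (h - [:poly h x:]) x = 0" by simp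
  then obtain q where q: "h - [:poly h x:] = ?u * q"
    by (metis poly_eq_0_iff_dvd dvdE)
  define c where "c = inverse (poly h x)"
  have "h = ?u * q + [:poly h x:]" using q by (simp add: algebra_simps)
  then have "smult c h = smult c (?u * q) + [:c * poly h x:]"
    by (metis smult_add_right smult_pCons smult_0_right)
  moreover have "smult (- c) q * ?u = - smult c (?u * q)"
    by (simp only: smult_minus_left mult_minus_left mult_smult_left mult.commute)
  ultimately have 1: "smult (- c) q * ?u + [:c:] * h = 1"
    using assms by (simp add: c_def one_pCons)
  show ?thesis
  proof (induction m)
    case 0
    show ?case by (intro exI[of _ 1] exI[of _ 0]) simp
  next
    case (Suc m)
    then obtain a b where ab: "a * ?u ^ m + b * h = 1" by blast
    have "1 = (a * ?u ^ m + b * h) * (smult (- c) q * ?u + [:c:] * h)"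
      by (simp only: ab 1 mult_1_left)
    also have "\<dots> = (a * smult (- c) q) * ?u ^ Suc m
        + (b * smult (- c) q * ?u + [:c:] * (a * ?u ^ m + b * h)) * h"
      by (simp only: power_Suc ring_distribs mult.assoc mult.commute mult.left_commute add.assoc)
    finally show ?case by metis
  qed
qed

text \<open>
  The coefficients of \<open>G\<close> and \<open>H\<close> with respect to the series variable are polynomials in \<open>y\<close> and
  are found one after the other. The \<open>k\<close>-th one is a pair \<open>(G\<^sub>k, H\<^sub>k)\<close> with
  \<open>G\<^sub>k * h + g * H\<^sub>k = C\<close>, where \<open>C\<close> depends on earlier pairs and has degree below
  \<open>degree g + degree h\<close>. The Bezout identity solves this equation, and reduction modulo \<open>g\<close>
  keeps \<open>degree G\<^sub>k < degree g\<close> and \<open>degree H\<^sub>k < degree h\<close>. Because of these bounds the limits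
  are polynomials in \<open>y\<close>, of the degrees of \<open>g\<close> and \<open>h\<close>.
\<close>

lemma hensel_factorization:
  fixes F :: "'a::field fps poly" and g h a b :: "'a poly"
  assumes monic: "lead_coeff F = 1"
    and red: "map_poly (\<lambda>c. c $ 0) F = g * h"
    and bezout: "a * g + b * h = 1"
    and deg_g: "degree g > 0" and deg_h: "degree h > 0"
  shows "\<exists>G H. F = G * H \<and> degree G = degree g \<and> degree H = degree h"
proof -
  define Fk where "Fk k = map_poly (\<lambda>c. c $ k) F" for k
  have coeff_Fk: "coeff (Fk k) m = coeff F m $ k" for k m
    by (simp add: Fk_def coeff_map_poly)
  have gh0: "g \<noteq> 0" "h \<noteq> 0" using deg_g deg_h by auto
  have deg_F: "degree F = degree g + degree h"
  proof -
    have "degree (Fk 0) = degree F"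
      by (intro antisym degree_le le_degree) (auto simp: coeff_Fk monic coeff_eq_0)
    then show ?thesis using red gh0 by (simp add: Fk_def degree_mult_eq)
  qed
  have deg_Fk: "degree (Fk k) < degree g + degree h" if "k > 0" for k
  proof -
    have "coeff (Fk k) m = 0" if "m \<ge> degree g + degree h" for m
    proof (cases "m = degree F")
      case True then show ?thesis using monic \<open>k > 0\<close> by (simp add: coeff_Fk)
    next
      case False then show ?thesis using that deg_F by (simp add: coeff_Fk coeff_eq_0)
    qed
    then have "degree (Fk k) \<le> degree g + degree h - 1"
      using deg_g by (intro degree_le) auto
    then show ?thesis using deg_g by linarith
  qed
  \<comment> \<open>\<open>P f k r\<close>: the pair \<open>r\<close> is an admissible \<open>k\<close>-th coefficient if \<open>f\<close> holds the earlier ones\<close>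
  define P where "P f k r \<longleftrightarrow> (k = 0 \<longrightarrow> r = (g, h)) \<and> (k > 0 \<longrightarrow>
      degree (fst r) < degree g \<and> degree (snd r) < degree h \<and>
      fst r * h + g * snd r = Fk k - (\<Sum>i\<in>{1..<k}. fst (f i) * snd (f (k - i))))"
    for f :: "nat \<Rightarrow> 'a poly \<times> 'a poly" and k :: nat and r
  have "\<exists>s. \<forall>k. P s k (s k)"
  proof (rule dependent_wf_choice[of less_than])
    fix f f' :: "nat \<Rightarrow> 'a poly \<times> 'a poly" and k r
    assume "\<And>i. (i, k) \<in> less_than \<Longrightarrow> f i = f' i"
    then have "(\<Sum>i\<in>{1..<k}. fst (f i) * snd (f (k - i)))
        = (\<Sum>i\<in>{1..<k}. fst (f' i) * snd (f' (k - i)))"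
      by (intro sum.cong) auto
    then show "P f k r = P f' k r" by (simp add: P_def)
  next
    fix k f assume IH: "\<And>i. (i, k) \<in> less_than \<Longrightarrow> P f i (f i)"
    show "\<exists>r. P f k r"
    proof (cases "k = 0")
      case True then show ?thesis by (simp add: P_def)
    next
      case False
      define C where "C = Fk k - (\<Sum>i\<in>{1..<k}. fst (f i) * snd (f (k - i)))"
      have "degree (fst (f i) * snd (f (k - i))) < degree g + degree h" if "i \<in> {1..<k}" for i
        using IH[of i] IH[of "k - i"] that degree_mult_le[of "fst (f i)" "snd (f (k - i))"]
        by (auto simp: P_def)
      then have deg_C: "degree C < degree g + degree h"
        unfolding C_def using deg_Fk[of k] False deg_g
        by (intro degree_diff_less degree_sum_less) auto
      define G where "G = (C * b) mod g"
      define H where "H = C * a + (C * b div g) * h"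
      have "C = C * (a * g + b * h)" by (simp add: bezout)
      also have "\<dots> = g * (C * a) + (C * b) * h" by (simp add: algebra_simps)
      also have "C * b = g * (C * b div g) + G" by (simp add: G_def)
      finally have eq: "G * h + g * H = C"
        by (simp add: H_def algebra_simps)
      have dG: "degree G < degree g"
        unfolding G_def using deg_g gh0 by (metis degree_0 degree_mod_less)
      have dH: "degree H < degree h"
      proof (cases "H = 0")
        case False
        have "degree (G * h) < degree g + degree h"
          using degree_mult_le[of G h] dG by linarith
        then have "degree (C - G * h) < degree g + degree h"
          using deg_C deg_g by (intro degree_diff_less) auto
        moreover have "C - G * h = g * H" using eq by (simp add: algebra_simps)
        ultimately show ?thesis using False gh0 by (simp add: degree_mult_eq)
      qed (use deg_h in auto)
      show ?thesis
        using False dG dH eq by (intro exI[of _ "(G, H)"]) (simp add: P_def C_def)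
    qed
  qed auto
  then obtain s where s: "\<And>k. P s k (s k)" by blast
  have s0: "s 0 = (g, h)" using s[of 0] by (simp add: P_def)
  have dfst: "degree (fst (s k)) \<le> degree g" "k > 0 \<Longrightarrow> degree (fst (s k)) < degree g"
   and dsnd: "degree (snd (s k)) \<le> degree h" "k > 0 \<Longrightarrow> degree (snd (s k)) < degree h" for k
    using s[of k] s0 by (cases "k = 0"; auto simp: P_def)+
  have conv: "(\<Sum>i\<le>k. fst (s i) * snd (s (k - i))) = Fk k" for k
  proof (cases "k = 0")
    case True then show ?thesis using s0 red by (simp add: Fk_def)
  next
    case False
    have "{..k} = insert 0 (insert k {1..<k})" using False by auto
    then have "(\<Sum>i\<le>k. fst (s i) * snd (s (k - i)))
       = g * snd (s k) + (fst (s k) * h + (\<Sum>i\<in>{1..<k}. fst (s i) * snd (s (k - i))))"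
      using False s0 by simp
    then show ?thesis using s[of k] False by (simp add: P_def algebra_simps)
  qed
  \<comment> \<open>reads a sequence of polynomials in \<open>y\<close> as a polynomial in \<open>y\<close> with series coefficients\<close>
  define asm where "asm A D = (\<Sum>m\<le>D. monom (Abs_fps (\<lambda>k. coeff (A k) m)) m)"
    for A :: "nat \<Rightarrow> 'a poly" and D
  have coeff_asm: "coeff (asm A D) m $ k = coeff (A k) m"
    if "\<And>k. degree (A k) \<le> D" for A D m k
  proof -
    have "coeff (asm A D) m = (if m \<le> D then Abs_fps (\<lambda>k. coeff (A k) m) else 0)"
      by (simp add: asm_def coeff_sum)
    then show ?thesis using that[of k] by (auto simp: coeff_eq_0)
  qed
  define G where "G = asm (\<lambda>k. fst (s k)) (degree g)"
  define H where "H = asm (\<lambda>k. snd (s k)) (degree h)"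
  have cG: "coeff G m $ k = coeff (fst (s k)) m" and cH: "coeff H m $ k = coeff (snd (s k)) m"
    for m k unfolding G_def H_def by (subst coeff_asm; use dfst dsnd in simp)+
  have "G * H = F"
  proof (intro poly_eqI fps_ext)
    fix m k
    have "coeff (G * H) m $ k
        = (\<Sum>i\<le>m. \<Sum>j=0..k. coeff (fst (s j)) i * coeff (snd (s (k - j))) (m - i))"
      by (simp add: coeff_mult fps_sum_nth fps_mult_nth cG cH)
    also have "\<dots> = (\<Sum>j\<le>k. \<Sum>i\<le>m. coeff (fst (s j)) i * coeff (snd (s (k - j))) (m - i))"
      by (subst sum.swap) (simp add: atMost_atLeast0)
    also have "\<dots> = coeff (\<Sum>j\<le>k. fst (s j) * snd (s (k - j))) m"
      by (simp add: coeff_sum coeff_mult)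
    also have "\<dots> = coeff F m $ k" by (simp add: conv coeff_Fk)
    finally show "coeff (G * H) m $ k = coeff F m $ k" .
  qed
  moreover have "degree G = degree g"
  proof (intro antisym[OF degree_le le_degree] allI impI)
    fix m assume "m > degree g"
    then show "coeff G m = 0"
      by (intro fps_ext) (auto simp: cG intro!: coeff_eq_0 le_less_trans[OF dfst(1)])
  next
    have "coeff G (degree g) $ 0 \<noteq> 0" using gh0 by (simp add: cG s0)
    then show "coeff G (degree g) \<noteq> 0" by force
  qed
  moreover have "degree H = degree h"
  proof (intro antisym[OF degree_le le_degree] allI impI)
    fix m assume "m > degree h"
    then show "coeff H m = 0"
      by (intro fps_ext) (auto simp: cH intro!: coeff_eq_0 le_less_trans[OF dsnd(1)])
  next
    have "coeff H (degree h) $ 0 \<noteq> 0" using gh0 by (simp add: cH s0)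
    then show "coeff H (degree h) \<noteq> 0" by force
  qed
  ultimately show ?thesis by blast
qed

section \<open>The Newton--Puiseux theorem\<close>

abbreviation prod_linear :: "'a::comm_ring_1 list \<Rightarrow> 'a poly" where
  "prod_linear zs \<equiv> (\<Prod>z\<leftarrow>zs. [:-z, 1:])"

abbreviation map_compose_power :: "nat \<Rightarrow> 'a::idom fls poly \<Rightarrow> 'a fls poly" where
  "map_compose_power n \<equiv> map_poly (\<lambda>c. fls_compose_power c n)"

lemma (in inj_comm_ring_hom) map_poly_hom_mult:
  "map_poly hom (p * q) = map_poly hom p * map_poly hom q"
proof -
  interpret p: map_poly_inj_comm_ring_hom hom ..
  show ?thesis by (rule p.hom_mult)
qed

lemma (in inj_comm_ring_hom) map_poly_hom_prod_linear:
  "map_poly hom (prod_linear zs) = (prod_linear (map hom zs))"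
  by (induction zs) (simp_all add: map_poly_hom_mult hom_uminus del: mult_pCons_left)

lemma inj_comm_ring_hom_fls_compose_power:
  assumes "n > 0"
  shows "inj_comm_ring_hom (\<lambda>c :: 'a::idom fls. fls_compose_power c n)"
proof unfold_locales
  fix c :: "'a fls" assume "fls_compose_power c n = 0"
  then have "fls_nth (fls_compose_power c n) (int n * k) = 0" for k by simp
  then show "c = 0" using assms by (intro fls_eqI) (simp add: fls_nth_compose_power)
qed (use assms in auto)

lemma fls_compose_power_compose_power:
  "m > 0 \<Longrightarrow> n > 0 \<Longrightarrow> fls_compose_power (fls_compose_power f m) n = fls_compose_power f (m * n)"
  by (intro fls_eqI) (auto simp: fls_nth_compose_power zdiv_zmult2_eq mult.commute[of "int m"]
      elim!: dvdE)

lemma map_poly_fls_compose_power_1: "map_compose_power 1 P = P"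
  by (intro poly_eqI fls_eqI) (simp add: coeff_map_poly fls_nth_compose_power)

text \<open>
  With \<open>a = - coeff P N / ((N + 1) * coeff P (N + 1))\<close> the second highest coefficient disappears
  (Tschirnhaus transformation).
\<close>

lemma coeff_pcompose_shift:
  fixes P :: "'a::comm_ring_1 poly"
  assumes "degree P \<le> Suc N"
  shows "coeff (P \<circ>\<^sub>p [:a, 1:]) N = coeff P N + of_nat (Suc N) * a * coeff P (Suc N)"
  using assms
proof (induction P arbitrary: N)
  case (pCons c Q)
  have dQ: "degree Q \<le> N" using pCons.prems by (cases "Q = 0") auto
  show ?case
  proof (cases N)
    case 0
    then obtain q where "Q = [:q:]" using dQ by (auto elim: degree_eq_zeroE)
    then show ?thesis using 0 by (simp add: pcompose_pCons)
  next
    case (Suc M)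
    have "coeff (Q \<circ>\<^sub>p [:a, 1:]) N = coeff Q N"
      using pCons.IH[of N] dQ by (simp add: coeff_eq_0)
    then show ?thesis using pCons.IH[of M] dQ Suc
      by (simp add: pcompose_pCons algebra_simps)
  qed
qed simp

text \<open>
  If \<open>g\<close> had only one root \<open>x\<close>, then \<open>g = (y - x)^d\<close>, the vanishing coefficient \<open>- d * x\<close> would give
  \<open>x = 0\<close>, and \<open>g\<close> would be \<open>y^d\<close>. So the part of \<open>g\<close> belonging to one root is a proper factor, coprime
  to the rest.
\<close>

lemma coprime_split_of_zero_trace:
  fixes g :: "'k::{alg_closed_field, field_char_0} poly"
  assumes "lead_coeff g = 1" "degree g \<ge> 2" "coeff g (degree g - 1) = 0" "i < degree g" "coeff g i \<noteq> 0"
  shows "\<exists>p q a b. g = p * q \<and> a * p + b * q = 1 \<and> degree p > 0 \<and> degree q > 0"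
proof -
  have g0: "g \<noteq> 0" using assms by auto
  obtain x where x: "poly g x = 0" using alg_closed_imp_poly_has_root[of g] assms by auto
  define m where "m = Polynomial.order x g"
  have m: "m > 0" using x g0 by (simp add: m_def order_root)
  obtain h where h: "g = [:-x, 1:] ^ m * h" "poly h x \<noteq> 0"
    using order_decomp[OF g0, of x] unfolding m_def by (auto simp: poly_eq_0_iff_dvd)
  have h0: "h \<noteq> 0" using h by auto
  have deg: "degree g = m + degree h" using h0 h(1) by (simp add: degree_mult_eq degree_linear_power)
  have "degree h > 0"
  proof (rule ccontr)
    assume "\<not> degree h > 0"
    then obtain c where c: "h = [:c:]" by (auto elim: degree_eq_zeroE)
    have lc: "lead_coeff ([:-x, 1:] ^ m) = 1" by (simp add: lead_coeff_power)
    have "lead_coeff g = lead_coeff ([:-x, 1:] ^ m) * lead_coeff h" using h(1) by (simp only: lead_coeff_mult)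
    then have "h = 1" using assms(1) lc c by (simp add: one_pCons)
    then have "g = monom 1 m \<circ>\<^sub>p [:-x, 1:]" using h(1) by (simp add: monom_altdef pcompose_hom.hom_power pcompose_pCons)
    moreover have "m = degree g" using deg \<open>h = 1\<close> by simp
    ultimately have "coeff g (m - 1) = of_nat m * (- x)"
      using coeff_pcompose_shift[of "monom 1 m" "m - 1" "-x"] m by (simp add: degree_monom_eq)
    then have "x = 0" using assms(3) m \<open>m = degree g\<close> by simp
    then have "g = monom 1 m" using h(1) \<open>h = 1\<close> by (simp add: monom_altdef)
    then show False using assms(4,5) \<open>m = degree g\<close> by (metis coeff_monom less_irrefl)
  qed
  moreover have "degree ([:-x, 1:] ^ m) > 0" using m by (simp add: degree_linear_power)
  moreover obtain a b where "a * [:-x, 1:] ^ m + b * h = 1" using bezout_linear_power h(2) by blast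
  ultimately show ?thesis using h(1) by blast
qed

text \<open>
  The smallest slope of the Newton polygon, the minimum of \<open>v i / (d - i)\<close> for the orders \<open>v i\<close> of the
  coefficients, becomes an integer after \<open>s = u^n\<close>. Rescaling \<open>y\<close> by the corresponding power of \<open>u\<close>
  then yields a polynomial with power series coefficients that does not reduce to \<open>y^d\<close> at \<open>u = 0\<close>.
  Its reduction splits into coprime factors, and Hensel's lemma lifts them.
\<close>

lemma puiseux_reducible:
  fixes P :: "'k::{alg_closed_field, field_char_0} fls poly"
  assumes monic: "lead_coeff P = 1" and deg: "degree P \<ge> 2" and tr: "coeff P (degree P - 1) = 0"
  shows "\<exists>n>0. \<exists>Q R. map_compose_power n P = Q * R \<and> degree Q > 0 \<and> degree R > 0"
proof (cases "\<exists>i<degree P. coeff P i \<noteq> 0")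
  case False
  define d where "d = degree P"
  have "P = monom 1 d"
  proof (rule poly_eqI)
    fix i show "coeff P i = coeff (monom 1 d) i"
      using False monic by (cases i d rule: linorder_cases) (auto simp: d_def coeff_eq_0)
  qed
  then have "P = monom 1 1 * monom 1 (d - 1)"
    using deg by (simp add: mult_monom d_def)
  then have "map_compose_power 1 P = monom 1 1 * monom 1 (d - 1)"
    by (simp only: map_poly_fls_compose_power_1)
  moreover have "degree (monom 1 1 :: 'k fls poly) > 0" "degree (monom 1 (d - 1) :: 'k fls poly) > 0"
    using deg by (simp_all add: degree_monom_eq d_def)
  ultimately show ?thesis by (intro exI[of _ 1]) blast
next
  case True
  define d where "d = degree P"
  define v where "v i = fls_subdegree (coeff P i)" for i
  define I where "I = {i. i < d \<and> coeff P i \<noteq> 0}"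
  have I: "finite I" "I \<noteq> {}" using True by (auto simp: I_def d_def)
  define i0 where "i0 = arg_min_on (\<lambda>i. real_of_int (v i) / real (d - i)) I"
  have i0: "i0 \<in> I" unfolding i0_def using I by (rule arg_min_if_finite(1))
  have i0_min: "real_of_int (v i0) / real (d - i0) \<le> real_of_int (v i) / real (d - i)" if "i \<in> I" for i
    unfolding i0_def using I that by (rule arg_min_least)
  define n where "n = d - i0"
  define r where "r = v i0"
  have n: "n > 0" using i0 by (simp add: n_def I_def)
  interpret cp: inj_comm_ring_hom "\<lambda>c :: 'k fls. fls_compose_power c n"
    using n by (rule inj_comm_ring_hom_fls_compose_power)
  have slope: "int n * v i \<ge> int (d - i) * r" if "i \<in> I" for i
  proof -
    have "real (d - i) > 0" "real n > 0" using that n by (auto simp: I_def)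
    then have "real_of_int r * real (d - i) \<le> real_of_int (v i) * real n"
      using i0_min[OF that] by (simp add: r_def n_def field_simps)
    then have "real_of_int (r * int (d - i)) \<le> real_of_int (v i * int n)" by simp
    then show ?thesis by (simp only: of_int_le_iff mult.commute)
  qed
  define c where "c i = fls_compose_power (coeff P i) n" for i
  have c_zero: "fls_nth (c i) k = 0" if "k < int (d - i) * r" "i \<le> d" for i k
  proof (cases "i \<in> I")
    case True
    show ?thesis
    proof (cases "int n dvd k")
      case True
      then obtain j where j: "k = int n * j" by blast
      then have "int n * j < int n * v i" using slope[OF \<open>i \<in> I\<close>] that by simp
      then have "j < v i" using n by simp
      then show ?thesis using n by (simp add: c_def j fls_nth_compose_power v_def)
    qed (use n in \<open>simp add: c_def fls_nth_compose_power\<close>)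
  next
    case False
    show ?thesis
    proof (cases "i = d")
      case True then show ?thesis using that monic n by (simp add: c_def d_def)
    next
      case False then show ?thesis using \<open>i \<notin> I\<close> that n by (simp add: c_def I_def)
    qed
  qed
  define q where "q i = Abs_fps (\<lambda>k. fls_nth (c i) (int k + int (d - i) * r))" for i
  have q: "fps_to_fls (q i) = fls_X_intpow (- (int (d - i) * r)) * c i" if "i \<le> d" for i
  proof -
    have "fls_X_intpow (- k) * c i = fls_shift k (c i)" for k
      using fls_X_intpow_times_conv_shift(1)[of "- k" "c i"] by simp
    moreover have "fps_to_fls (q i) = fls_shift (int (d - i) * r) (c i)"
      using that by (intro fls_eqI) (auto simp: q_def of_nat_diff intro!: c_zero)
    ultimately show ?thesis by simp
  qed
  \<comment> \<open>\<open>u^(- d * r) * P(u^r * y)\<close> after the substitution \<open>s = u^n\<close>; its coefficients are power series in \<open>u\<close>\<close>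
  define F where "F = (\<Sum>i\<le>d. monom (q i) i)"
  have coeff_F: "coeff F i = (if i \<le> d then q i else 0)" for i
    by (simp add: F_def coeff_sum)
  have qd: "q d = 1" using monic n by (intro fps_ext) (auto simp: q_def c_def d_def)
  have deg_F: "degree F = d"
    by (intro antisym[OF degree_le le_degree]) (auto simp: coeff_F qd)
  define g where "g = map_poly (\<lambda>c. c $ 0) F"
  have coeff_g: "coeff g i = (if i \<le> d then q i $ 0 else 0)" for i
    by (simp add: g_def coeff_map_poly coeff_F)
  have deg_g: "degree g = d"
    by (intro antisym[OF degree_le le_degree]) (auto simp: coeff_g qd)
  have "\<exists>p q a b. g = p * q \<and> a * p + b * q = 1 \<and> degree p > 0 \<and> degree q > 0"
  proof (rule coprime_split_of_zero_trace)
    show "lead_coeff g = 1" by (simp add: deg_g coeff_g qd)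
    show "degree g \<ge> 2" using deg by (simp add: deg_g d_def)
    show "coeff g (degree g - 1) = 0"
      using tr by (simp add: deg_g coeff_g q_def c_def d_def)
    show "i0 < degree g" using i0 by (simp add: deg_g I_def)
    have "fls_nth (c i0) (int n * r) = fls_nth (coeff P i0) r" using n by (simp add: c_def fls_nth_compose_power)
    also have "\<dots> \<noteq> 0" using i0 by (simp add: r_def v_def I_def)
    finally show "coeff g i0 \<noteq> 0" using i0 by (simp add: coeff_g q_def n_def I_def)
  qed
  then obtain p h a b where gph: "g = p * h" "a * p + b * h = 1" "degree p > 0" "degree h > 0" by blast
  obtain G H where GH: "F = G * H" "degree G = degree p" "degree H = degree h"
    using hensel_factorization[of F p h a b] gph by (auto simp: g_def deg_F coeff_F qd)
  interpret fl: inj_comm_ring_hom "fps_to_fls :: 'k fps \<Rightarrow> 'k fls"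
    by unfold_locales (auto simp: fls_times_fps_to_fls)
  let ?w = "fls_X_intpow (- r) :: 'k fls"
  have w0: "?w \<noteq> 0"
  proof
    assume "?w = 0"
    then have "fls_nth ?w (- r) = 0" by simp
    then show False by simp
  qed
  let ?S = "\<lambda>A. map_poly fps_to_fls A \<circ>\<^sub>p [:0, ?w:]"
  have "map_compose_power n P = smult (fls_X_intpow (int d * r)) (?S F)"
  proof (rule poly_eqI)
    fix i
    show "coeff (map_compose_power n P) i = coeff (smult (fls_X_intpow (int d * r)) (?S F)) i"
    proof (cases "i \<le> d")
      case True
      then have "coeff (smult (fls_X_intpow (int d * r)) (?S F)) i =
         fls_X_intpow (int d * r) * (?w ^ i * (fls_X_intpow (- (int (d - i) * r)) * c i))"
        by (simp only: coeff_smult coeff_pcompose_linear fl.coeff_map_poly_hom coeff_F if_True q)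
      also have "\<dots> = (fls_X_intpow (int d * r) * ?w ^ i * fls_X_intpow (- (int (d - i) * r))) * c i"
        by (simp only: mult.assoc)
      also have "fls_X_intpow (int d * r) * ?w ^ i * fls_X_intpow (- (int (d - i) * r)) = (1 :: 'k fls)"
      proof -
        have "int d * r + int i * - r + - (int (d - i) * r) = 0"
          using True by (simp add: of_nat_diff algebra_simps)
        then show ?thesis
          by (simp only: fls_X_intpow_power fls_X_intpow_times_fls_X_intpow) simp
      qed
      also have "1 * c i = c i" by simp
      finally show ?thesis by (simp add: c_def)
    next
      case False
      then have "coeff P i = 0" by (simp add: d_def coeff_eq_0)
      with False show ?thesis
        by (simp only: coeff_smult coeff_pcompose_linear fl.coeff_map_poly_hom cp.coeff_map_poly_hom
            coeff_F if_False fl.hom_zero cp.hom_zero mult_zero_right)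
    qed
  qed
  also have "?S F = ?S G * ?S H" by (simp only: GH(1) fl.map_poly_hom_mult pcompose_mult)
  finally have "map_compose_power n P
      = smult (fls_X_intpow (int d * r)) (?S G) * ?S H" by simp
  moreover have "degree (smult (fls_X_intpow (int d * r)) (?S G)) > 0" "degree (?S H) > 0"
    using GH gph w0 by (simp_all add: degree_pcompose)
  ultimately show ?thesis using n by blast
qed

text \<open>
  Induction on the degree: after a translation that kills the second highest coefficient, the
  polynomial factors over some \<open>K((u))\<close>, and the exponents needed for the two factors are multiplied to
  get one that serves both.
\<close>

lemma puiseux_splits:
  fixes P :: "'k::{alg_closed_field, field_char_0} fls poly"
  assumes "P \<noteq> 0"
  shows "\<exists>n>0. \<exists>c zs. map_compose_power n P = smult c (prod_linear zs)"
  using assms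
proof (induction "degree P" arbitrary: P rule: less_induct)
  case less
  let ?d = "degree P"
  show ?case
  proof (cases "?d \<le> 1")
    case True
    have "map_compose_power 1 P = P" by (rule map_poly_fls_compose_power_1)
    moreover have "\<exists>c zs. P = smult c (prod_linear zs)"
    proof (cases "?d = 0")
      case True
      then obtain c where "P = [:c:]" by (auto elim: degree_eq_zeroE)
      then show ?thesis by (intro exI[of _ c] exI[of _ "[]"]) simp
    next
      case False
      then have "?d = 1" using True by simp
      then have "P = [:coeff P 0, coeff P 1:]" "coeff P 1 \<noteq> 0"
        using leading_coeff_neq_0[OF less.prems]
        by (auto intro!: poly_eqI simp: coeff_pCons coeff_eq_0 split: nat.splits)
      then obtain a b where "P = [:b, a:]" "a \<noteq> 0" by metis
      then show ?thesis by (intro exI[of _ a] exI[of _ "[- b / a]"]) simp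
    qed
    ultimately show ?thesis by (intro exI[of _ 1]) auto
  next
    case False
    let ?l = "lead_coeff P"
    define a where "a = - coeff P (?d - 1) / (of_nat ?d * ?l)"
    define P1 where "P1 = smult (inverse ?l) (P \<circ>\<^sub>p [:a, 1:])"
    have l: "?l \<noteq> 0" using less.prems by simp
    have dP1: "degree P1 = ?d" using l by (simp add: P1_def degree_pcompose)
    have "\<exists>n>0. \<exists>Q R. map_compose_power n P1 = Q * R \<and> degree Q > 0 \<and> degree R > 0"
    proof (rule puiseux_reducible)
      have "lead_coeff (P \<circ>\<^sub>p [:a, 1:]) = ?l" by (subst lead_coeff_comp) auto
      then show "lead_coeff P1 = 1" using l dP1 by (simp add: P1_def)
      show "degree P1 \<ge> 2" using False dP1 by simp
      have "coeff (P \<circ>\<^sub>p [:a, 1:]) (?d - 1) = coeff P (?d - 1) + of_nat ?d * a * ?l"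
        using False coeff_pcompose_shift[of P "?d - 1" a] by simp
      also have "\<dots> = 0" using False l by (simp add: a_def)
      finally show "coeff P1 (degree P1 - 1) = 0" using dP1 by (simp add: P1_def)
    qed
    then obtain n Q R where n: "n > 0" and QR: "map_compose_power n P1 = Q * R"
      "degree Q > 0" "degree R > 0" by blast
    interpret n: inj_comm_ring_hom "\<lambda>c :: 'k fls. fls_compose_power c n"
      using n by (rule inj_comm_ring_hom_fls_compose_power)
    have Q0: "Q \<noteq> 0" "R \<noteq> 0" using QR by auto
    have "degree Q + degree R = ?d" using dP1 QR(1) Q0 by (metis n.degree_map_poly_hom degree_mult_eq)
    then have lt: "degree Q < ?d" "degree R < ?d" using QR by auto
    obtain n1 c1 zs1 where 1: "n1 > 0" "map_compose_power n1 Q = smult c1 (prod_linear zs1)"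
      using less.hyps[OF lt(1) Q0(1)] by blast
    obtain n2 c2 zs2 where 2: "n2 > 0" "map_compose_power n2 R = smult c2 (prod_linear zs2)"
      using less.hyps[OF lt(2) Q0(2)] by blast
    interpret n1: inj_comm_ring_hom "\<lambda>c :: 'k fls. fls_compose_power c n1"
      using 1(1) by (rule inj_comm_ring_hom_fls_compose_power)
    interpret n2: inj_comm_ring_hom "\<lambda>c :: 'k fls. fls_compose_power c n2"
      using 2(1) by (rule inj_comm_ring_hom_fls_compose_power)
    interpret n12: inj_comm_ring_hom "\<lambda>c :: 'k fls. fls_compose_power c (n1 * n2)"
      using 1 2 by (intro inj_comm_ring_hom_fls_compose_power) simp
    interpret N: inj_comm_ring_hom "\<lambda>c :: 'k fls. fls_compose_power c (n * (n1 * n2))"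
      using n 1 2 by (intro inj_comm_ring_hom_fls_compose_power) simp
    have comp: "map_compose_power k (map_compose_power m A)
        = map_compose_power (m * k) A" if "m > 0" "k > 0" for m k and A :: "'k fls poly"
      by (rule poly_eqI) (use that in \<open>simp add: coeff_map_poly fls_compose_power_compose_power\<close>)
    let ?N = "n * (n1 * n2)"
    have "map_compose_power ?N P1 = map_compose_power (n1 * n2) (Q * R)"
      unfolding QR(1)[symmetric] using n 1(1) 2(1) by (intro comp[symmetric]) auto
    also have "\<dots> = map_compose_power (n1 * n2) Q * map_compose_power (n2 * n1) R"
      by (simp only: n12.map_poly_hom_mult mult.commute[of n2])
    also have "\<dots> = map_compose_power n2 (map_compose_power n1 Q)
        * map_compose_power n1 (map_compose_power n2 R)"
      using 1(1) 2(1) by (simp only: comp)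
    also have "\<dots> = smult (fls_compose_power c1 n2 * fls_compose_power c2 n1)
        (prod_linear (map (\<lambda>z. fls_compose_power z n2) zs1 @ map (\<lambda>z. fls_compose_power z n1) zs2))"
      unfolding 1(2) 2(2) n1.map_poly_hom_smult n2.map_poly_hom_smult n1.map_poly_hom_prod_linear
        n2.map_poly_hom_prod_linear map_append prod_list.append by (simp add: mult.commute)
    finally obtain c zs where P1: "map_compose_power ?N P1 = smult c (prod_linear zs)"
      by blast
    let ?a = "fls_compose_power a ?N"
    have "P = smult ?l (P1 \<circ>\<^sub>p [:-a, 1:])"
      using l by (simp add: P1_def pcompose_smult pcompose_pCons flip: pcompose_assoc)
    moreover have Pc: "map_compose_power ?N (smult ?l (P1 \<circ>\<^sub>p [:-a, 1:]))
      = smult (fls_compose_power ?l ?N) (map_compose_power ?N P1 \<circ>\<^sub>p [:-?a, 1:])"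
      by (simp only: N.map_poly_hom_smult N.map_poly_pcompose N.map_poly_pCons_hom map_poly_0 N.hom_one N.hom_uminus)
    ultimately have "map_compose_power ?N P
      = smult (fls_compose_power ?l ?N) (map_compose_power ?N P1 \<circ>\<^sub>p [:-?a, 1:])"
      by (metis Pc)
    also note P1
    also have "(smult c (prod_linear zs)) \<circ>\<^sub>p [:-?a, 1:] = smult c (prod_linear (map (\<lambda>z. z + ?a) zs))"
    proof -
      have "(prod_linear zs) \<circ>\<^sub>p [:-?a, 1:] = (prod_linear (map (\<lambda>z. z + ?a) zs))"
        by (induction zs) (simp_all add: pcompose_mult pcompose_pCons add.commute del: mult_pCons_left)
      then show ?thesis by (simp only: pcompose_smult)
    qed
    finally have "map_compose_power ?N P
      = smult (fls_compose_power ?l ?N * c) (prod_linear (map (\<lambda>z. z + ?a) zs))"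
      by (simp only: smult_smult)
    moreover have "?N > 0" using n 1(1) 2(1) by simp
    ultimately show ?thesis by blast
  qed
qed

section \<open>Expansions at infinity\<close>

text \<open>
  The expansion of polynomials at \<open>x = \<infinity>\<close> in the local parameter \<open>u\<close> with \<open>x = u^(-n)\<close>. A pole of order
  \<open>k\<close> in \<open>u\<close> corresponds to degree \<open>k / n\<close> in \<open>x\<close>.
\<close>

definition embed_inf :: "nat \<Rightarrow> 'a::comm_ring_1 poly \<Rightarrow> 'a fls" where
  "embed_inf n p = poly (map_poly fls_const p) (fls_X_intpow (- int n))"

lemma nth_embed_inf:
  "fls_nth (embed_inf n p) k = (\<Sum>i\<le>degree p. if k = - (int n * int i) then coeff p i else 0)"
proof -
  have *: "fls_nth (fls_const c * fls_X_intpow m) k = (if k = m then c else 0)" for c :: 'a and m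
    by auto
  have "embed_inf n p = (\<Sum>i\<le>degree (map_poly fls_const p). fls_const (coeff p i) * fls_X_intpow (- (int n * int i)))"
    unfolding embed_inf_def poly_altdef
    by (intro sum.cong refl) (simp only: coeff_map_poly fls_const_0 fls_X_intpow_power, simp add: mult.commute)
  also have "degree (map_poly fls_const p) = degree p"
    by (intro degree_map_poly) (simp add: fls_const_nonzero)
  finally show ?thesis by (simp only: fls_nth_sum *)
qed

lemma nth_embed_inf_mult: "n > 0 \<Longrightarrow> fls_nth (embed_inf n p) (- (int n * int i)) = coeff p i"
  by (auto simp: nth_embed_inf sum.delta coeff_eq_0)

lemma nth_embed_inf_0: "n > 0 \<Longrightarrow> fls_nth (embed_inf n p) 0 = coeff p 0"
  using nth_embed_inf_mult[of n p 0] by simp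

lemma nth_embed_inf_eq_0: "(\<And>i. k \<noteq> - (int n * int i)) \<Longrightarrow> fls_nth (embed_inf n p) k = 0"
  by (simp add: nth_embed_inf)

lemma inj_comm_ring_hom_embed_inf:
  assumes "n > 0"
  shows "inj_comm_ring_hom (embed_inf n :: 'a::idom poly \<Rightarrow> 'a fls)"
proof -
  interpret c: inj_comm_ring_hom "fls_const :: 'a \<Rightarrow> 'a fls"
    by unfold_locales (auto simp: fls_const_mult_const fls_plus_const)
  interpret cp: map_poly_inj_comm_ring_hom "fls_const :: 'a \<Rightarrow> 'a fls" ..
  show ?thesis
  proof unfold_locales
    fix p :: "'a poly" assume 0: "embed_inf n p = 0"
    show "p = 0"
    proof (rule poly_eqI)
      fix i show "coeff p i = coeff 0 i" using nth_embed_inf_mult[OF assms, of p i] 0 by simp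
    qed
  qed (simp_all add: embed_inf_def cp.hom_add cp.hom_mult)
qed

lemma embed_inf_const: "embed_inf n [:c:] = fls_const c"
  by (cases "c = 0") (simp_all add: embed_inf_def map_poly_pCons)

lemma embed_inf_monom: "embed_inf n (monom c k) = fls_const c * fls_X_intpow (- (int n * int k))"
  by (simp only: embed_inf_def map_poly_monom fls_const_0 poly_monom fls_X_intpow_power)
     (simp add: mult.commute)

lemma subdegree_embed_inf:
  assumes "n > 0" "p \<noteq> 0"
  shows "fls_subdegree (embed_inf n p) = - (int n * int (degree p))"
proof (rule fls_subdegree_eqI)
  show "fls_nth (embed_inf n p) (- (int n * int (degree p))) \<noteq> 0"
    using assms by (simp add: nth_embed_inf_mult)
  fix k assume "k < - (int n * int (degree p))"
  then have "k \<noteq> - (int n * int i)" if "i \<le> degree p" for i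
    using that mult_left_mono[of "int i" "int (degree p)" "int n"] by auto
  then show "fls_nth (embed_inf n p) k = 0" by (simp add: nth_embed_inf)
qed

lemma compose_power_embed_inf:
  assumes "n > 0"
  shows "fls_compose_power (embed_inf 1 p) n = embed_inf n p"
proof (rule fls_eqI)
  fix k
  have *: "k = - (int n * int i) \<longleftrightarrow> int n dvd k \<and> k div int n = - (int 1 * int i)" for i
  proof -
    have "int n dvd k \<and> k div int n = - int i" if "k = int n * - int i"
      unfolding that using assms by (simp del: mult_minus_right)
    moreover have "k = int n * - int i" if "int n dvd k" "k div int n = - int i"
      using dvd_mult_div_cancel[OF that(1)] that(2) by simp
    moreover have "- (int n * int i) = int n * - int i" "int 1 * int i = int i" by simp_all
    ultimately show ?thesis by metis
  qed
  have "fls_nth (embed_inf n p) k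
      = (\<Sum>i\<le>degree p. if int n dvd k \<and> k div int n = - (int 1 * int i) then coeff p i else 0)"
    unfolding nth_embed_inf by (rule sum.cong[OF refl], rule if_cong[OF * refl refl])
  also have "\<dots> = (if int n dvd k then fls_nth (embed_inf 1 p) (k div int n) else 0)"
    by (cases "int n dvd k") (simp_all add: nth_embed_inf)
  finally show "fls_nth (fls_compose_power (embed_inf 1 p) n) k = fls_nth (embed_inf n p) k"
    using assms by (simp only: fls_nth_compose_power)
qed

section \<open>Roots of unity\<close>

text \<open>
  Since \<open>X^n - 1\<close> is separable, there are \<open>n\<close> roots of unity. They cannot all be zeros of
  \<open>X^r - 1\<close> with \<open>r = k mod n < n\<close>.
\<close>

lemma exists_root_of_unity_powi_neq_1:
  assumes "n > 0" "\<not> int n dvd k"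
  shows "\<exists>z::'k::{alg_closed_field, field_char_0}. z ^ n = 1 \<and> z powi k \<noteq> 1"
proof (rule ccontr)
  assume "\<not> ?thesis"
  then have all: "z powi k = 1" if "z ^ n = 1" for z :: 'k using that by blast
  define r where "r = nat (k mod int n)"
  have r: "r > 0" "r < n" "int r = k mod int n"
  proof -
    have "0 \<le> k mod int n" "k mod int n < int n" "k mod int n \<noteq> 0"
      using assms by (auto simp: dvd_eq_mod_eq_0)
    then show "r > 0" "r < n" "int r = k mod int n" unfolding r_def by linarith+
  qed
  have allr: "z ^ r = 1" if "z ^ n = 1" for z :: 'k
  proof -
    have z0: "z \<noteq> 0" using that assms(1) by (auto simp: power_0_left)
    have "k = int n * (k div int n) + int r" by (simp add: r(3))
    then have "z powi k = z powi (int n * (k div int n) + int r)" by (rule arg_cong)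
    also have "\<dots> = (z powi int n) powi (k div int n) * z powi int r"
      using z0 by (subst power_int_add) (auto simp: power_int_mult)
    finally have "z powi k = (z powi int n) powi (k div int n) * z powi int r" .
    then show ?thesis using all[OF that] that by simp
  qed
  define p :: "'k poly" where "p = monom 1 n - 1"
  have deg_p: "degree p = n"
  proof -
    have "degree (monom 1 n + (- 1) :: 'k poly) = degree (monom 1 n :: 'k poly)"
      using assms(1) by (intro degree_add_eq_left) (simp add: degree_monom_eq)
    then show ?thesis by (simp add: p_def degree_monom_eq)
  qed
  have p0: "p \<noteq> 0" using deg_p assms(1) by auto
  have poly_p: "poly p z = z ^ n - 1" for z by (simp add: p_def poly_monom)
  obtain A where A: "size A = n" "p = smult (lead_coeff p) (\<Prod>x\<in>#A. [:-x, 1:])"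
    using alg_closed_imp_factorization[OF p0] deg_p by auto
  have count: "count A x \<le> 1" for x
  proof (rule ccontr)
    assume "\<not> count A x \<le> 1"
    then have "x \<in># A" by (intro count_inI) auto
    then obtain A' where A': "A = add_mset x A'" by (meson multi_member_split)
    then have "x \<in># A'" using \<open>\<not> count A x \<le> 1\<close> by (intro count_inI) auto
    then obtain B where "A' = add_mset x B" by (meson multi_member_split)
    with A' have "A = add_mset x (add_mset x B)" by simp
    then have "p = [:-x, 1:] * ([:-x, 1:] * smult (lead_coeff p) (\<Prod>x\<in>#B. [:-x, 1:]))"
      using A(2) by simp
    then obtain q where q: "p = [:-x, 1:] * ([:-x, 1:] * q)" by metis
    have "poly (pderiv p) x = 0" "poly p x = 0"
      unfolding q pderiv_mult by (simp_all del: mult_pCons_left)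
    moreover have "pderiv p = smult (of_nat n) (monom 1 (n - 1))"
      by (simp add: p_def pderiv_diff pderiv_monom smult_monom)
    ultimately have "x ^ (n - 1) = 0" "x ^ n = 1" using assms(1) by (auto simp: poly_monom poly_p)
    then show False using assms(1) by (auto simp: power_0_left)
  qed
  have "n = card (set_mset A)"
  proof -
    have "size A = (\<Sum>x\<in>set_mset A. count A x)" by (simp add: size_multiset_overloaded_eq)
    also have "\<dots> = (\<Sum>x\<in>set_mset A. 1)"
      using count by (intro sum.cong refl antisym) (auto simp: Suc_le_eq)
    finally show ?thesis using A(1) by simp
  qed
  have sub: "set_mset A \<subseteq> {z. poly (monom 1 r - 1) z = 0}"
  proof
    fix x assume "x \<in># A"
    then have "poly (\<Prod>x\<in>#A. [:-x, 1:]) x = 0" by (auto simp: poly_prod_mset prod_mset_zero_iff)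
    then have "poly p x = 0" by (subst A(2)) simp
    then show "x \<in> {z. poly (monom 1 r - 1) z = 0}" using allr[of x] by (simp add: poly_p poly_monom)
  qed
  have deg_r: "degree (monom 1 r - 1 :: 'k poly) = r"
  proof -
    have "degree (monom 1 r + (- 1) :: 'k poly) = degree (monom 1 r :: 'k poly)"
      using r(1) by (intro degree_add_eq_left) (simp add: degree_monom_eq)
    then show ?thesis by (simp add: degree_monom_eq)
  qed
  have nz: "(monom 1 r - 1 :: 'k poly) \<noteq> 0" using deg_r r(1) by auto
  note \<open>n = card (set_mset A)\<close>
  also have "card (set_mset A) \<le> card {z. poly (monom 1 r - 1 :: 'k poly) z = 0}"
    by (rule card_mono[OF poly_roots_finite[OF nz] sub])
  also have "\<dots> \<le> r" using card_poly_roots_bound[OF nz] deg_r by simp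
  finally have "n \<le> r" .
  then show False using r by simp
qed

text \<open>
  Multiplying the summation variable by a root of unity \<open>w\<close> multiplies the sum by
  \<open>w powi k\<close>, which can be chosen different from 1.
\<close>

lemma sum_roots_of_unity_powi:
  assumes "n > 0" "\<not> int n dvd k"
  shows "(\<Sum>z\<in>{z::'k::{alg_closed_field, field_char_0}. z ^ n = 1}. z powi k) = 0"
proof -
  let ?U = "{z::'k. z ^ n = 1}"
  obtain w :: 'k where w: "w ^ n = 1" "w powi k \<noteq> 1" using exists_root_of_unity_powi_neq_1[OF assms] by blast
  have w0: "w \<noteq> 0" using w assms(1) by (auto simp: power_0_left)
  have "(\<Sum>z\<in>?U. z powi k) = (\<Sum>z\<in>?U. (w * z) powi k)"
    using w w0
    by (intro sum.reindex_bij_witness[of _ "\<lambda>z. w * z" "\<lambda>z. z / w"]) (auto simp: power_mult_distrib power_divide)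
  also have "\<dots> = w powi k * (\<Sum>z\<in>?U. z powi k)" by (simp add: power_int_mult_distrib sum_distrib_left)
  finally show ?thesis using w(2) by simp
qed

lemma finite_roots_of_unity: "n > 0 \<Longrightarrow> finite {z::'k::field. z ^ n = 1}"
proof -
  assume n: "n > 0"
  have "(monom 1 n - 1 :: 'k poly) \<noteq> 0"
  proof
    assume "(monom 1 n - 1 :: 'k poly) = 0"
    then have "coeff (monom 1 n - 1 :: 'k poly) n = 0" by simp
    then show False using n by simp
  qed
  from poly_roots_finite[OF this] show ?thesis by (simp add: poly_monom)
qed

section \<open>Rotations of the local parameter\<close>

text \<open>
  The automorphism \<open>u \<mapsto> z * u\<close> of \<open>K((u))\<close>.
\<close>

definition fls_rotate :: "'a::field \<Rightarrow> 'a fls \<Rightarrow> 'a fls" where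
  "fls_rotate z f = Abs_fls (\<lambda>k. z powi k * fls_nth f k)"

lemma nth_fls_rotate [simp]: "fls_nth (fls_rotate z f) k = z powi k * fls_nth f k"
  unfolding fls_rotate_def by (rule nth_Abs_fls_lower_bound[of "fls_subdegree f"]) auto

lemma subdegree_fls_rotate [simp]: "z \<noteq> 0 \<Longrightarrow> fls_subdegree (fls_rotate z f) = fls_subdegree f"
proof (cases "f = 0")
  case True
  then have "fls_rotate z f = 0" by (intro fls_eqI) simp
  then show ?thesis using True by simp
next
  case False
  assume "z \<noteq> 0"
  then show ?thesis using False by (intro fls_subdegree_eqI) auto
qed

lemma inj_comm_ring_hom_fls_rotate:
  assumes z: "z \<noteq> 0"
  shows "inj_comm_ring_hom (fls_rotate z)"
proof unfold_locales
  fix f g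
  show "fls_rotate z (f * g) = fls_rotate z f * fls_rotate z g"
  proof (rule fls_eqI)
    fix k
    have "z powi k = z powi i * z powi (k - i)" for i using z by (simp flip: power_int_add)
    then show "fls_nth (fls_rotate z (f * g)) k = fls_nth (fls_rotate z f * fls_rotate z g) k"
      using z by (simp add: fls_times_nth(2) sum_distrib_left mult_ac)
  qed
next
  fix f assume "fls_rotate z f = 0"
  then have "z powi k * fls_nth f k = 0" for k by (metis nth_fls_rotate fls_zero_nth)
  then show "f = 0" using z by (intro fls_eqI) auto
qed (auto intro!: fls_eqI simp: algebra_simps)

lemma fls_rotate_embed_inf:
  assumes "z ^ n = 1" "n > 0"
  shows "fls_rotate z (embed_inf n p) = embed_inf n p"
proof (rule fls_eqI)
  fix k
  have z0: "z \<noteq> 0" using assms by (auto simp: power_0_left)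
  show "fls_nth (fls_rotate z (embed_inf n p)) k = fls_nth (embed_inf n p) k"
  proof (cases "\<exists>i. k = - (int n * int i)")
    case True
    then obtain i where k: "k = - (int n * int i)" by blast
    have "z powi k = 1" unfolding k power_int_minus power_int_mult using assms by simp
    then show ?thesis by simp
  qed (simp add: nth_embed_inf_eq_0)
qed

lemma fls_rotate_0 [simp]: "fls_rotate z 0 = 0"
  by (intro fls_eqI) simp

lemma fls_rotate_mult: "fls_rotate (z * w) f = fls_rotate z (fls_rotate w f)"
  by (intro fls_eqI) (simp add: power_int_mult_distrib)

lemma fls_rotate_1 [simp]: "fls_rotate 1 f = f"
  by (intro fls_eqI) simp

section \<open>Roots of an irreducible polynomial at infinity\<close>

lemma dvd_const_if_vanishes:
  fixes q :: "'a::field poly poly"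
  assumes "map_poly (\<lambda>c. poly c a) q = 0"
  shows "[:[:-a, 1:]:] dvd q"
proof -
  have "[:-a, 1:] dvd coeff q i" for i
  proof -
    have "coeff (map_poly (\<lambda>c. poly c a) q) i = 0" by (simp add: assms)
    then show ?thesis by (simp add: coeff_map_poly poly_eq_0_iff_dvd)
  qed
  then show ?thesis by (simp add: const_poly_dvd_iff)
qed

text \<open>
  This is Gauss's lemma, in a form that uses that \<open>K\<close> is algebraically closed. Let \<open>v\<close> have the least
  degree among the nonzero polynomials that vanish at \<open>y\<close>. Pseudo-division gives \<open>c * f = q * v\<close> with
  \<open>c \<noteq> 0\<close> in \<open>K[x]\<close>. If \<open>c\<close> has the least possible degree here, it is constant: at a zero \<open>a\<close> of \<open>c\<close> the
  product \<open>q * v\<close> vanishes, so \<open>x - a\<close> divides \<open>q\<close> or \<open>v\<close> and could be cancelled. Hence \<open>v\<close> divides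
  the irreducible \<open>f\<close>, and they have the same degree.
\<close>

lemma degree_ge_of_root_of_irreducible:
  fixes f :: "'k::alg_closed_field poly poly"
  assumes hom: "inj_comm_ring_hom (e :: 'k poly \<Rightarrow> 'b::idom)"
    and irr: "irreducible f" and deg: "degree f > 0" and root: "poly (map_poly e f) y = 0"
    and w: "w \<noteq> 0" "poly (map_poly e w) y = 0"
  shows "degree f \<le> degree w"
proof -
  interpret e: inj_comm_ring_hom e by (rule hom)
  interpret pe: map_poly_inj_comm_ring_hom e ..
  \<comment> \<open>the degrees of the nonzero polynomials vanishing at \<open>y\<close>\<close>
  define A where "A m \<longleftrightarrow> (\<exists>w. w \<noteq> 0 \<and> poly (map_poly e w) y = 0 \<and> degree w = m)" for m
  define m where "m = (LEAST m. A m)"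
  have "A (degree w)" using w by (auto simp: A_def)
  then have Am: "A m" and m_le: "m \<le> degree w" unfolding m_def by (rule LeastI, rule Least_le)
  have m_min: "r = 0" if "degree r < m" "poly (map_poly e r) y = 0" for r
    using that not_less_Least[of "degree r" A] unfolding m_def[symmetric] by (auto simp: A_def)
  obtain w1 where w1: "w1 \<noteq> 0" "poly (map_poly e w1) y = 0" "degree w1 = m" using Am by (auto simp: A_def)
  have m0: "m > 0"
  proof (rule ccontr)
    assume "\<not> m > 0"
    then obtain c where c: "w1 = [:c:]" using w1 by (auto elim: degree_eq_zeroE)
    then show False using w1 by simp
  qed
  \<comment> \<open>the degrees of the possible multipliers \<open>c\<close>\<close>
  define B where "B k \<longleftrightarrow> (\<exists>c q v. c \<noteq> 0 \<and> degree c = k \<and> degree v = m \<and> v \<noteq> 0 \<and> [:c:] * f = q * v)" for k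
  have "\<exists>k. B k"
  proof -
    obtain q r where qr: "pseudo_divmod f w1 = (q, r)" by force
    let ?c = "coeff w1 (degree w1) ^ (Suc (degree f) - degree w1)"
    have eq: "smult ?c f = w1 * q + r" and r: "r = 0 \<or> degree r < degree w1"
      using pseudo_divmod[OF w1(1) qr] by auto
    have "map_poly e (smult ?c f) = map_poly e (w1 * q + r)" by (simp only: eq)
    then have "smult (e ?c) (map_poly e f) = map_poly e w1 * map_poly e q + map_poly e r"
      by (simp only: e.map_poly_hom_smult pe.hom_add pe.hom_mult)
    from arg_cong[OF this, of "\<lambda>p. poly p y"]
    have "poly (map_poly e r) y = 0" using root w1 by simp
    then have "r = 0" using m_min r w1 by auto
    then have "[:?c:] * f = q * w1" using eq by (simp add: mult.commute)
    moreover have "?c \<noteq> 0" using leading_coeff_neq_0[OF w1(1)] by (rule power_not_zero)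
    ultimately show ?thesis using w1 unfolding B_def by blast
  qed
  then have "B (LEAST k. B k)" by (rule LeastI_ex)
  then obtain c q v where cqv: "c \<noteq> 0" "degree c = (LEAST k. B k)" "degree v = m" "v \<noteq> 0" "[:c:] * f = q * v"
    unfolding B_def[of "LEAST k. B k"] by blast
  have "degree c = 0"
  proof (rule ccontr)
    assume "degree c \<noteq> 0"
    then obtain a where "poly c a = 0" using alg_closed_imp_poly_has_root by blast
    then obtain c' where c': "c = [:-a, 1:] * c'" by (auto simp: poly_eq_0_iff_dvd)
    have c'0: "c' \<noteq> 0" using c' cqv by auto
    have "degree ([:-a, 1:] * c') = degree [:-a, 1:] + degree c'"
      using c'0 by (intro degree_mult_eq) auto
    then have "degree c' < degree c" by (simp add: c' del: mult_pCons_left)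
    then have nB: "\<not> B (degree c')" using cqv(2) not_less_Least by metis
    interpret a: comm_ring_hom "\<lambda>c. poly c a" by unfold_locales auto
    interpret pa: map_poly_comm_ring_hom "\<lambda>c. poly c a" ..
    have "map_poly (\<lambda>c. poly c a) [:c:] = 0"
      using \<open>poly c a = 0\<close> by (intro poly_eqI) (simp add: coeff_map_poly coeff_pCons split: nat.split)
    then have "map_poly (\<lambda>c. poly c a) ([:c:] * f) = 0"
      by (simp only: pa.hom_mult mult_zero_left)
    then have "map_poly (\<lambda>c. poly c a) q * map_poly (\<lambda>c. poly c a) v = 0"
      using cqv(5) by (simp only: pa.hom_mult)
    then consider "[:[:-a, 1:]:] dvd q" | "[:[:-a, 1:]:] dvd v"
      using dvd_const_if_vanishes by (metis mult_eq_0_iff)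
    then obtain q' v' where qv': "q' * v' * [:[:-a, 1:]:] = q * v" "v' \<noteq> 0" "degree v' = m"
    proof cases
      case 1
      then obtain q' where "q = [:[:-a, 1:]:] * q'" by (rule dvdE)
      then show thesis using cqv that[of q' v] by (simp add: mult_ac del: mult_pCons_left mult_pCons_right)
    next
      case 2
      then obtain v' where v': "v = [:[:-a, 1:]:] * v'" by (rule dvdE)
      have v'0: "v' \<noteq> 0" using v' cqv by auto
      then have "degree v' = m" using cqv(3) unfolding v' by (subst (asm) degree_mult_eq) auto
      with v' v'0 show thesis using that[of q v'] by (simp add: mult_ac del: mult_pCons_left mult_pCons_right)
    qed
    have "[:[:-a, 1:]:] * ([:c':] * f) = [:[:-a, 1:]:] * (q' * v')"
      using cqv(5) qv'(1) unfolding c' by (simp add: mult_ac)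
    then have "[:c':] * f = q' * v'" by (subst (asm) mult_left_cancel) auto
    then show False using nB c'0 qv' by (auto simp: B_def)
  qed
  then obtain c0 where c0: "c = [:c0:]" "c0 \<noteq> 0" using cqv(1) by (auto elim: degree_eq_zeroE)
  have "f = [:[:inverse c0:]:] * ([:c:] * f)" using c0 by (simp flip: one_pCons)
  then have fqv: "f = ([:[:inverse c0:]:] * q) * v" using cqv(5) by (simp only: mult.assoc)
  have "\<not> v dvd 1" using cqv m0 by (auto simp: poly_dvd_1)
  then have "[:[:inverse c0:]:] * q dvd 1" using irr fqv irreducibleD by blast
  then have "degree ([:[:inverse c0:]:] * q) = 0" using poly_dvd_1 by blast
  moreover have "degree f = degree ([:[:inverse c0:]:] * q) + degree v"
    by (subst fqv, rule degree_mult_eq) (use fqv irr in auto)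
  ultimately show ?thesis using cqv(3) m_le by simp
qed

lemma lead_coeff_degree_prod_linear:
  fixes zs :: "'a::idom list"
  shows "lead_coeff (prod_linear zs) = 1" "degree (prod_linear zs) = length zs"
proof -
  have "lead_coeff (prod_linear zs) = 1 \<and> degree (prod_linear zs) = length zs"
  proof (induction zs)
    case (Cons a zs)
    then have "(prod_linear zs) \<noteq> 0" by auto
    then have "degree ([:-a, 1:] * (prod_linear zs)) = 1 + length zs"
      using Cons by (subst degree_mult_eq) auto
    moreover have "lead_coeff ([:-a, 1:] * (prod_linear zs)) = 1"
      unfolding lead_coeff_mult using conjunct1[OF Cons.IH] by simp
    ultimately show ?case by (simp del: mult_pCons_left)
  qed simp
  then show "lead_coeff (prod_linear zs) = 1" "degree (prod_linear zs) = length zs"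
    by auto
qed

lemma poly_prod_linear: "poly (prod_linear zs) y = (\<Prod>z\<leftarrow>zs. y - z)"
  for y :: "'a::comm_ring_1"
  by (induction zs) (simp_all del: mult_pCons_left)

text \<open>
  The list \<open>zs\<close> consists of the roots of \<open>f\<close> over \<open>K((u))\<close>, where \<open>x = u^(-n)\<close>; they are the branches
  of the curve \<open>f = 0\<close> over \<open>x = \<infinity>\<close>, with conjugate branches listed separately. Indexing by a list
  allows matrices whose columns belong to the roots. Throughout, \<open>e\<close> and \<open>F\<close> denote the expansions at infinity of
  coefficients and of \<open>f\<close> itself, and \<open>U\<close> is the group of rotations \<open>u \<mapsto> \<zeta> * u\<close> that fix \<open>x\<close>.
\<close>

locale puiseux_roots =
  fixes f :: "'k::{alg_closed_field, field_char_0} poly poly" and n :: nat and zs :: "'k fls list"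
  assumes irr: "irreducible f" and deg_pos: "degree f > 0" and n_pos: "n > 0"
    and split: "map_poly (embed_inf n) f = smult (embed_inf n (lead_coeff f)) (prod_linear zs)"
begin

abbreviation "d \<equiv> degree f"
abbreviation "e \<equiv> embed_inf n :: 'k poly \<Rightarrow> 'k fls"
abbreviation "F \<equiv> map_poly (embed_inf n) f"
abbreviation "Z \<equiv> set zs"
abbreviation "U \<equiv> {\<zeta>::'k. \<zeta> ^ n = 1}"

definition ev :: "'k poly poly \<Rightarrow> 'k fls \<Rightarrow> 'k fls" where "ev w y = poly (map_poly e w) y"

sublocale e: inj_comm_ring_hom e by (rule inj_comm_ring_hom_embed_inf[OF n_pos])
sublocale pe: map_poly_inj_comm_ring_hom e ..

lemma f_nz: "f \<noteq> 0" using deg_pos by auto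
lemma e_lc_nz: "e (lead_coeff f) \<noteq> 0" using f_nz by simp

lemma ev_add: "ev (v + w) y = ev v y + ev w y" by (simp add: ev_def pe.hom_add)
lemma ev_diff: "ev (v - w) y = ev v y - ev w y" by (simp add: ev_def pe.hom_minus)
lemma ev_mult: "ev (v * w) y = ev v y * ev w y" by (simp add: ev_def pe.hom_mult)
lemma ev_power: "ev (w ^ k) y = ev w y ^ k" by (simp add: ev_def pe.hom_power)
lemma ev_sum: "ev (\<Sum>i\<in>A. g i) y = (\<Sum>i\<in>A. ev (g i) y)" by (simp add: ev_def pe.hom_sum poly_sum)
lemma ev_smult: "ev (smult c w) y = e c * ev w y" by (simp add: ev_def e.map_poly_hom_smult)
lemma ev_const: "ev [:c:] y = e c" by (simp add: ev_def e.map_poly_pCons_hom)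
lemma ev_1: "ev 1 y = 1" by (simp add: ev_def)
lemma ev_pCons: "ev (pCons c w) y = e c + y * ev w y" by (simp add: ev_def e.map_poly_pCons_hom)

lemma length_zs: "length zs = d"
proof -
  have "degree F = degree (prod_linear zs)" using e_lc_nz by (simp only: split degree_smult_eq if_False)
  also have "\<dots> = length zs" by (rule lead_coeff_degree_prod_linear)
  finally show ?thesis by simp
qed

lemma ev_f: "y \<in> Z \<longleftrightarrow> ev f y = 0"
proof -
  have "poly (prod_linear zs) y = 0 \<longleftrightarrow> y \<in> set zs" by (induction zs) auto
  then show ?thesis using e_lc_nz unfolding ev_def split poly_smult mult_eq_0_iff by blast
qed

lemma ev_nz:
  assumes "w \<noteq> 0" "degree w < d" "y \<in> Z"
  shows "ev w y \<noteq> 0"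
proof
  assume "ev w y = 0"
  then have "d \<le> degree w"
    using degree_ge_of_root_of_irreducible[OF e.inj_comm_ring_hom_axioms irr deg_pos, of y w] assms ev_f
    by (simp add: ev_def)
  then show False using assms by simp
qed

lemma distinct_zs: "distinct zs"
proof (rule ccontr)
  assume "\<not> distinct zs"
  then obtain xs ys us y where zs: "zs = xs @ [y] @ ys @ [y] @ us" using not_distinct_decomp by blast
  then have "F = [:-y, 1:] * ([:-y, 1:] * smult (e (lead_coeff f)) (prod_linear (xs @ ys @ us)))"
    unfolding split by (simp add: mult_ac del: mult_pCons_left mult_pCons_right)
  then obtain q where q: "F = [:-y, 1:] * ([:-y, 1:] * q)" by blast
  interpret ei: idom_hom e ..
  have "poly (pderiv F) y = 0" unfolding q pderiv_mult by (simp del: mult_pCons_left)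
  then have "ev (pderiv f) y = 0" by (simp add: ev_def ei.map_poly_pderiv)
  moreover have "pderiv f \<noteq> 0" using deg_pos by (simp add: pderiv_eq_0_iff)
  ultimately show False using ev_nz[of "pderiv f" y] deg_pos zs by (simp add: degree_pderiv)
qed

lemma card_Z: "card Z = d" using distinct_card[OF distinct_zs] length_zs by simp

lemma F_prod: "F = smult (e (lead_coeff f)) (\<Prod>z\<in>Z. [:-z, 1:])"
  by (simp add: split prod.distinct_set_conv_list[OF distinct_zs])

text \<open>
  Rotations in \<open>U\<close> fix the image of \<open>K[x]\<close>; in particular they permute the roots.
\<close>

lemma rotate_ev:
  assumes "\<zeta> \<in> U" shows "fls_rotate \<zeta> (ev w y) = ev w (fls_rotate \<zeta> y)"
proof -
  have "\<zeta> \<noteq> 0" using assms n_pos by (auto simp: power_0_left)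
  then interpret r: inj_comm_ring_hom "fls_rotate \<zeta>" by (rule inj_comm_ring_hom_fls_rotate)
  have "map_poly (fls_rotate \<zeta>) (map_poly e w) = map_poly e w"
    using assms n_pos by (intro poly_eqI) (simp add: fls_rotate_embed_inf)
  then show ?thesis unfolding ev_def by (metis r.poly_map_poly)
qed

lemma rotate_Z: "\<zeta> \<in> U \<Longrightarrow> y \<in> Z \<Longrightarrow> fls_rotate \<zeta> y \<in> Z"
  using rotate_ev[of \<zeta> f y] by (simp add: ev_f)

lemma bij_rotate: 
  assumes "\<zeta> \<in> U" shows "bij_betw (fls_rotate \<zeta>) Z Z"
proof (rule bij_betwI[of _ _ _ "fls_rotate (inverse \<zeta>)"])
  have z: "\<zeta> \<noteq> 0" "inverse \<zeta> \<in> U" using assms n_pos by (auto simp: power_0_left power_inverse)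
  show "fls_rotate \<zeta> \<in> Z \<rightarrow> Z" "fls_rotate (inverse \<zeta>) \<in> Z \<rightarrow> Z" using rotate_Z assms z by auto
  show "fls_rotate (inverse \<zeta>) (fls_rotate \<zeta> x) = x" "fls_rotate \<zeta> (fls_rotate (inverse \<zeta>) x) = x" for x
    using z by (simp_all flip: fls_rotate_mult)
qed

end

lemma puiseux_rootsI:
  fixes f :: "'k::{alg_closed_field, field_char_0} poly poly"
  assumes "irreducible f" "degree f > 0" "n > 0"
    and eq: "map_poly (embed_inf n) f = smult c (prod_linear zs)"
  shows "puiseux_roots f n zs"
proof -
  interpret en: inj_comm_ring_hom "embed_inf n :: 'k poly \<Rightarrow> 'k fls"
    by (rule inj_comm_ring_hom_embed_inf[OF \<open>n > 0\<close>])
  have "c = embed_inf n (lead_coeff f)"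
    using arg_cong[OF eq, of lead_coeff]
    by (simp only: en.hom_lead_coeff lead_coeff_smult lead_coeff_degree_prod_linear(1) mult_1_right)
  with assms show ?thesis by unfold_locales simp_all
qed

lemma ex_puiseux_roots:
  fixes f :: "'k::{alg_closed_field, field_char_0} poly poly"
  assumes irr: "irreducible f" and deg: "degree f > 0"
  shows "\<exists>n zs. puiseux_roots f n zs"
proof -
  interpret e1: inj_comm_ring_hom "embed_inf 1 :: 'k poly \<Rightarrow> 'k fls" by (rule inj_comm_ring_hom_embed_inf) simp
  have "map_poly (embed_inf 1) f \<noteq> 0" using deg by (metis e1.degree_map_poly_hom degree_0 less_irrefl)
  then obtain n c zs where n: "n > 0"
    and "map_compose_power n (map_poly (embed_inf 1) f) = smult c (prod_linear zs)"
    using puiseux_splits by blast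
  moreover interpret en: inj_comm_ring_hom "embed_inf n :: 'k poly \<Rightarrow> 'k fls"
    by (rule inj_comm_ring_hom_embed_inf[OF n])
  have "map_compose_power n (map_poly (embed_inf 1) f) = map_poly (embed_inf n) f"
    by (intro poly_eqI) (simp only: e1.coeff_map_poly_hom en.coeff_map_poly_hom
        coeff_map_poly[of "\<lambda>c. fls_compose_power c n", OF fls_compose_power_0_left] compose_power_embed_inf[OF n])
  ultimately have eq: "map_poly (embed_inf n) f = smult c (prod_linear zs)" by simp
  have "puiseux_roots f n zs" using irr deg n eq by (rule puiseux_rootsI)
  then show ?thesis by blast
qed

section \<open>The ring of a binary form\<close>

context puiseux_roots
begin

text \<open>
  The intermediate results of Horner's scheme for \<open>f\<close>, from \<open>lead_coeff f\<close> for \<open>i = 0\<close> to \<open>f\<close> for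
  \<open>i = d\<close>. At a root \<open>y\<close> of \<open>f\<close> they are the coefficients of \<open>f / (Y - y)\<close> and hence integral over \<open>K[x]\<close>,
  even if \<open>y\<close> is not.
\<close>

definition horner :: "nat \<Rightarrow> 'k poly poly" where "horner i = poly_shift (d - i) f"

text \<open>
  The \<open>K[x]\<close>-module spanned by 1 and the Horner polynomials. Modulo \<open>f\<close> it is a ring, the one
  attached to the binary form \<open>f\<close> (Birch and Merriman, Nakagawa), whose discriminant is that of \<open>f\<close>. The
  span of the powers of \<open>y\<close> has these properties only if \<open>f\<close> is monic.
\<close>

definition form_ring :: "'k poly poly set" where
  "form_ring = {[:c0:] + (\<Sum>i\<in>{1..<d}. smult (c i) (horner i)) | c0 c. True}"

text \<open>
  Membership in this ring for polynomials that are read modulo \<open>f\<close>.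
\<close>

definition form_ring_mod :: "'k poly poly \<Rightarrow> bool" where
  "form_ring_mod w \<longleftrightarrow> (\<exists>r\<in>form_ring. f dvd (w - r))"

lemma degree_horner: "i \<le> d \<Longrightarrow> degree (horner i) = i"
  by (intro antisym[OF degree_le le_degree]) (auto simp: horner_def coeff_poly_shift coeff_eq_0 f_nz)

lemma horner_0: "horner 0 = [:lead_coeff f:]"
  by (rule poly_eqI) (auto simp: horner_def coeff_poly_shift coeff_pCons coeff_eq_0 split: nat.splits)

lemma horner_d: "horner d = f"
  by (rule poly_eqI) (auto simp: horner_def coeff_poly_shift)

lemma horner_Suc: "i < d \<Longrightarrow> horner (Suc i) = pCons (coeff f (d - Suc i)) (horner i)"
  by (rule poly_eqI) (auto simp: horner_def coeff_poly_shift coeff_pCons Suc_diff_Suc split: nat.splits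
      intro!: arg_cong[of _ _ "coeff f"])

lemma form_ringI: "w = [:c0:] + (\<Sum>i\<in>{1..<d}. smult (c i) (horner i)) \<Longrightarrow> w \<in> form_ring"
  unfolding form_ring_def by blast

lemma form_ringE:
  assumes "w \<in> form_ring" obtains c0 c where "w = [:c0:] + (\<Sum>i\<in>{1..<d}. smult (c i) (horner i))"
  using assms unfolding form_ring_def by blast

lemma form_ring_add: "v \<in> form_ring \<Longrightarrow> w \<in> form_ring \<Longrightarrow> v + w \<in> form_ring"
proof -
  assume "v \<in> form_ring" "w \<in> form_ring"
  then obtain a0 a b0 b where "v = [:a0:] + (\<Sum>i\<in>{1..<d}. smult (a i) (horner i))"
    "w = [:b0:] + (\<Sum>i\<in>{1..<d}. smult (b i) (horner i))" by (auto elim!: form_ringE)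
  then show ?thesis
    by (intro form_ringI[of _ "a0 + b0" "\<lambda>i. a i + b i"]) (simp add: smult_add_left sum.distrib)
qed

lemma form_ring_smult: "w \<in> form_ring \<Longrightarrow> smult a w \<in> form_ring"
proof -
  assume "w \<in> form_ring"
  then obtain b0 b where "w = [:b0:] + (\<Sum>i\<in>{1..<d}. smult (b i) (horner i))" by (auto elim!: form_ringE)
  then show ?thesis
    by (intro form_ringI[of _ "a * b0" "\<lambda>i. a * b i"]) (simp add: smult_add_right smult_sum2)
qed

lemma form_ring_const: "[:a:] \<in> form_ring" by (rule form_ringI[of _ a "\<lambda>_. 0"]) simp

lemma form_ring_sum: "(\<And>i. i \<in> A \<Longrightarrow> g i \<in> form_ring) \<Longrightarrow> (\<Sum>i\<in>A. g i) \<in> form_ring"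
  by (induction A rule: infinite_finite_induct) (auto intro: form_ring_add form_ring_const[of 0, simplified])

lemma form_ring_horner: "i < d \<Longrightarrow> horner i \<in> form_ring"
proof (cases "i = 0")
  case False
  assume "i < d"
  then have "(\<Sum>j\<in>{1..<d}. smult (if j = i then 1 else 0) (horner j)) = horner i"
    using False by (subst sum.cong[OF refl, of _ _ "\<lambda>j. if j = i then horner j else 0"]) auto
  then show ?thesis by (intro form_ringI[of _ 0 "\<lambda>j. if j = i then 1 else 0"]) simp
qed (simp add: horner_0 form_ring_const)

lemma degree_form_ring: "w \<in> form_ring \<Longrightarrow> degree w < d"
  using deg_pos by (elim form_ringE) (auto intro!: degree_add_less degree_sum_less le_less_trans[OF degree_smult_le]
      simp: degree_horner)

lemma form_ring_mod_of_form_ring: "w \<in> form_ring \<Longrightarrow> form_ring_mod w" unfolding form_ring_mod_def by (intro bexI[of _ w]) auto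

lemma form_ring_mod_dvd: "f dvd w \<Longrightarrow> form_ring_mod w" unfolding form_ring_mod_def using form_ring_const[of 0] by (intro bexI[of _ 0]) auto

lemma form_ring_mod_add: "form_ring_mod v \<Longrightarrow> form_ring_mod w \<Longrightarrow> form_ring_mod (v + w)"
proof -
  assume "form_ring_mod v" "form_ring_mod w"
  then obtain r s where "r \<in> form_ring" "s \<in> form_ring" "f dvd (v - r)" "f dvd (w - s)" unfolding form_ring_mod_def by blast
  moreover then have "f dvd ((v - r) + (w - s))" by (intro dvd_add)
  moreover have "(v - r) + (w - s) = (v + w) - (r + s)" by simp
  ultimately show ?thesis unfolding form_ring_mod_def using form_ring_add by metis
qed

lemma form_ring_mod_smult: "form_ring_mod w \<Longrightarrow> form_ring_mod (smult a w)"
proof -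
  assume "form_ring_mod w"
  then obtain s where "s \<in> form_ring" "f dvd (w - s)" unfolding form_ring_mod_def by blast
  moreover then have "f dvd smult a (w - s)" by (intro dvd_smult)
  ultimately show ?thesis unfolding form_ring_mod_def using form_ring_smult by (metis smult_diff_right)
qed

lemma form_ring_mod_sum: "(\<And>i. i \<in> A \<Longrightarrow> form_ring_mod (g i)) \<Longrightarrow> form_ring_mod (\<Sum>i\<in>A. g i)"
  by (induction A rule: infinite_finite_induct) (auto intro: form_ring_mod_add form_ring_mod_dvd)

lemma form_ring_mod_cong: "f dvd (v - w) \<Longrightarrow> form_ring_mod w \<Longrightarrow> form_ring_mod v"
proof -
  assume "f dvd (v - w)" "form_ring_mod w"
  then have "form_ring_mod ((v - w) + w)" by (intro form_ring_mod_add) (rule form_ring_mod_dvd)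
  then show ?thesis by simp
qed

lemma form_ring_mod_horner: "i \<le> d \<Longrightarrow> form_ring_mod (horner i)"
  by (cases "i = d") (simp_all add: horner_d form_ring_mod_dvd form_ring_mod_of_form_ring form_ring_horner)

text \<open>
  By the recursion \<open>horner (i + 1) = y * horner i + a\<close> a factor \<open>y\<close> can be moved from one Horner
  polynomial to the other, at the expense of terms linear in Horner polynomials. Repeating this ends at the constant
  \<open>horner 0\<close> or at \<open>horner d = f\<close>.
\<close>

lemma form_ring_mod_horner_mult_horner: "i \<le> d \<Longrightarrow> j \<le> d \<Longrightarrow> form_ring_mod (horner i * horner j)"
proof (induction i arbitrary: j)
  case 0
  have "form_ring_mod (horner j)" using 0 by (intro form_ring_mod_horner)
  then show ?case by (simp add: horner_0 form_ring_mod_smult)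
next
  case (Suc i)
  show ?case
  proof (cases "j = d")
    case True then show ?thesis by (simp add: horner_d form_ring_mod_dvd)
  next
    case False
    then have j: "j < d" using Suc.prems by simp
    let ?a = "coeff f (d - Suc i)" and ?b = "coeff f (d - Suc j)"
    have "horner (Suc i) * horner j = horner i * horner (Suc j) + (smult (- ?b) (horner i) + smult ?a (horner j))"
      using Suc.prems j by (simp add: horner_Suc algebra_simps)
    moreover have "form_ring_mod \<dots>" using Suc.prems j by (intro form_ring_mod_add form_ring_mod_smult form_ring_mod_horner Suc.IH) auto
    ultimately show ?thesis by simp
  qed
qed

lemma form_ring_mod_mult: "form_ring_mod v \<Longrightarrow> form_ring_mod w \<Longrightarrow> form_ring_mod (v * w)"
proof -
  assume "form_ring_mod v" "form_ring_mod w"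
  then obtain r s where rs: "r \<in> form_ring" "s \<in> form_ring" "f dvd (v - r)" "f dvd (w - s)" unfolding form_ring_mod_def by blast
  have 1: "form_ring_mod (r * horner j)" if "j < d" for j
  proof -
    obtain a0 a where "r = [:a0:] + (\<Sum>i\<in>{1..<d}. smult (a i) (horner i))" using rs(1) by (rule form_ringE)
    then have "r * horner j = smult a0 (horner j) + (\<Sum>i\<in>{1..<d}. smult (a i) (horner i * horner j))"
      by (simp add: distrib_right sum_distrib_right)
    moreover have "form_ring_mod \<dots>" using that
      by (intro form_ring_mod_add form_ring_mod_sum form_ring_mod_smult form_ring_mod_horner_mult_horner form_ring_mod_of_form_ring form_ring_horner) auto
    ultimately show ?thesis by simp
  qed
  have "form_ring_mod (r * s)"
  proof -
    obtain a0 a where "s = [:a0:] + (\<Sum>i\<in>{1..<d}. smult (a i) (horner i))" using rs(2) by (rule form_ringE)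
    then have "r * s = smult a0 r + (\<Sum>i\<in>{1..<d}. smult (a i) (r * horner i))"
      by (simp add: distrib_left sum_distrib_left)
    moreover have "form_ring_mod \<dots>" using rs
      by (intro form_ring_mod_add form_ring_mod_sum form_ring_mod_smult 1 form_ring_mod_of_form_ring) auto
    ultimately show ?thesis by simp
  qed
  moreover have "f dvd (v * w - r * s)"
  proof -
    have "v * w - r * s = (v - r) * w + r * (w - s)" by (simp add: algebra_simps)
    then show ?thesis using rs by simp
  qed
  ultimately show ?thesis by (metis form_ring_mod_cong)
qed

lemma form_ring_mod_power: "form_ring_mod w \<Longrightarrow> form_ring_mod (w ^ k)"
proof (induction k)
  case 0 show ?case using form_ring_const[of 1] by (simp add: form_ring_mod_of_form_ring flip: one_pCons)
qed (auto intro: form_ring_mod_mult)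

definition root_quotient :: "'k fls \<Rightarrow> 'k fls poly" where "root_quotient y = synthetic_div F y"

lemma F_eq_root_quotient: "y \<in> Z \<Longrightarrow> F = [:-y, 1:] * root_quotient y"
  using synthetic_div_correct'[of y F] ev_f[of y] by (simp add: root_quotient_def ev_def)

lemma degree_root_quotient: "y \<in> Z \<Longrightarrow> degree (root_quotient y) = d - 1"
  by (simp add: root_quotient_def degree_synthetic_div)

lemma coeff_root_quotient:
  assumes y: "y \<in> Z" shows "i < d \<Longrightarrow> coeff (root_quotient y) (d - Suc i) = ev (horner i) y"
proof (induction i)
  case 0
  have "coeff F d = coeff (root_quotient y) (d - 1) - y * coeff (root_quotient y) d"
    using deg_pos by (subst F_eq_root_quotient[OF y], cases d) (simp_all add: coeff_pCons)
  moreover have "coeff (root_quotient y) d = 0" using degree_root_quotient[OF y] deg_pos by (intro coeff_eq_0) simp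
  ultimately show ?case by (simp add: horner_0 ev_const)
next
  case (Suc i)
  then obtain m where m: "d = Suc (Suc i) + m" by (metis Suc_leI le_iff_add)
  have "coeff F (Suc m) = coeff (root_quotient y) m - y * coeff (root_quotient y) (Suc m)"
    by (subst F_eq_root_quotient[OF y]) (simp add: coeff_pCons)
  then show ?case using Suc m by (simp add: horner_Suc ev_pCons algebra_simps)
qed

lemma root_quotient_prod: "y \<in> Z \<Longrightarrow> root_quotient y = smult (e (lead_coeff f)) (\<Prod>z\<in>Z - {y}. [:-z, 1:])"
proof -
  assume y: "y \<in> Z"
  have "(\<Prod>z\<in>Z. [:-z, 1:]) = [:-y, 1:] * (\<Prod>z\<in>Z - {y}. [:-z, 1:])"
    using y by (intro prod.remove) auto
  then have "[:-y, 1:] * root_quotient y = [:-y, 1:] * smult (e (lead_coeff f)) (\<Prod>z\<in>Z - {y}. [:-z, 1:])"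
    using F_eq_root_quotient[OF y] F_prod by (simp del: mult_pCons_left)
  then show ?thesis by (subst (asm) mult_left_cancel) auto
qed

lemma pderiv_F: "pderiv F = (\<Sum>y\<in>Z. root_quotient y)"
  by (simp add: F_prod pderiv_smult pderiv_prod pderiv_pCons smult_sum2 root_quotient_prod)

text \<open>
  The sum over the roots of \<open>F / (Y - y)\<close> is \<open>F'\<close>, and the trace of \<open>horner i\<close> is one coefficient of this
  sum.
\<close>

lemma trace_horner: "i < d \<Longrightarrow> (\<Sum>y\<in>Z. ev (horner i) y) = e (of_nat (d - i) * coeff f (d - i))"
proof -
  assume i: "i < d"
  have "(\<Sum>y\<in>Z. ev (horner i) y) = coeff (pderiv F) (d - Suc i)"
    using i by (simp add: pderiv_F coeff_sum coeff_root_quotient)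
  also have "\<dots> = of_nat (d - i) * e (coeff f (d - i))"
    using i by (simp add: coeff_pderiv Suc_diff_Suc)
  finally show ?thesis by (simp add: e.hom_mult e.hom_of_nat)
qed

lemma trace_form_ring: "w \<in> form_ring \<Longrightarrow> (\<Sum>y\<in>Z. ev w y) \<in> range e"
proof -
  assume "w \<in> form_ring"
  then obtain c0 c where w: "w = [:c0:] + (\<Sum>i\<in>{1..<d}. smult (c i) (horner i))" by (rule form_ringE)
  have "(\<Sum>y\<in>Z. ev w y) = of_nat d * e c0 + (\<Sum>y\<in>Z. \<Sum>i\<in>{1..<d}. e (c i) * ev (horner i) y)"
    by (simp add: w ev_add ev_const ev_sum ev_smult sum.distrib card_Z)
  also have "(\<Sum>y\<in>Z. \<Sum>i\<in>{1..<d}. e (c i) * ev (horner i) y) = (\<Sum>i\<in>{1..<d}. e (c i) * (\<Sum>y\<in>Z. ev (horner i) y))"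
    by (subst sum.swap) (simp add: sum_distrib_left)
  also have "\<dots> = (\<Sum>i\<in>{1..<d}. e (c i * (of_nat (d - i) * coeff f (d - i))))"
    by (intro sum.cong refl) (simp add: trace_horner e.hom_mult)
  also have "of_nat d * e c0 + \<dots> = e (of_nat d * c0 + (\<Sum>i\<in>{1..<d}. c i * (of_nat (d - i) * coeff f (d - i))))"
    by (simp add: e.hom_add e.hom_mult e.hom_sum e.hom_of_nat)
  finally show ?thesis by blast
qed

lemma trace_form_ring_mod: "form_ring_mod w \<Longrightarrow> (\<Sum>y\<in>Z. ev w y) \<in> range e"
proof -
  assume "form_ring_mod w"
  then obtain r q where r: "r \<in> form_ring" "w - r = f * q" unfolding form_ring_mod_def by (auto elim!: dvdE)
  have "ev w y = ev r y" if "y \<in> Z" for y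
    using arg_cong[OF r(2), of "\<lambda>w. ev w y"] ev_f[of y] that by (simp add: ev_diff ev_mult)
  then show ?thesis using trace_form_ring[OF r(1)] by simp
qed

text \<open>
  A function on the curve without poles is constant. The power sums of the values of \<open>w\<close> at the roots are
  traces, so they lie in \<open>K[x]\<close>; as they are bounded at infinity, they are constants. Therefore the
  values and their constant terms have equal power sums, and, in characteristic zero, agree up to order. So \<open>w\<close> takes
  a constant value at some root, and because \<open>f\<close> is irreducible and \<open>w\<close> has smaller degree, \<open>w\<close> is
  this constant.
\<close>

lemma bounded_imp_const:
  assumes w: "w \<in> form_ring" and bdd: "\<And>y k. y \<in> Z \<Longrightarrow> k < 0 \<Longrightarrow> fls_nth (ev w y) k = 0"
  shows "\<exists>c. w = [:[:c:]:]"
proof -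
  interpret fl: comm_ring_hom "fps_to_fls :: 'k fps \<Rightarrow> 'k fls"
    by unfold_locales (auto simp: fls_times_fps_to_fls)
  interpret co: comm_ring_hom "fls_const :: 'k \<Rightarrow> 'k fls"
    by unfold_locales (auto simp: fls_const_mult_const fls_plus_const)
  have "\<exists>u. ev w y = fps_to_fls u" if "y \<in> Z" for y
    by (rule exI[of _ "Abs_fps (\<lambda>k. fls_nth (ev w y) (int k))"], rule fls_eqI) (use bdd that in auto)
  then obtain u where u: "\<And>y. y \<in> Z \<Longrightarrow> ev w y = fps_to_fls (u y)" by metis
  define c where "c y = fps_nth (u y) 0" for y
  have pow: "(\<Sum>y\<in>Z. ev w y ^ k) = (\<Sum>y\<in>Z. fls_const (c y) ^ k)" for k
  proof -
    have "(\<Sum>y\<in>Z. ev w y ^ k) \<in> range e"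
      using trace_form_ring_mod[OF form_ring_mod_power[OF form_ring_mod_of_form_ring[OF w]], of k] by (simp add: ev_power)
    then obtain p where p: "(\<Sum>y\<in>Z. ev w y ^ k) = e p" by blast
    have "(\<Sum>y\<in>Z. ev w y ^ k) = fps_to_fls (\<Sum>y\<in>Z. u y ^ k)"
      by (simp add: u fps_to_fls_power fl.hom_sum)
    with p have ep: "e p = fps_to_fls (\<Sum>y\<in>Z. u y ^ k)" by simp
    have "coeff p i = 0" if "i > 0" for i
      using nth_embed_inf_mult[OF n_pos, of p i] n_pos that unfolding ep by simp
    then have "p = [:coeff p 0:]" by (intro poly_eqI) (auto simp: coeff_pCons split: nat.splits)
    moreover have "coeff p 0 = (\<Sum>y\<in>Z. c y ^ k)"
      using nth_embed_inf_0[OF n_pos, of p] unfolding ep by (simp add: c_def fps_sum_nth fps_power_zeroth)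
    ultimately have "e p = fls_const (\<Sum>y\<in>Z. c y ^ k)" by (metis embed_inf_const)
    then show ?thesis using p by (simp add: fls_const_power co.hom_sum)
  qed
  have lin: "(\<Sum>y\<in>Z. poly q (ev w y)) = (\<Sum>y\<in>Z. poly q (fls_const (c y)))" for q
  proof -
    have "(\<Sum>y\<in>Z. poly q (v y)) = (\<Sum>k\<le>degree q. coeff q k * (\<Sum>y\<in>Z. v y ^ k))" for v :: "'k fls \<Rightarrow> 'k fls"
      by (subst sum_distrib_left, subst sum.swap) (simp add: poly_altdef)
    then show ?thesis by (simp only: pow)
  qed
  obtain y0 where y0: "y0 \<in> Z" using deg_pos card_Z by (metis card.empty ex_in_conv less_irrefl)
  let ?v = "ev w y0"
  define A where "A = (ev w ` Z \<union> (\<lambda>y. fls_const (c y)) ` Z) - {?v}"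
  \<comment> \<open>\<open>q\<close> vanishes at all values and all constant terms except \<open>?v\<close>, so it detects whether \<open>?v\<close> is a constant term\<close>
  define q where "q = (\<Prod>a\<in>A. [:-a, 1:])"
  have fin: "finite A" by (simp add: A_def)
  have q0: "poly q a = 0 \<longleftrightarrow> a \<in> A" for a
    using fin by (auto simp: q_def poly_prod)
  have "\<exists>y\<in>Z. fls_const (c y) = ?v"
  proof (rule ccontr)
    assume no: "\<not> ?thesis"
    have "(\<Sum>y\<in>Z. poly q (fls_const (c y))) = 0"
      using no by (intro sum.neutral) (auto simp: q0 A_def)
    moreover have "(\<Sum>y\<in>Z. poly q (ev w y)) = (\<Sum>y\<in>Z. if ev w y = ?v then poly q ?v else 0)"
      by (intro sum.cong refl) (auto simp: q0 A_def)
    moreover have "\<dots> = of_nat (card {y\<in>Z. ev w y = ?v}) * poly q ?v"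
      by (simp add: sum.If_cases Int_def)
    moreover have "poly q ?v \<noteq> 0" by (simp add: q0 A_def)
    ultimately have "card {y\<in>Z. ev w y = ?v} = 0" using lin[of q] by simp
    then show False using y0 by auto
  qed
  then obtain y where "fls_const (c y) = ?v" by blast
  then have "ev (w - [:[:c y:]:]) y0 = 0" by (simp add: ev_diff ev_const embed_inf_const)
  moreover have "degree (w - [:[:c y:]:]) < d"
    using degree_form_ring[OF w] deg_pos by (intro degree_diff_less) auto
  ultimately have "w - [:[:c y:]:] = 0" using ev_nz y0 by blast
  then show ?thesis by auto
qed

end

section \<open>Resultant and discriminant in terms of the roots\<close>

lemma det_scale_columns:
  fixes A :: "'a::comm_ring_1 mat"
  assumes A: "A \<in> carrier_mat m m"
  shows "det (mat m m (\<lambda>(i, j). A $$ (i, j) * g j)) = det A * (\<Prod>j<m. g j)"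
proof -
  let ?D = "mat m m (\<lambda>(i, j). if i = j then g j else 0)"
  have "mat m m (\<lambda>(i, j). A $$ (i, j) * g j) = A * ?D"
  proof (rule eq_matI)
    fix i j assume "i < dim_row (A * ?D)" "j < dim_col (A * ?D)"
    then have ij: "i < m" "j < m" using A by auto
    have "(A * ?D) $$ (i, j) = (\<Sum>k = 0..<m. A $$ (i, k) * (if k = j then g j else 0))"
      using A ij by (simp add: scalar_prod_def)
    also have "\<dots> = A $$ (i, j) * g j"
      using ij by (simp add: if_distrib[of "\<lambda>x. _ * x"] cong: if_cong)
    finally show "mat m m (\<lambda>(i, j). A $$ (i, j) * g j) $$ (i, j) = (A * ?D) $$ (i, j)"
      using ij by simp
  qed (use A in auto)
  moreover have "det ?D = (\<Prod>j<m. g j)"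
  proof -
    have "det ?D = prod_list (diag_mat ?D)"
      by (rule det_upper_triangular[of _ m]) auto
    also have "\<dots> = (\<Prod>j<m. g j)" by (simp add: prod_list_diag_prod atLeast0LessThan)
    finally show ?thesis .
  qed
  ultimately show ?thesis using A by (simp add: det_mult[of _ m])
qed

text \<open>
  Row \<open>i\<close> of the Sylvester matrix lists the coefficients of a multiple \<open>r i\<close> of \<open>F\<close> or \<open>G\<close>. Multiplying it by
  the Vandermonde matrix \<open>V\<close> of the roots, extended by an identity block to the right size, evaluates these
  polynomials at the roots: the rows of \<open>F\<close> become zero and those of \<open>G\<close> become \<open>V\<close> with the columns scaled by
  the values of \<open>G\<close>. The factor \<open>det V\<close> then appears on both sides and is cancelled.
\<close>

lemma resultant_eq_prod_roots:
  fixes F G :: "'a::idom poly"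
  assumes F: "F = smult a (prod_linear zs)" and a: "a \<noteq> 0"
    and V: "det (mat (length zs) (length zs) (\<lambda>(i, j). zs ! j ^ (length zs - 1 - i))) \<noteq> 0"
  shows "resultant F G = a ^ degree G * (\<Prod>j<length zs. poly G (zs ! j))"
proof -
  define m where "m = length zs"
  define n where "n = degree G"
  define V where "V = mat m m (\<lambda>(i, j). zs ! j ^ (m - 1 - i))"
  have V0: "det V \<noteq> 0" using assms(3) by (simp add: V_def m_def)
  have deg_F: "degree F = m"
    using a by (simp add: F m_def lead_coeff_degree_prod_linear)
  have lc_F: "coeff F m = a"
    using lead_coeff_degree_prod_linear[of zs] by (simp add: F m_def)
  have root: "poly F (zs ! j) = 0" if "j < m" for j
    using that unfolding F m_def poly_smult poly_prod_linear by (auto simp: prod_list_zero_iff)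
  define r where "r i = (if i < n then monom 1 (n - 1 - i) * F else monom 1 (m + n - 1 - i) * G)" for i
  define S where "S = sylvester_mat F G"
  have S: "S \<in> carrier_mat (n + m) (n + m)"
    using sylvester_carrier_mat[of F G] by (simp add: S_def deg_F n_def add.commute)
  have S_index: "S $$ (i, k) = coeff (r i) (m + n - 1 - k)" if "i < n + m" "k < n + m" for i k
  proof -
    have sh: "coeff (monom 1 a * P) b = coeff (monom 1 (a - 1) * P) (b - 1)"
      if "a > 0" "b > 0" for a b and P :: "'a poly"
      using that by (cases a; cases b) (simp_all add: monom_Suc)
    have "S $$ (i, k) = (if i < n then coeff (monom 1 (n - i) * F) (m + n - k)
        else coeff (monom 1 (m + n - i) * G) (m + n - k))"
      using that unfolding S_def n_def deg_F[symmetric]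
      by (intro sylvester_index_mat2) (simp_all add: add.commute)
    also have "\<dots> = coeff (r i) (m + n - 1 - k)"
      using that unfolding r_def by (simp add: sh)
    finally show ?thesis .
  qed
  have deg_r: "degree (r i) < n + m" if "i < n + m" for i
  proof (cases "i < n")
    case True
    have "degree (r i) \<le> (n - 1 - i) + m"
      using True degree_mult_le[of "monom 1 (n - 1 - i)" F] deg_F degree_monom_le[of "1::'a" "n - 1 - i"]
      by (simp add: r_def)
    then show ?thesis using True by simp
  next
    case False
    have "degree (r i) \<le> (m + n - 1 - i) + n"
      using False degree_mult_le[of "monom 1 (m + n - 1 - i)" G] degree_monom_le[of "1::'a" "m + n - 1 - i"]
      by (simp add: r_def n_def)
    then show ?thesis using False that by simp
  qed
  have row_sum: "(\<Sum>k<n + m. S $$ (i, k) * z ^ (m + n - 1 - k)) = poly (r i) z" if "i < n + m" for i z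
  proof -
    have "(\<Sum>k<n + m. S $$ (i, k) * z ^ (m + n - 1 - k))
        = (\<Sum>k<n + m. coeff (r i) (n + m - Suc k) * z ^ (n + m - Suc k))"
      using that by (intro sum.cong refl) (simp add: S_index add.commute)
    also have "\<dots> = (\<Sum>l<n + m. coeff (r i) l * z ^ l)" by (rule sum.nat_diff_reindex)
    also have "\<dots> = (\<Sum>l\<le>degree (r i). coeff (r i) l * z ^ l)"
      using deg_r[OF that] by (intro sum.mono_neutral_right) (auto simp: coeff_eq_0)
    finally show ?thesis by (simp add: poly_altdef)
  qed
  define S11 where "S11 = mat n n (\<lambda>(i, j). S $$ (i, j))"
  define S12 where "S12 = mat n m (\<lambda>(i, j). S $$ (i, j + n))"
  define S21 where "S21 = mat m n (\<lambda>(i, j). S $$ (i + n, j))"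
  define S22 where "S22 = mat m m (\<lambda>(i, j). S $$ (i + n, j + n))"
  define Vt where "Vt = mat n m (\<lambda>(i, j). zs ! j ^ (m + n - 1 - i))"
  define Y where "Y = mat m m (\<lambda>(i, j). V $$ (i, j) * poly G (zs ! j))"
  have carr: "S11 \<in> carrier_mat n n" "S12 \<in> carrier_mat n m" "S21 \<in> carrier_mat m n" "S22 \<in> carrier_mat m m"
    "Vt \<in> carrier_mat n m" "V \<in> carrier_mat m m" "Y \<in> carrier_mat m m"
    by (auto simp: S11_def S12_def S21_def S22_def Vt_def V_def Y_def)
  have S_block: "S = four_block_mat S11 S12 S21 S22"
    using S by (intro eq_matI) (auto simp: S11_def S12_def S21_def S22_def)
  have split_sum: "(\<Sum>k<n + m. h k) = (\<Sum>k = 0..<n. h k) + (\<Sum>k = 0..<m. h (k + n))" for h :: "nat \<Rightarrow> 'a"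
    using sum.atLeastLessThan_concat[of 0 n "n + m" h] sum.shift_bounds_nat_ivl[of h 0 n m]
    by (simp add: atLeast0LessThan add.commute)
  have upper: "S11 * Vt + S12 * V = 0\<^sub>m n m"
  proof (rule eq_matI)
    fix i j assume "i < dim_row (0\<^sub>m n m :: 'a mat)" "j < dim_col (0\<^sub>m n m :: 'a mat)"
    then have ij: "i < n" "j < m" by auto
    have "(S11 * Vt + S12 * V) $$ (i, j) = (\<Sum>k<n + m. S $$ (i, k) * (zs ! j) ^ (m + n - 1 - k))"
      using ij carr unfolding split_sum
      by (simp add: scalar_prod_def S11_def S12_def Vt_def V_def)
    also have "\<dots> = poly (r i) (zs ! j)" using ij by (intro row_sum) simp
    also have "\<dots> = 0" using ij root by (simp add: r_def)
    finally show "(S11 * Vt + S12 * V) $$ (i, j) = 0\<^sub>m n m $$ (i, j)" using ij by simp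
  qed (use carr in auto)
  have lower: "S21 * Vt + S22 * V = Y"
  proof (rule eq_matI)
    fix i j assume "i < dim_row Y" "j < dim_col Y"
    then have ij: "i < m" "j < m" using carr by auto
    have "(S21 * Vt + S22 * V) $$ (i, j) = (\<Sum>k<n + m. S $$ (i + n, k) * (zs ! j) ^ (m + n - 1 - k))"
      using ij carr unfolding split_sum
      by (simp add: scalar_prod_def S21_def S22_def Vt_def V_def)
    also have "\<dots> = poly (r (i + n)) (zs ! j)" using ij by (intro row_sum) simp
    also have "\<dots> = Y $$ (i, j)" using ij by (simp add: r_def Y_def V_def poly_monom)
    finally show "(S21 * Vt + S22 * V) $$ (i, j) = Y $$ (i, j)" .
  qed (use carr in auto)
  define V' where "V' = four_block_mat (1\<^sub>m n) Vt (0\<^sub>m m n) V"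
  have V': "V' \<in> carrier_mat (n + m) (n + m)" using carr by (auto simp: V'_def)
  have "S * V' = four_block_mat (S11 * 1\<^sub>m n + S12 * 0\<^sub>m m n) (S11 * Vt + S12 * V)
      (S21 * 1\<^sub>m n + S22 * 0\<^sub>m m n) (S21 * Vt + S22 * V)"
    unfolding S_block V'_def by (rule mult_four_block_mat) (use carr in auto)
  also have "\<dots> = four_block_mat S11 (0\<^sub>m n m) S21 Y"
    using carr by (simp add: upper lower)
  finally have "det S * det V' = det (four_block_mat S11 (0\<^sub>m n m) S21 Y)"
    using S V' by (metis det_mult)
  also have "\<dots> = det S11 * det Y" by (rule det_four_block_mat_upper_right_zero) (use carr in auto)
  also have "det V' = det V"
    unfolding V'_def using carr by (subst det_four_block_mat_lower_left_zero[of _ n _ m]) auto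
  also have "det S11 = a ^ n"
  proof -
    have "det S11 = prod_list (diag_mat S11)"
    proof (rule det_upper_triangular)
      show "upper_triangular S11"
      proof (rule upper_triangularI)
        fix i j assume "j < i" "i < dim_row S11"
        then have ij: "j < i" "i < n" using carr by auto
        have "degree (r i) \<le> (n - 1 - i) + m"
          using ij degree_mult_le[of "monom 1 (n - 1 - i)" F] deg_F degree_monom_le[of "1::'a" "n - 1 - i"]
          by (simp add: r_def)
        then show "S11 $$ (i, j) = 0" using ij by (simp add: S11_def S_index coeff_eq_0)
      qed
    qed (use carr in auto)
    also have "diag_mat S11 = replicate n a"
    proof (rule nth_equalityI)
      fix i assume "i < length (diag_mat S11)"
      then have i: "i < n" using carr by (simp add: diag_mat_def)
      then have "coeff (r i) (m + n - 1 - i) = a"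
        using lc_F by (simp add: r_def coeff_monom_mult)
      then show "diag_mat S11 ! i = replicate n a ! i"
        using i carr by (simp add: diag_mat_def S11_def S_index)
    qed (use carr in \<open>simp add: diag_mat_def\<close>)
    finally show ?thesis by simp
  qed
  also have "det Y = det V * (\<Prod>j<m. poly G (zs ! j))"
    unfolding Y_def by (rule det_scale_columns) (use carr in auto)
  finally have "det S * det V = (a ^ n * (\<Prod>j<m. poly G (zs ! j))) * det V" by (simp add: mult_ac)
  then show ?thesis using V0 by (simp add: resultant_def S_def n_def m_def)
qed

context puiseux_roots
begin

definition value_mat :: "(nat \<Rightarrow> 'k poly poly) \<Rightarrow> 'k fls mat" where
  "value_mat v = mat d d (\<lambda>(i, j). ev (v i) (zs ! j))"

definition form_ring_basis :: "nat \<Rightarrow> 'k poly poly" where "form_ring_basis i = (if i = 0 then 1 else horner i)"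

definition vandermonde :: "'k fls mat" where "vandermonde = mat d d (\<lambda>(i, j). zs ! j ^ (d - 1 - i))"

lemma zs_in: "j < d \<Longrightarrow> zs ! j \<in> Z" using length_zs by simp

lemma poly_root_quotient_root: "y \<in> Z \<Longrightarrow> z \<in> Z \<Longrightarrow> y \<noteq> z \<Longrightarrow> poly (root_quotient y) z = 0"
  by (simp add: root_quotient_prod poly_prod)

lemma poly_root_quotient_self: "y \<in> Z \<Longrightarrow> poly (root_quotient y) y = poly (pderiv F) y"
proof -
  assume y: "y \<in> Z"
  have "poly (pderiv F) y = (\<Sum>z\<in>Z. if z = y then poly (root_quotient y) y else 0)"
    unfolding pderiv_F poly_sum using y by (intro sum.cong refl) (auto simp: poly_root_quotient_root)
  then show ?thesis using y by simp
qed

lemma pderiv_F_root: "y \<in> Z \<Longrightarrow> poly (pderiv F) y = e (lead_coeff f) * (\<Prod>z\<in>Z - {y}. y - z)"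
  by (simp add: root_quotient_prod poly_prod flip: poly_root_quotient_self)

lemma pderiv_F_root_nz: "y \<in> Z \<Longrightarrow> poly (pderiv F) y \<noteq> 0"
  using e_lc_nz by (auto simp: pderiv_F_root)

lemma prod_nth_zs: "(\<Prod>j<d. g (zs ! j)) = (\<Prod>y\<in>Z. g y)"
proof -
  have "(\<Prod>j<d. g (zs ! j)) = prod_list (map g zs)"
    by (simp add: prod.list_conv_set_nth length_zs atLeast0LessThan)
  then show ?thesis by (simp add: prod.distinct_set_conv_list[OF distinct_zs])
qed

lemma sum_nth_zs: "(\<Sum>j<d. g (zs ! j)) = (\<Sum>y\<in>Z. g y)"
proof -
  have "(\<Sum>j<d. g (zs ! j)) = sum_list (map g zs)"
    by (simp add: sum.list_conv_set_nth length_zs atLeast0LessThan)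
  then show ?thesis by (simp add: sum.distinct_set_conv_list[OF distinct_zs])
qed

text \<open>
  The Horner polynomials at \<open>y\<close> are the coefficients of \<open>F / (Y - y)\<close>, whose value at another root is 0 and at
  \<open>y\<close> itself is \<open>F' y\<close>. So the matrix product is diagonal.
\<close>

lemma det_vandermonde_horner: "det vandermonde * det (value_mat horner) = (\<Prod>y\<in>Z. poly (pderiv F) y)"
proof -
  let ?D = "mat d d (\<lambda>(i, j). 1\<^sub>m d $$ (i, j) * poly (pderiv F) (zs ! j))"
  have carr: "vandermonde \<in> carrier_mat d d" "value_mat horner \<in> carrier_mat d d" by (auto simp: vandermonde_def value_mat_def)
  have "transpose_mat vandermonde * value_mat horner = ?D"
  proof (rule eq_matI)
    fix k j assume "k < dim_row ?D" "j < dim_col ?D"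
    then have kj: "k < d" "j < d" by auto
    have "(transpose_mat vandermonde * value_mat horner) $$ (k, j) = (\<Sum>i<d. zs ! k ^ (d - 1 - i) * ev (horner i) (zs ! j))"
      using kj by (simp add: scalar_prod_def vandermonde_def value_mat_def atLeast0LessThan)
    also have "\<dots> = (\<Sum>i<d. coeff (root_quotient (zs ! j)) (d - Suc i) * zs ! k ^ (d - Suc i))"
      using kj by (intro sum.cong refl) (simp add: coeff_root_quotient zs_in)
    also have "\<dots> = (\<Sum>i<d. coeff (root_quotient (zs ! j)) i * zs ! k ^ i)" by (rule sum.nat_diff_reindex)
    also have "\<dots> = poly (root_quotient (zs ! j)) (zs ! k)"
      using degree_root_quotient[of "zs ! j"] zs_in kj deg_pos unfolding poly_altdef
      by (intro sum.mono_neutral_right) (auto simp: coeff_eq_0)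
    also have "\<dots> = ?D $$ (k, j)"
      using kj zs_in by (cases "k = j")
        (auto simp: poly_root_quotient_self poly_root_quotient_root nth_eq_iff_index_eq[OF distinct_zs] length_zs)
    finally show "(transpose_mat vandermonde * value_mat horner) $$ (k, j) = ?D $$ (k, j)" .
  qed (use carr in auto)
  then have "det (transpose_mat vandermonde) * det (value_mat horner) = det ?D"
    using carr by (metis det_mult transpose_carrier_mat)
  also have "det ?D = det (1\<^sub>m d) * (\<Prod>j<d. poly (pderiv F) (zs ! j))"
    by (rule det_scale_columns) auto
  finally show ?thesis using carr by (simp add: det_transpose prod_nth_zs)
qed

lemma det_vandermonde_nz: "det vandermonde \<noteq> 0"
  using det_vandermonde_horner pderiv_F_root_nz by (auto simp: prod_zero_iff)

lemma det_horner_form_ring_basis: "det (value_mat horner) = e (lead_coeff f) * det (value_mat form_ring_basis)"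
proof -
  have "value_mat horner = multrow 0 (e (lead_coeff f)) (value_mat form_ring_basis)"
    by (rule eq_matI) (auto simp: value_mat_def form_ring_basis_def horner_0 ev_const ev_1)
  then show ?thesis using deg_pos by (simp add: det_multrow[of _ d] value_mat_def)
qed

text \<open>
  The Horner polynomials are triangular in the powers of \<open>y\<close>, with diagonal entries \<open>lead_coeff f\<close>. The sign comes
  from the order of the powers, which is decreasing in \<open>vandermonde\<close>.
\<close>

lemma det_horner_vandermonde: "\<exists>s\<in>{1, -1}. det (value_mat horner) = s * e (lead_coeff f) ^ d * det vandermonde"
proof -
  let ?T = "mat d d (\<lambda>(i, k). if k \<le> i then e (coeff f (k + (d - i))) else 0)"
  let ?V' = "mat d d (\<lambda>(i, j). vandermonde $$ (d - 1 - i, j))"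
  have vandermonde: "vandermonde \<in> carrier_mat d d" by (simp add: vandermonde_def)
  have "value_mat horner = ?T * ?V'"
  proof (rule eq_matI)
    fix i j assume "i < dim_row (?T * ?V')" "j < dim_col (?T * ?V')"
    then have ij: "i < d" "j < d" by auto
    have "(?T * ?V') $$ (i, j) = (\<Sum>k<d. (if k \<le> i then e (coeff f (k + (d - i))) else 0) * zs ! j ^ k)"
      using ij by (simp add: scalar_prod_def vandermonde_def atLeast0LessThan)
    also have "\<dots> = (\<Sum>k\<le>i. e (coeff f (k + (d - i))) * zs ! j ^ k)"
      using ij by (intro sum.mono_neutral_cong_right) auto
    also have "\<dots> = ev (horner i) (zs ! j)"
      using ij degree_horner[of i] unfolding ev_def poly_altdef by (simp add: horner_def coeff_poly_shift)
    finally show "value_mat horner $$ (i, j) = (?T * ?V') $$ (i, j)" using ij by (simp add: value_mat_def)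
  qed (auto simp: value_mat_def)
  then have "det (value_mat horner) = det ?T * det ?V'" by (simp add: det_mult[of _ d])
  also have "det ?T = e (lead_coeff f) ^ d"
  proof -
    have "det ?T = prod_list (diag_mat ?T)"
      by (rule det_lower_triangular[of d]) auto
    also have "diag_mat ?T = replicate d (e (lead_coeff f))"
      by (rule nth_equalityI) (auto simp: diag_mat_def)
    finally show ?thesis by simp
  qed
  also have "det ?V' = signof (\<lambda>i. if i < d then d - 1 - i else i) * det vandermonde"
  proof -
    let ?p = "\<lambda>i. if i < d then d - 1 - i else i"
    have p: "?p permutes {0..<d}"
      by (rule bij_imp_permutes[OF bij_betwI[of _ _ _ ?p]]) auto
    have "?V' = mat d d (\<lambda>(i, j). vandermonde $$ (?p i, j))" by (rule eq_matI) auto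
    then show ?thesis using det_permute_rows[OF vandermonde p] by simp
  qed
  finally have "det (value_mat horner) = signof (\<lambda>i. if i < d then d - 1 - i else i) * e (lead_coeff f) ^ d * det vandermonde"
    by simp
  moreover have "signof (\<lambda>i. if i < d then d - 1 - i else i) \<in> {1, -1 :: 'k fls}"
    by (auto simp: sign_def)
  ultimately show ?thesis by blast
qed

lemma e_resultant: "e (resultant f (pderiv f)) = e (lead_coeff f) ^ (d - 1) * (\<Prod>y\<in>Z. poly (pderiv F) y)"
proof -
  interpret ei: idom_hom e ..
  have "resultant F (pderiv F) = e (lead_coeff f) ^ degree (pderiv F) * (\<Prod>j<length zs. poly (pderiv F) (zs ! j))"
    using det_vandermonde_nz length_zs by (intro resultant_eq_prod_roots[OF split e_lc_nz]) (simp add: vandermonde_def)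
  moreover have "pderiv F = map_poly e (pderiv f)" by (simp add: ei.map_poly_pderiv)
  ultimately show ?thesis by (simp add: e.resultant_hom length_zs prod_nth_zs degree_pderiv)
qed

lemma e_disc: "\<exists>s\<in>{1, -1}. e (disc_y f) * e (lead_coeff f) = s * e (resultant f (pderiv f))"
proof -
  let ?s = "(- 1) ^ (d * (d - 1) div 2) :: 'k poly"
  have s: "?s \<in> {1, -1}" by (cases "even (d * (d - 1) div 2)") auto
  have "disc_y f * lead_coeff f = ?s * resultant f (pderiv f)"
    using lead_coeff_dvd_resultant_pderiv[OF deg_pos] by (simp add: disc_y_def)
  from arg_cong[OF this, of e] have "e (disc_y f) * e (lead_coeff f) = e ?s * e (resultant f (pderiv f))"
    by (simp only: e.hom_mult)
  moreover have "e ?s \<in> {1, -1}" using s by (auto simp: e.hom_uminus)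
  ultimately show ?thesis by blast
qed

text \<open>
  The discriminant of the form ring is the discriminant of \<open>f\<close>: this follows by multiplying the two relations
  between the Horner and the Vandermonde determinants.
\<close>

lemma det_form_ring_basis_disc: "\<exists>s\<in>{1, -1}. det (value_mat form_ring_basis) ^ 2 = s * e (disc_y f)"
proof -
  let ?l = "e (lead_coeff f)"
  obtain s where s: "s \<in> {1, -1}" "det (value_mat horner) = s * ?l ^ d * det vandermonde" using det_horner_vandermonde by blast
  obtain t where t: "t \<in> {1, -1}" "e (disc_y f) * ?l = t * e (resultant f (pderiv f))" using e_disc by blast
  have ld: "?l ^ d = ?l * ?l ^ (d - 1)" using deg_pos by (simp flip: power_Suc)
  have ss: "s * s = 1" "t * t = 1" using s t by auto
  have "?l * det (value_mat form_ring_basis) = ?l * (s * ?l ^ (d - 1) * det vandermonde)"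
    using s(2) det_horner_form_ring_basis ld by (simp add: mult_ac)
  then have form_ring_basis: "det (value_mat form_ring_basis) = s * ?l ^ (d - 1) * det vandermonde" using e_lc_nz by simp
  have "det (value_mat form_ring_basis) ^ 2 * ?l = s * ?l ^ (d - 1) * (det vandermonde * det (value_mat horner))"
    by (simp add: power2_eq_square det_horner_form_ring_basis) (simp add: form_ring_basis mult_ac)
  also have "\<dots> = s * e (resultant f (pderiv f))" by (simp add: det_vandermonde_horner e_resultant mult_ac)
  also have "e (resultant f (pderiv f)) = t * (e (disc_y f) * ?l)"
    using t(2) ss(2) by (simp flip: mult.assoc)
  finally have "det (value_mat form_ring_basis) ^ 2 * ?l = (s * t * e (disc_y f)) * ?l" by (simp add: mult_ac)
  then have "det (value_mat form_ring_basis) ^ 2 = s * t * e (disc_y f)" using e_lc_nz by simp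
  moreover have "s * t \<in> {1, -1}" using s t by auto
  ultimately show ?thesis by blast
qed

lemma disc_roots:
  "\<exists>s\<in>{1, -1}. e (disc_y f) = s * (e (lead_coeff f) ^ (2 * (d - 1)) * (\<Prod>y\<in>Z. \<Prod>z\<in>Z - {y}. y - z))"
proof -
  let ?l = "e (lead_coeff f)"
  obtain t where t: "t \<in> {1, -1}" "e (disc_y f) * ?l = t * e (resultant f (pderiv f))" using e_disc by blast
  have "e (resultant f (pderiv f)) = ?l ^ (d - 1) * (?l ^ d * (\<Prod>y\<in>Z. \<Prod>z\<in>Z - {y}. y - z))"
    by (simp add: e_resultant pderiv_F_root prod.distrib card_Z)
  also have "?l ^ d = ?l * ?l ^ (d - 1)" using deg_pos by (simp flip: power_Suc)
  also have "?l ^ (d - 1) * (?l * ?l ^ (d - 1) * (\<Prod>y\<in>Z. \<Prod>z\<in>Z - {y}. y - z))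
      = (?l ^ (2 * (d - 1)) * (\<Prod>y\<in>Z. \<Prod>z\<in>Z - {y}. y - z)) * ?l"
    by (simp add: mult_2 power_add mult_ac)
  finally have "e (disc_y f) * ?l = (t * (?l ^ (2 * (d - 1)) * (\<Prod>y\<in>Z. \<Prod>z\<in>Z - {y}. y - z))) * ?l"
    using t(2) by (simp add: mult_ac)
  then show ?thesis using t(1) e_lc_nz by auto
qed

end

section \<open>Lattice reduction at infinity\<close>

lemma det_add_rows:
  fixes A :: "'a::comm_ring_1 mat"
  assumes A: "A \<in> carrier_mat m m" and k: "k < m" and S: "finite S" "S \<subseteq> {..<m} - {k}"
  shows "det (mat m m (\<lambda>(i, j). if i = k then A $$ (k, j) + (\<Sum>l\<in>S. c l * A $$ (l, j)) else A $$ (i, j))) = det A"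
  using S
proof (induction S rule: finite_induct)
  case empty
  have "mat m m (\<lambda>(i, j). if i = k then A $$ (k, j) + (\<Sum>l\<in>{}. c l * A $$ (l, j)) else A $$ (i, j)) = A"
    using A by (intro eq_matI) auto
  then show ?case by simp
next
  case (insert l S)
  let ?B = "\<lambda>S. mat m m (\<lambda>(i, j). if i = k then A $$ (k, j) + (\<Sum>l\<in>S. c l * A $$ (l, j)) else A $$ (i, j))"
  have l: "l < m" "k \<noteq> l" using insert.prems by auto
  have "?B (insert l S) = addrow (c l) k l (?B S)"
    using l k insert.hyps by (intro eq_matI) (auto simp: algebra_simps)
  then have "det (?B (insert l S)) = det (?B S)"
    using l by (simp add: det_addrow[of l m])
  then show ?case using insert by simp
qed

lemma nth_fls_mult_lower:
  fixes f g :: "'a::idom fls"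
  assumes f: "\<And>k. k < a \<Longrightarrow> fls_nth f k = 0" and g: "\<And>k. k < b \<Longrightarrow> fls_nth g k = 0"
  shows "k < a + b \<Longrightarrow> fls_nth (f * g) k = 0" and "fls_nth (f * g) (a + b) = fls_nth f a * fls_nth g b"
proof -
  consider "f = 0 \<or> g = 0" | "f \<noteq> 0" "g \<noteq> 0" by blast
  then have "(k < a + b \<longrightarrow> fls_nth (f * g) k = 0) \<and> fls_nth (f * g) (a + b) = fls_nth f a * fls_nth g b"
  proof cases
    case 2
    have ge: "a \<le> fls_subdegree f" "b \<le> fls_subdegree g"
      using 2 f[of "fls_subdegree f"] g[of "fls_subdegree g"] by (force simp: not_less[symmetric])+
    have sd: "fls_subdegree (f * g) = fls_subdegree f + fls_subdegree g" using 2 by (rule fls_subdegree_mult)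
    have "fls_nth (f * g) (a + b) = fls_nth f a * fls_nth g b"
    proof (cases "fls_subdegree f = a \<and> fls_subdegree g = b")
      case True
      then show ?thesis using fls_times_base[of f g] by simp
    next
      case False
      then have "a < fls_subdegree f \<or> b < fls_subdegree g" using ge by auto
      moreover then have "a + b < fls_subdegree (f * g)" using ge sd by auto
      ultimately show ?thesis by auto
    qed
    then show ?thesis using sd ge by auto
  qed auto
  then show "k < a + b \<Longrightarrow> fls_nth (f * g) k = 0" "fls_nth (f * g) (a + b) = fls_nth f a * fls_nth g b" by auto
qed

lemma nth_fls_prod_lower:
  fixes g :: "'i \<Rightarrow> 'a::idom fls"
  assumes "finite I" "\<And>i k. i \<in> I \<Longrightarrow> k < b i \<Longrightarrow> fls_nth (g i) k = 0"
  shows "(\<forall>k < (\<Sum>i\<in>I. b i). fls_nth (\<Prod>i\<in>I. g i) k = 0) \<and> fls_nth (\<Prod>i\<in>I. g i) (\<Sum>i\<in>I. b i) = (\<Prod>i\<in>I. fls_nth (g i) (b i))"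
  using assms
proof (induction I rule: finite_induct)
  case (insert i I)
  then have IH: "\<forall>k < (\<Sum>i\<in>I. b i). fls_nth (\<Prod>i\<in>I. g i) k = 0"
    "fls_nth (\<Prod>i\<in>I. g i) (\<Sum>i\<in>I. b i) = (\<Prod>i\<in>I. fls_nth (g i) (b i))" by auto
  have gi: "\<And>k. k < b i \<Longrightarrow> fls_nth (g i) k = 0" using insert.prems by auto
  from nth_fls_mult_lower[of "b i" "g i" "\<Sum>i\<in>I. b i" "\<Prod>i\<in>I. g i", OF gi] IH insert.hyps
  show ?case by auto
qed auto

context puiseux_roots
begin

text \<open>
  The largest pole order in \<open>u\<close> of the values of \<open>w\<close> at the roots, that is, \<open>n\<close> times the degree of growth
  of \<open>w\<close> in \<open>x\<close>.
\<close>

definition growth :: "'k poly poly \<Rightarrow> int" where "growth w = Max ((\<lambda>y. - fls_subdegree (ev w y)) ` Z)"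
text \<open>
  The coefficient of \<open>w\<close> at its order of growth; it is 0 at those roots where \<open>w\<close> grows less.
\<close>

definition lead :: "'k poly poly \<Rightarrow> 'k fls \<Rightarrow> 'k" where "lead w y = fls_nth (ev w y) (- growth w)"

lemma Z_nonempty: "Z \<noteq> {}" using card_Z deg_pos by auto

lemma nth_ev_below_growth: "y \<in> Z \<Longrightarrow> k < - growth w \<Longrightarrow> fls_nth (ev w y) k = 0"
proof -
  assume "y \<in> Z" "k < - growth w"
  then have "- fls_subdegree (ev w y) \<le> growth w" unfolding growth_def by (intro Max_ge) auto
  then show ?thesis using \<open>k < - growth w\<close> by (intro fls_eq0_below_subdegree) simp
qed

lemma lead_attained:
  assumes "w \<in> form_ring" "w \<noteq> 0" shows "\<exists>y\<in>Z. lead w y \<noteq> 0"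
proof -
  have "growth w \<in> (\<lambda>y. - fls_subdegree (ev w y)) ` Z" unfolding growth_def using Z_nonempty by (intro Max_in) auto
  then obtain y where y: "y \<in> Z" "- growth w = fls_subdegree (ev w y)" by auto
  have "ev w y \<noteq> 0" using assms y by (intro ev_nz degree_form_ring)
  then show ?thesis using y by (intro bexI[of _ y]) (auto simp: lead_def)
qed

lemma growth_le_0_imp_const:
  assumes "w \<in> form_ring" "w \<noteq> 0" "growth w \<le> 0"
  shows "\<exists>c. c \<noteq> 0 \<and> w = [:[:c:]:]" "growth w = 0"
proof -
  obtain c where c: "w = [:[:c:]:]"
    using bounded_imp_const[OF assms(1)] nth_ev_below_growth[of _ _ w] assms(3) by force
  then have "c \<noteq> 0" using assms(2) by auto
  then show "\<exists>c. c \<noteq> 0 \<and> w = [:[:c:]:]" using c by blast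
  show "growth w = 0" unfolding growth_def using Z_nonempty by (simp add: c ev_const embed_inf_const)
qed

lemma growth_nonneg: "w \<in> form_ring \<Longrightarrow> w \<noteq> 0 \<Longrightarrow> growth w \<ge> 0"
  using growth_le_0_imp_const(2)[of w] by linarith

lemma lead_rotate:
  assumes "\<zeta> \<in> U" shows "lead w (fls_rotate \<zeta> y) = \<zeta> powi (- growth w) * lead w y"
  by (simp add: lead_def flip: rotate_ev[OF assms])

lemma finite_U: "finite U" using finite_roots_of_unity[OF n_pos] .
lemma card_U_nz: "(of_nat (card U) :: 'k) \<noteq> 0" using finite_U by (auto simp: card_eq_0_iff intro: exI[of _ 1])

text \<open>
  A rotation by \<open>\<zeta>\<close> multiplies the leading coefficients of \<open>w\<close> by \<open>\<zeta> powi (- growth w)\<close>. So averaging over \<open>U\<close> against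
  \<open>\<zeta> powi m\<close> singles out the members whose growth is congruent to \<open>m\<close> modulo \<open>n\<close>.
\<close>

lemma average_lead:
  "(\<Sum>\<zeta>\<in>U. \<zeta> powi m * (\<Sum>i<d. x i * lead (v i) (fls_rotate \<zeta> y)))
    = of_nat (card U) * (\<Sum>i<d. if int n dvd (m - growth (v i)) then x i * lead (v i) y else 0)"
proof -
  have "(\<Sum>\<zeta>\<in>U. \<zeta> powi m * (\<Sum>i<d. x i * lead (v i) (fls_rotate \<zeta> y)))
     = (\<Sum>i<d. x i * lead (v i) y * (\<Sum>\<zeta>\<in>U. \<zeta> powi (m - growth (v i))))"
    unfolding sum_distrib_left
  proof (subst sum.swap, intro sum.cong refl)
    fix i \<zeta> assume "\<zeta> \<in> U"
    then have "\<zeta> \<noteq> 0" using n_pos by (auto simp: power_0_left)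
    then have "\<zeta> powi (m - growth (v i)) = \<zeta> powi m * \<zeta> powi (- growth (v i))"
      by (simp flip: power_int_add)
    then show "\<zeta> powi m * (x i * lead (v i) (fls_rotate \<zeta> y)) = x i * lead (v i) y * \<zeta> powi (m - growth (v i))"
      using lead_rotate[OF \<open>\<zeta> \<in> U\<close>, of "v i" y] by (simp add: mult_ac)
  qed
  also have "\<dots> = (\<Sum>i<d. if int n dvd (m - growth (v i)) then of_nat (card U) * (x i * lead (v i) y) else 0)"
  proof (intro sum.cong refl)
    fix i
    show "x i * lead (v i) y * (\<Sum>\<zeta>\<in>U. \<zeta> powi (m - growth (v i)))
        = (if int n dvd (m - growth (v i)) then of_nat (card U) * (x i * lead (v i) y) else 0)"
    proof (cases "int n dvd (m - growth (v i))")
      case True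
      then obtain j where "m - growth (v i) = int n * j" by blast
      then have "\<zeta> powi (m - growth (v i)) = 1" if "\<zeta> \<in> U" for \<zeta> using that by (simp add: power_int_mult)
      then show ?thesis using True by simp
    next
      case False
      have "(\<Sum>\<zeta>\<in>U. \<zeta> powi (m - growth (v i))) = 0"
        using n_pos False by (rule sum_roots_of_unity_powi)
      then show ?thesis using False by simp
    qed
  qed
  finally show ?thesis by (simp add: sum_distrib_left if_distrib cong: if_cong)
qed

text \<open>
  The order of the determinant at infinity plays the role of the covolume of a lattice; half the degree of the
  discriminant is its value for the basis of the form ring.
\<close>

definition bases :: "(nat \<Rightarrow> 'k poly poly) set" where
  "bases = {v. (\<forall>i<d. v i \<in> form_ring) \<and> det (value_mat v) \<noteq> 0 \<and> 2 * fls_subdegree (det (value_mat v)) = - (int n * int (degree (disc_y f)))}"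

lemma disc_nz: "disc_y f \<noteq> 0" and form_ring_basis_in_bases: "form_ring_basis \<in> bases"
proof -
  obtain s where s: "s \<in> {1, -1}" "det (value_mat form_ring_basis) ^ 2 = s * e (disc_y f)" using det_form_ring_basis_disc by blast
  have "det (value_mat form_ring_basis) \<noteq> 0" using det_vandermonde_horner pderiv_F_root_nz by (auto simp: det_horner_form_ring_basis)
  then show d0: "disc_y f \<noteq> 0" using s by auto
  have "fls_subdegree (det (value_mat form_ring_basis) ^ 2) = fls_subdegree (e (disc_y f))"
    using s by auto
  then have "2 * fls_subdegree (det (value_mat form_ring_basis)) = - (int n * int (degree (disc_y f)))"
    using subdegree_embed_inf[OF n_pos d0] by (simp add: fls_subdegree_pow)
  moreover have "form_ring_basis i \<in> form_ring" if "i < d" for i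
    using that form_ring_const[of 1] by (auto simp: form_ring_basis_def form_ring_horner one_pCons)
  ultimately show "form_ring_basis \<in> bases" using \<open>det (value_mat form_ring_basis) \<noteq> 0\<close> by (simp add: bases_def)
qed

lemma bases_nz: "v \<in> bases \<Longrightarrow> i < d \<Longrightarrow> v i \<noteq> 0"
proof
  assume v: "v \<in> bases" and i: "i < d" and "v i = 0"
  then have "value_mat v = mat\<^sub>r d d (\<lambda>k. if k = i then 0\<^sub>v d else row (value_mat v) k)"
    by (intro eq_matI) (auto simp: value_mat_def ev_def)
  then have "det (value_mat v) = 0" using det_row_0[OF i, of "\<lambda>k. row (value_mat v) k"]
    by (metis (no_types, lifting) value_mat_def Pi_I row_carrier_vec carrier_vecI dim_col_mat(1) index_row(2))
  then show False using v by (simp add: bases_def)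
qed

text \<open>
  Lattice reduction over \<open>K[x]\<close>: a family of least total growth has linearly independent leading coefficients. By
  \<open>average_lead\<close> a linear relation can be restricted to members whose growth lies in one residue class modulo \<open>n\<close>.
  After multiplication by suitable powers of \<open>x\<close>, each of which adds \<open>n\<close> to the growth, they all grow like the fastest
  one, and replacing this one by the linear combination lowers its growth. This is a row operation, so the determinant does
  not change.
\<close>

lemma reduced_basis_exists:
  "\<exists>v\<in>bases. \<forall>x. (\<forall>y\<in>Z. (\<Sum>i<d. x i * lead (v i) y) = 0) \<longrightarrow> (\<forall>i<d. x i = 0)"
proof -
  define \<mu> where "\<mu> v = (\<Sum>i<d. nat (growth (v i)))" for v
  obtain v where v: "v \<in> bases" and v_min: "\<And>v'. v' \<in> bases \<Longrightarrow> \<mu> v \<le> \<mu> v'"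
    using ex_has_least_nat[of "\<lambda>v. v \<in> bases" form_ring_basis \<mu>] form_ring_basis_in_bases by blast
  have vR: "\<And>i. i < d \<Longrightarrow> v i \<in> form_ring" using v by (simp add: bases_def)
  have "x i = 0" if x: "\<forall>y\<in>Z. (\<Sum>i<d. x i * lead (v i) y) = 0" and "i < d" for x i
  proof (rule ccontr)
    assume "x i \<noteq> 0"
    define I where "I = {i. i < d \<and> x i \<noteq> 0}"
    have I: "finite I" "I \<noteq> {}" using \<open>x i \<noteq> 0\<close> \<open>i < d\<close> by (auto simp: I_def)
    then have "Max ((\<lambda>i. growth (v i)) ` I) \<in> (\<lambda>i. growth (v i)) ` I" by (intro Max_in) auto
    then obtain i0 where i0: "i0 \<in> I" and "growth (v i0) = Max ((\<lambda>i. growth (v i)) ` I)" by auto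
    then have i0_max: "growth (v i) \<le> growth (v i0)" if "i \<in> I" for i
      using I that by simp
    define J where "J = {i \<in> I. int n dvd (growth (v i0) - growth (v i))}"
    have J: "finite J" "i0 \<in> J" "J \<subseteq> {..<d}" using I i0 by (auto simp: J_def I_def)
    define k where "k i = nat ((growth (v i0) - growth (v i)) div int n)" for i
    have k: "int n * int (k i) = growth (v i0) - growth (v i)" if "i \<in> J" for i
      using that i0_max[of i] n_pos by (auto simp: J_def k_def pos_imp_zdiv_nonneg_iff)
    have sumJ: "(\<Sum>i\<in>J. x i * lead (v i) y) = 0" if "y \<in> Z" for y
    proof -
      have "of_nat (card U) * (\<Sum>i<d. if int n dvd (growth (v i0) - growth (v i)) then x i * lead (v i) y else 0) = 0"
        unfolding average_lead[symmetric] using x that rotate_Z by (intro sum.neutral) auto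
      then have "0 = (\<Sum>i<d. if int n dvd (growth (v i0) - growth (v i)) then x i * lead (v i) y else 0)"
        using card_U_nz by simp
      also have "\<dots> = (\<Sum>i\<in>J. x i * lead (v i) y)"
        by (rule sum.mono_neutral_cong_right) (auto simp: J_def I_def)
      finally show ?thesis by simp
    qed
    define p where "p i = monom (x i / x i0) (k i)" for i
    define w where "w = (\<Sum>i\<in>J. smult (p i) (v i))"
    have pi0: "p i0 = 1" using i0 by (simp add: p_def k_def I_def)
    have wR: "w \<in> form_ring" unfolding w_def using vR J by (intro form_ring_sum form_ring_smult) auto
    have ev_w: "ev w y = ev (v i0) y + (\<Sum>i\<in>J - {i0}. e (p i) * ev (v i) y)" for y
      unfolding w_def ev_sum ev_smult using J pi0 by (subst sum.remove[of _ i0]) auto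
    define v' where "v' = v(i0 := w)"
    have "value_mat v' = mat d d (\<lambda>(i, j). if i = i0 then value_mat v $$ (i0, j) + (\<Sum>l\<in>J - {i0}. e (p l) * value_mat v $$ (l, j)) else value_mat v $$ (i, j))"
      using J by (intro eq_matI) (auto simp: value_mat_def v'_def ev_w intro!: sum.cong)
    then have "det (value_mat v') = det (value_mat v)"
      using J by (simp only:) (intro det_add_rows, auto simp: value_mat_def)
    then have v'_bases: "v' \<in> bases" using v wR vR by (simp add: bases_def v'_def)
    have "growth w < growth (v i0)"
    proof -
      have "w \<noteq> 0" using bases_nz[OF v'_bases, of i0] J by (auto simp: v'_def)
      then obtain y where y: "y \<in> Z" "lead w y \<noteq> 0" using lead_attained wR by blast
      have nth_w: "fls_nth (ev w y) m = (\<Sum>i\<in>J. x i / x i0 * fls_nth (ev (v i) y) (m + (growth (v i0) - growth (v i))))" for m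
      proof -
        have "fls_nth (ev w y) m = (\<Sum>i\<in>J. fls_nth (e (p i) * ev (v i) y) m)"
          by (simp add: w_def ev_sum ev_smult fls_nth_sum)
        also have "\<dots> = (\<Sum>i\<in>J. x i / x i0 * fls_nth (ev (v i) y) (m + (growth (v i0) - growth (v i))))"
        proof (intro sum.cong refl)
          fix i assume "i \<in> J"
          have "e (p i) * ev (v i) y = fls_const (x i / x i0) * (fls_X_intpow (- (int n * int (k i))) * ev (v i) y)"
            by (simp only: p_def embed_inf_monom mult.assoc)
          also have "fls_X_intpow (- (int n * int (k i))) * ev (v i) y = fls_shift (growth (v i0) - growth (v i)) (ev (v i) y)"
            using fls_X_intpow_times_conv_shift(1)[of "- (int n * int (k i))" "ev (v i) y"] k[OF \<open>i \<in> J\<close>] by simp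
          finally show "fls_nth (e (p i) * ev (v i) y) m = x i / x i0 * fls_nth (ev (v i) y) (m + (growth (v i0) - growth (v i)))"
            by simp
        qed
        finally show ?thesis .
      qed
      have "fls_nth (ev w y) m = 0" if "m \<le> - growth (v i0)" for m
      proof (cases "m = - growth (v i0)")
        case True
        have "fls_nth (ev w y) m = (\<Sum>i\<in>J. x i * lead (v i) y) / x i0"
          unfolding nth_w True lead_def by (simp add: sum_divide_distrib)
        then show ?thesis using sumJ[OF y(1)] by simp
      next
        case False
        then show ?thesis unfolding nth_w using that y(1)
          by (intro sum.neutral) (auto intro!: nth_ev_below_growth)
      qed
      then show ?thesis using y(2) unfolding lead_def by (meson neg_le_iff_le not_less)
    qed
    moreover have "growth w \<ge> 0" using growth_nonneg[OF wR] bases_nz[OF v'_bases, of i0] J by (auto simp: v'_def)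
    ultimately have "nat (growth (v' i0)) < nat (growth (v i0))" by (simp add: v'_def)
    then have "\<mu> v' < \<mu> v" unfolding \<mu>_def using J
      by (intro sum_strict_mono_ex1) (auto simp: v'_def intro!: bexI[of _ i0])
    then show False using v_min[OF v'_bases] by simp
  qed
  then show ?thesis using v by blast
qed

end

context puiseux_roots
begin

definition leads :: "(nat \<Rightarrow> 'k poly poly) \<Rightarrow> 'k mat" where
  "leads v = mat d d (\<lambda>(i, j). lead (v i) (zs ! j))"

lemma leads_carrier: "leads v \<in> carrier_mat d d" by (simp add: leads_def)

lemma det_leads_nz:
  assumes indep: "\<And>x i. (\<forall>y\<in>Z. (\<Sum>i<d. x i * lead (v i) y) = 0) \<Longrightarrow> i < d \<Longrightarrow> x i = 0"
  shows "det (leads v) \<noteq> 0"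
proof
  assume "det (leads v) = 0"
  then have "det (transpose_mat (leads v)) = 0" using det_transpose[OF leads_carrier] by simp
  then obtain x where x: "x \<in> carrier_vec d" "x \<noteq> 0\<^sub>v d" "transpose_mat (leads v) *\<^sub>v x = 0\<^sub>v d"
    using det_0_iff_vec_prod_zero[of "transpose_mat (leads v)" d] leads_carrier by auto
  have "(\<Sum>i<d. x $ i * lead (v i) y) = 0" if y: "y \<in> Z" for y
  proof -
    obtain j where j: "j < d" "y = zs ! j" using y length_zs by (auto simp: in_set_conv_nth)
    have "(\<Sum>i<d. x $ i * lead (v i) y) = (transpose_mat (leads v) *\<^sub>v x) $ j"
      using j x(1) by (simp add: leads_def scalar_prod_def atLeast0LessThan mult.commute)
    then show ?thesis using x(3) j by simp
  qed
  then have "x $ i = 0" if "i < d" for i using indep[of "\<lambda>i. x $ i"] that by blast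
  then have "x = 0\<^sub>v d" using x(1) by (intro eq_vecI) auto
  then show False using x(2) by simp
qed

lemma signof_mult: "signof p * (x::'a::comm_ring_1) = (if sign p = 1 then x else - x)"
  by (auto simp: sign_def)

text \<open>
  The Leibniz expansion of \<open>det (value_mat v)\<close> has leading coefficient \<open>det (leads v)\<close>.
\<close>

lemma subdegree_det_value_mat:
  assumes "det (leads v) \<noteq> 0"
  shows "fls_subdegree (det (value_mat v)) = - (\<Sum>i<d. growth (v i))"
proof (rule fls_subdegree_eqI)
  let ?s = "- (\<Sum>i<d. growth (v i))"
  have 1: "(\<forall>k < ?s. fls_nth (\<Prod>i = 0..<d. value_mat v $$ (i, p i)) k = 0)
      \<and> fls_nth (\<Prod>i = 0..<d. value_mat v $$ (i, p i)) ?s = (\<Prod>i = 0..<d. leads v $$ (i, p i))"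
    if "p permutes {0..<d}" for p
  proof -
    have p: "p i < d" if "i < d" for i using \<open>p permutes {0..<d}\<close> that by (auto dest: permutes_in_image[of _ _ i])
    have "?s = (\<Sum>i = 0..<d. - growth (v i))" by (simp add: sum_negf atLeast0LessThan)
    moreover have "fls_nth (value_mat v $$ (i, p i)) k = 0" if "i \<in> {0..<d}" "k < - growth (v i)" for i k
      using that p by (auto simp: value_mat_def intro!: nth_ev_below_growth zs_in)
    note nth_fls_prod_lower[of "{0..<d}" "\<lambda>i. - growth (v i)" "\<lambda>i. value_mat v $$ (i, p i)", OF _ this]
    moreover have "fls_nth (value_mat v $$ (i, p i)) (- growth (v i)) = leads v $$ (i, p i)" if "i \<in> {0..<d}" for i
      using that p by (auto simp: value_mat_def leads_def lead_def)
    then have "(\<Prod>i = 0..<d. fls_nth (value_mat v $$ (i, p i)) (- growth (v i))) = (\<Prod>i = 0..<d. leads v $$ (i, p i))"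
      by (rule prod.cong[OF refl])
    ultimately show ?thesis by simp
  qed
  have det: "det (value_mat v) = (\<Sum>p | p permutes {0..<d}. signof p * (\<Prod>i = 0..<d. value_mat v $$ (i, p i)))"
    by (rule det_def') (simp add: value_mat_def)
  have nth_sg: "fls_nth (signof p * g) k = signof p * fls_nth g k" for p k and g :: "'k fls"
    by (simp add: signof_mult)
  have "fls_nth (det (value_mat v)) ?s = det (leads v)"
    unfolding det det_def'[OF leads_carrier] fls_nth_sum nth_sg using 1 by (intro sum.cong refl) auto
  then show "fls_nth (det (value_mat v)) ?s \<noteq> 0" using assms by simp
  fix k assume "k < ?s"
  then show "fls_nth (det (value_mat v)) k = 0"
    unfolding det fls_nth_sum nth_sg using 1 by (intro sum.neutral) auto
qed

text \<open>
  Rotations permute the summands up to the factor \<open>\<zeta> powi (- (growth v + growth w))\<close>.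
\<close>

lemma sum_lead_lead_nz_imp_dvd:
  assumes "(\<Sum>y\<in>Z. lead v y * lead w y) \<noteq> 0"
  shows "int n dvd (growth v + growth w)"
proof (rule ccontr)
  assume "\<not> ?thesis"
  then have "\<not> int n dvd (- (growth v + growth w))" using dvd_minus_iff by blast
  then obtain \<zeta> :: 'k where \<zeta>: "\<zeta> ^ n = 1" "\<zeta> powi (- (growth v + growth w)) \<noteq> 1"
    using exists_root_of_unity_powi_neq_1[OF n_pos] by blast
  then have z: "\<zeta> \<in> U" "\<zeta> \<noteq> 0" using n_pos by (auto simp: power_0_left)
  have "(\<Sum>y\<in>Z. lead v y * lead w y) = (\<Sum>y\<in>Z. lead v (fls_rotate \<zeta> y) * lead w (fls_rotate \<zeta> y))"
    by (rule sum.reindex_bij_betw[OF bij_rotate[OF z(1)], symmetric])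
  also have "\<dots> = (\<Sum>y\<in>Z. \<zeta> powi (- (growth v + growth w)) * (lead v y * lead w y))"
  proof (intro sum.cong refl)
    fix y
    have "\<zeta> powi (- (growth v + growth w)) = \<zeta> powi (- growth v) * \<zeta> powi (- growth w)"
      using z by (simp flip: power_int_add)
    then show "lead v (fls_rotate \<zeta> y) * lead w (fls_rotate \<zeta> y) = \<zeta> powi (- (growth v + growth w)) * (lead v y * lead w y)"
      unfolding lead_rotate[OF z(1)] by (simp add: mult_ac)
  qed
  also have "\<dots> = \<zeta> powi (- (growth v + growth w)) * (\<Sum>y\<in>Z. lead v y * lead w y)" by (simp add: sum_distrib_left)
  finally show False using assms \<zeta> by simp
qed

text \<open>
  The Gram matrix of the leading coefficients for the trace form is nonsingular, so some term of its Leibniz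
  expansion is nonzero.
\<close>

lemma gram_permutation:
  assumes "det (leads v) \<noteq> 0"
  shows "\<exists>p. p permutes {0..<d} \<and> (\<forall>i<d. int n dvd (growth (v i) + growth (v (p i))))"
proof -
  let ?G = "leads v * transpose_mat (leads v)"
  have G: "?G \<in> carrier_mat d d" using leads_carrier by (metis mult_carrier_mat transpose_carrier_mat)
  have "det ?G = det (leads v) * det (leads v)"
    using leads_carrier det_transpose[OF leads_carrier] by (metis det_mult transpose_carrier_mat)
  then have "det ?G \<noteq> 0" using assms by simp
  then obtain p where p: "p \<in> {p. p permutes {0..<d}}" "signof p * (\<Prod>i = 0..<d. ?G $$ (i, p i)) \<noteq> 0"
    unfolding det_def'[OF G] by (rule sum.not_neutral_contains_not_neutral)
  then have p1: "p permutes {0..<d}" by simp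
  from p(2) have nz: "?G $$ (i, p i) \<noteq> 0" if "i < d" for i
    using that by (auto simp: prod_zero_iff)
  have "int n dvd (growth (v i) + growth (v (p i)))" if i: "i < d" for i
  proof (rule sum_lead_lead_nz_imp_dvd)
    have "p i < d" using p1 i permutes_in_image[of p "{0..<d}" i] by simp
    then have "?G $$ (i, p i) = (\<Sum>j<d. lead (v i) (zs ! j) * lead (v (p i)) (zs ! j))"
      using i by (simp add: leads_def scalar_prod_def atLeast0LessThan)
    also have "\<dots> = (\<Sum>y\<in>Z. lead (v i) y * lead (v (p i)) y)" by (rule sum_nth_zs)
    finally show "(\<Sum>y\<in>Z. lead (v i) y * lead (v (p i)) y) \<noteq> 0" using nz[OF i] by simp
  qed
  then show ?thesis using p1 by blast
qed

text \<open>
  The equality case of the Riemann--Hurwitz inequality: the curve has a single, totally ramified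
  place over \<open>x = \<infinity>\<close>. For a reduced basis \<open>v\<close>, twice the total growth is \<open>n * degree (disc_y f) = n * (d - 1)\<close>. Pairing the
  members by the permutation of \<open>gram_permutation\<close> makes it a sum of \<open>d\<close> multiples of \<open>n\<close>. Such a multiple
  is 0 only if both members have growth 0; members of growth 0 are constants, so by independence there is at most one of
  them, and it is paired with itself. Hence exactly one multiple is 0 and the others equal \<open>n\<close>, so the growth of every other
  member lies strictly between 0 and \<open>n\<close>. Averaging over \<open>U\<close> then shows that every \<open>U\<close>-invariant function on the roots is
  constant.
\<close>

theorem rotations_transitive_on_roots:
  assumes minimal: "degree (disc_y f) + 1 = d" and y: "y \<in> Z" and z: "z \<in> Z"
  shows "\<exists>\<zeta>\<in>U. z = fls_rotate \<zeta> y"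
proof -
  obtain v where v: "v \<in> bases" and indep: "\<And>x i. (\<forall>y\<in>Z. (\<Sum>i<d. x i * lead (v i) y) = 0) \<Longrightarrow> i < d \<Longrightarrow> x i = 0"
    using reduced_basis_exists by blast
  have det: "det (leads v) \<noteq> 0" using indep by (rule det_leads_nz)
  have vR: "v i \<in> form_ring" "v i \<noteq> 0" if "i < d" for i using v bases_nz[OF v that] that by (auto simp: bases_def)
  have N0: "growth (v i) \<ge> 0" if "i < d" for i using vR[OF that] by (rule growth_nonneg)
  have sumN: "2 * (\<Sum>i<d. growth (v i)) = int n * int (d - 1)"
    using v subdegree_det_value_mat[OF det] minimal by (simp add: bases_def flip: minimal)
  obtain p where p: "p permutes {0..<d}" and dvd: "\<And>i. i < d \<Longrightarrow> int n dvd (growth (v i) + growth (v (p i)))"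
    using gram_permutation[OF det] by blast
  have p_lt: "p i < d" if "i < d" for i using p that permutes_in_image[of p "{0..<d}" i] by simp
  define K where "K i = (growth (v i) + growth (v (p i))) div int n" for i
  have K: "growth (v i) + growth (v (p i)) = int n * K i" if "i < d" for i using dvd[OF that] by (simp add: K_def)
  have K_ge: "K i \<ge> 0" if "i < d" for i
    using N0[OF that] N0[OF p_lt[OF that]] n_pos by (simp add: K_def pos_imp_zdiv_nonneg_iff)
  have "(\<Sum>i<d. growth (v (p i))) = (\<Sum>i<d. growth (v i))"
    using sum.permute[OF p, of "\<lambda>i. growth (v i)"] by (simp add: atLeast0LessThan comp_def)
  then have "(\<Sum>i<d. int n * K i) = 2 * (\<Sum>i<d. growth (v i))"
    by (simp add: sum.distrib flip: K)
  then have "int n * (\<Sum>i<d. K i) = int n * int (d - 1)" using sumN by (simp add: sum_distrib_left)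
  then have sumK: "(\<Sum>i<d. K i) = int (d - 1)" using n_pos by simp
  have "\<exists>i<d. K i = 0"
  proof (rule ccontr)
    assume "\<not> ?thesis"
    then have "K i \<ge> 1" if "i < d" for i using K_ge[OF that] that by force
    then have "(\<Sum>i<d. K i) \<ge> (\<Sum>i<d. 1)" by (intro sum_mono) auto
    then show False using sumK deg_pos by simp
  qed
  then obtain i0 where i0: "i0 < d" "K i0 = 0" by blast
  have N_i0: "growth (v i0) = 0" "growth (v (p i0)) = 0"
    using K[OF i0(1)] i0(2) N0[OF i0(1)] N0[OF p_lt[OF i0(1)]] by auto
  have lead_const: "\<exists>c. c \<noteq> 0 \<and> (\<forall>y\<in>Z. lead (v i) y = c)" if i: "i < d" "growth (v i) = 0" for i
  proof -
    obtain c where "c \<noteq> 0" "v i = [:[:c:]:]" using growth_le_0_imp_const[of "v i"] vR[OF i(1)] i(2) by auto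
    then show ?thesis using i(2) by (intro exI[of _ c]) (simp add: lead_def ev_const embed_inf_const)
  qed
  obtain c0 where c0: "c0 \<noteq> 0" "\<And>y. y \<in> Z \<Longrightarrow> lead (v i0) y = c0" using lead_const[OF i0(1) N_i0(1)] by blast
  have uniq: "i = i0" if i: "i < d" "growth (v i) = 0" for i
  proof (rule ccontr)
    assume ne: "i \<noteq> i0"
    obtain c where c: "c \<noteq> 0" "\<And>y. y \<in> Z \<Longrightarrow> lead (v i) y = c" using lead_const[OF i] by blast
    define x where "x j = (if j = i then c0 else if j = i0 then - c else 0)" for j
    have "(\<Sum>j<d. x j * lead (v j) y) = 0" if "y \<in> Z" for y
    proof -
      have "(\<Sum>j<d. x j * lead (v j) y) = (\<Sum>j\<in>{i, i0}. x j * lead (v j) y)"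
        using i i0 by (intro sum.mono_neutral_right) (auto simp: x_def)
      then show ?thesis using ne c c0 that by (simp add: x_def)
    qed
    then have "x i = 0" using indep i by blast
    then show False using c0 by (simp add: x_def)
  qed
  have p_i0: "p i0 = i0" using uniq[OF p_lt[OF i0(1)] N_i0(2)] .
  have p_ne: "p i \<noteq> i0" if "i \<noteq> i0" for i using p_i0 that p by (metis permutes_inj injD)
  have K1: "K i \<ge> 1" if "i < d" "i \<noteq> i0" for i
  proof -
    have "K i \<noteq> 0" using K[OF that(1)] N0[OF that(1)] N0[OF p_lt[OF that(1)]] uniq[OF that(1)] that(2) by auto
    then show ?thesis using K_ge[OF that(1)] by simp
  qed
  have Keq: "K i = 1" if "i < d" "i \<noteq> i0" for i
  proof (rule ccontr)
    assume "K i \<noteq> 1"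
    then have "K i > 1" using K1[OF that] by simp
    have "(\<Sum>j\<in>{..<d} - {i0}. 1) < (\<Sum>j\<in>{..<d} - {i0}. K j)"
      using K1 \<open>K i > 1\<close> that by (intro sum_strict_mono_ex1) (auto intro!: bexI[of _ i])
    also have "\<dots> = (\<Sum>j<d. K j)" using i0 by (simp add: sum.remove[of "{..<d}" i0])
    finally show False using sumK i0(1) by (simp add: card_Diff_singleton)
  qed
  have not_dvd: "\<not> int n dvd growth (v i)" if "i < d" "i \<noteq> i0" for i
  proof
    assume a: "int n dvd growth (v i)"
    have "growth (v i) > 0" "growth (v (p i)) > 0"
      using N0[OF that(1)] N0[OF p_lt[OF that(1)]] uniq[OF that(1)] uniq[OF p_lt[OF that(1)]] that(2) p_ne[OF that(2)]
      by force+
    moreover have "growth (v i) + growth (v (p i)) = int n" using K[OF that(1)] Keq[OF that] by simp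
    ultimately show False using a zdvd_imp_le[OF a] by simp
  qed
  \<comment> \<open>the indicator function of the orbit of \<open>y\<close>\<close>
  define g :: "'k fls \<Rightarrow> 'k" where "g u = (if \<exists>\<zeta>\<in>U. u = fls_rotate \<zeta> y then 1 else 0)" for u
  have g_rot: "g (fls_rotate \<zeta> u) = g u" if "\<zeta> \<in> U" for \<zeta> u
  proof -
    have ne: "\<zeta> \<noteq> 0" using that n_pos by (auto simp: power_0_left)
    have "(\<exists>\<eta>\<in>U. fls_rotate \<zeta> u = fls_rotate \<eta> y) \<longleftrightarrow> (\<exists>\<eta>\<in>U. u = fls_rotate \<eta> y)"
    proof
      assume "\<exists>\<eta>\<in>U. fls_rotate \<zeta> u = fls_rotate \<eta> y"
      then obtain \<eta> where "\<eta> \<in> U" "fls_rotate \<zeta> u = fls_rotate \<eta> y" by blast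
      then have "u = fls_rotate (inverse \<zeta> * \<eta>) y" using ne by (metis fls_rotate_mult fls_rotate_1 left_inverse)
      then show "\<exists>\<eta>\<in>U. u = fls_rotate \<eta> y" using \<open>\<eta> \<in> U\<close> that
        by (intro bexI[of _ "inverse \<zeta> * \<eta>"]) (auto simp: power_mult_distrib power_inverse)
    next
      assume "\<exists>\<eta>\<in>U. u = fls_rotate \<eta> y"
      then obtain \<eta> where "\<eta> \<in> U" "u = fls_rotate \<eta> y" by blast
      then show "\<exists>\<eta>\<in>U. fls_rotate \<zeta> u = fls_rotate \<eta> y" using that
        by (intro bexI[of _ "\<zeta> * \<eta>"]) (auto simp: fls_rotate_mult power_mult_distrib)
    qed
    then show ?thesis by (simp add: g_def)
  qed
  \<comment> \<open>the coordinates of \<open>g\<close> with respect to the leading coefficients, by Cramer's rule\<close>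
  obtain x where x: "\<And>u. u \<in> Z \<Longrightarrow> g u = (\<Sum>i<d. x i * lead (v i) u)"
  proof -
    let ?A = "transpose_mat (leads v)"
    have A: "?A \<in> carrier_mat d d" using leads_carrier by simp
    have dA: "det ?A \<noteq> 0" using det det_transpose[OF leads_carrier] by simp
    define b where "b = vec d (\<lambda>j. g (zs ! j))"
    define x where "x = (1 / det ?A) \<cdot>\<^sub>v (adj_mat ?A *\<^sub>v b)"
    have b: "b \<in> carrier_vec d" by (simp add: b_def)
    have adj: "adj_mat ?A \<in> carrier_mat d d" "?A * adj_mat ?A = det ?A \<cdot>\<^sub>m 1\<^sub>m d" using adj_mat[OF A] by auto
    have xc: "x \<in> carrier_vec d" using adj b by (simp add: x_def)
    have "?A *\<^sub>v x = (1 / det ?A) \<cdot>\<^sub>v (?A *\<^sub>v (adj_mat ?A *\<^sub>v b))"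
      unfolding x_def using A adj b by (intro mult_mat_vec) auto
    also have "?A *\<^sub>v (adj_mat ?A *\<^sub>v b) = (det ?A \<cdot>\<^sub>m 1\<^sub>m d) *\<^sub>v b"
      using A adj b by (metis assoc_mult_mat_vec)
    also have "\<dots> = det ?A \<cdot>\<^sub>v b" using b
      by (intro eq_vecI) (auto simp: scalar_prod_def if_distrib[of "\<lambda>x. _ * x"] if_distrib[of "\<lambda>x. x * _"] cong: if_cong)
    finally have Ax: "?A *\<^sub>v x = b" using dA b by (simp add: smult_smult_assoc)
    have "g u = (\<Sum>i<d. x $ i * lead (v i) u)" if u: "u \<in> Z" for u
    proof -
      obtain j where j: "j < d" "u = zs ! j" using u length_zs by (auto simp: in_set_conv_nth)
      have "(\<Sum>i<d. x $ i * lead (v i) u) = (?A *\<^sub>v x) $ j"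
        using j xc by (simp add: leads_def scalar_prod_def atLeast0LessThan mult.commute)
      then show ?thesis using Ax j by (simp add: b_def)
    qed
    then show thesis using that by blast
  qed
  have "g u = x i0 * c0" if u: "u \<in> Z" for u
  proof -
    have "of_nat (card U) * g u = (\<Sum>\<zeta>\<in>U. \<zeta> powi 0 * g (fls_rotate \<zeta> u))" by (simp add: g_rot)
    also have "\<dots> = (\<Sum>\<zeta>\<in>U. \<zeta> powi 0 * (\<Sum>i<d. x i * lead (v i) (fls_rotate \<zeta> u)))"
      using u by (intro sum.cong refl) (simp add: x rotate_Z)
    also have "\<dots> = of_nat (card U) * (\<Sum>i<d. if int n dvd (0 - growth (v i)) then x i * lead (v i) u else 0)"
      by (rule average_lead)
    also have "(\<Sum>i<d. if int n dvd (0 - growth (v i)) then x i * lead (v i) u else 0)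
        = (\<Sum>i<d. if i = i0 then x i0 * c0 else 0)"
      using not_dvd N_i0 c0(2)[OF u] by (intro sum.cong refl) auto
    also have "\<dots> = x i0 * c0" using i0 by simp
    finally show ?thesis using card_U_nz by simp
  qed
  then have "g z = g y" using y z by simp
  also have "g y = 1" unfolding g_def by (auto intro!: exI[of _ 1])
  finally show ?thesis by (auto simp: g_def split: if_splits)
qed

end

section \<open>The action of the general linear group\<close>

definition mat2 :: "'a \<Rightarrow> 'a \<Rightarrow> 'a \<Rightarrow> 'a \<Rightarrow> 'a mat" where
  "mat2 a b c d = mat 2 2 (\<lambda>(i, j). if i = 0 then if j = 0 then a else b else if j = 0 then c else d)"

lemma mat2_carrier: "mat2 a b c d \<in> carrier_mat 2 2" by (simp add: mat2_def)

lemma mat2_index [simp]: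
  "mat2 a b c d $$ (0, 0) = a" "mat2 a b c d $$ (0, Suc 0) = b"
  "mat2 a b c d $$ (Suc 0, 0) = c" "mat2 a b c d $$ (Suc 0, Suc 0) = d"
  by (simp_all add: mat2_def)

lemma eq_mat2I:
  assumes "A \<in> carrier_mat 2 2" "B \<in> carrier_mat 2 2"
    "A $$ (0, 0) = B $$ (0, 0)" "A $$ (0, Suc 0) = B $$ (0, Suc 0)"
    "A $$ (Suc 0, 0) = B $$ (Suc 0, 0)" "A $$ (Suc 0, Suc 0) = B $$ (Suc 0, Suc 0)"
  shows "A = B"
  using assms by (intro eq_matI) (auto simp: less_2_cases_iff)

lemma mult_index_2:
  assumes "A \<in> carrier_mat 2 2" "B \<in> carrier_mat 2 2" "i < 2" "j < 2"
  shows "(A * B) $$ (i, j) = A $$ (i, 0) * B $$ (0, j) + A $$ (i, Suc 0) * B $$ (Suc 0, j)"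
  using assms by (simp add: scalar_prod_def numeral_2_eq_2)

lemma GL2_iff:
  "A \<in> GL2 \<longleftrightarrow> A \<in> carrier_mat 2 2 \<and> (\<exists>C \<in> carrier_mat 2 2. A * C = 1\<^sub>m 2 \<and> C * A = 1\<^sub>m 2)"
proof
  assume A: "A \<in> GL2"
  then have c: "A \<in> carrier_mat 2 2" by (simp add: GL2_def)
  from A c have "\<exists>C. A * C = 1\<^sub>m 2 \<and> C * A = 1\<^sub>m (dim_row C)"
    by (auto simp: GL2_def invertible_mat_def inverts_mat_def)
  then obtain C where C: "A * C = 1\<^sub>m 2" "C * A = 1\<^sub>m (dim_row C)" by blast
  have "C \<in> carrier_mat 2 2"
    using C c by (metis carrier_matD(2) carrier_matI index_mult_mat(3) index_one_mat(3))
  then show "A \<in> carrier_mat 2 2 \<and> (\<exists>C \<in> carrier_mat 2 2. A * C = 1\<^sub>m 2 \<and> C * A = 1\<^sub>m 2)"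
    using c C by auto
next
  assume "A \<in> carrier_mat 2 2 \<and> (\<exists>C \<in> carrier_mat 2 2. A * C = 1\<^sub>m 2 \<and> C * A = 1\<^sub>m 2)"
  then show "A \<in> GL2" by (auto simp: GL2_def invertible_mat_def inverts_mat_def)
qed

lemma GL2_mult:
  fixes A B :: "'a::comm_ring_1 poly mat"
  assumes "A \<in> GL2" "B \<in> GL2" shows "A * B \<in> GL2"
proof -
  from assms obtain C D where c: "A \<in> carrier_mat 2 2" "B \<in> carrier_mat 2 2" "C \<in> carrier_mat 2 2" "D \<in> carrier_mat 2 2"
    and 1: "A * C = 1\<^sub>m 2" "C * A = 1\<^sub>m 2" "B * D = 1\<^sub>m 2" "D * B = 1\<^sub>m 2" by (auto simp: GL2_iff)
  have assoc: "(X * Y) * (Y' * X') = 1\<^sub>m 2"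
    if "X \<in> carrier_mat 2 2" "Y \<in> carrier_mat 2 2" "X' \<in> carrier_mat 2 2" "Y' \<in> carrier_mat 2 2"
      "Y * Y' = 1\<^sub>m 2" "X * X' = 1\<^sub>m 2" for X Y X' Y' :: "'a poly mat"
  proof -
    have "(X * Y) * (Y' * X') = X * (Y * (Y' * X'))" by (rule assoc_mult_mat) (use that in auto)
    also have "Y * (Y' * X') = (Y * Y') * X'" by (rule assoc_mult_mat[symmetric]) (use that in auto)
    finally show ?thesis using that by simp
  qed
  have "A * B \<in> carrier_mat 2 2" "D * C \<in> carrier_mat 2 2" using c by auto
  moreover have "(A * B) * (D * C) = 1\<^sub>m 2" "(D * C) * (A * B) = 1\<^sub>m 2"
    using c 1 by (intro assoc; simp)+
  ultimately show ?thesis unfolding GL2_iff by blast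
qed

lemma mat2_GL2:
  assumes "(a * d - b * c) * w = 1" shows "mat2 a b c d \<in> GL2"
  unfolding GL2_iff
proof (intro conjI bexI)
  have e: "a * (d * w) - b * (c * w) = 1" using assms by (simp add: algebra_simps)
  show "mat2 a b c d * mat2 (w * d) (- w * b) (- w * c) (w * a) = 1\<^sub>m 2"
    "mat2 (w * d) (- w * b) (- w * c) (w * a) * mat2 a b c d = 1\<^sub>m 2"
    using e by (intro eq_mat2I mult_carrier_mat[OF mat2_carrier mat2_carrier] one_carrier_mat;
        simp add: mult_index_2[OF mat2_carrier mat2_carrier] mult_ac)+
qed (rule mat2_carrier)+

lemma GL2_second_row_nz:
  assumes "A \<in> GL2" shows "[:A $$ (1, 1), A $$ (1, 0):] \<noteq> 0"
proof
  assume "[:A $$ (1, 1), A $$ (1, 0):] = 0"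
  moreover obtain C where "A \<in> carrier_mat 2 2" "C \<in> carrier_mat 2 2" "A * C = 1\<^sub>m 2"
    using assms by (auto simp: GL2_iff)
  then have "A $$ (1, 0) * C $$ (0, 1) + A $$ (1, 1) * C $$ (1, 1) = 1"
    using mult_index_2[of A C 1 1] by simp
  ultimately show False by simp
qed

text \<open>
  \<open>G_act\<close> clears denominators with the actual degree of its argument, so the two exponents have to agree for the actions
  to compose. The computation takes place in the fraction field, where the action is a substitution.
\<close>

lemma G_act_G_act:
  fixes h :: "'a::field poly poly"
  assumes A: "A \<in> GL2" and B: "B \<in> carrier_mat 2 2" and deg: "degree (G_act B h) = degree h"
  shows "G_act A (G_act B h) = G_act (B * A) h"
proof -
  let ?d = "degree h"
  define c :: "'a poly \<Rightarrow> 'a poly poly fract" where "c q = to_fract [:q:]" for q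
  interpret tf: inj_comm_ring_hom "to_fract :: 'a poly poly \<Rightarrow> _" by unfold_locales auto
  interpret c: comm_ring_hom c
    by unfold_locales (auto simp: c_def simp flip: one_pCons to_fract_mult to_fract_add)
  interpret mc: map_poly_comm_ring_hom c ..
  have Ac: "A \<in> carrier_mat 2 2" using A by (simp add: GL2_iff)
  define P where "P = [:A $$ (0, 1), A $$ (0, 0):]"
  define Q where "Q = [:A $$ (1, 1), A $$ (1, 0):]"
  let ?u = "to_fract P" and ?v = "to_fract Q"
  have v: "?v \<noteq> 0" using GL2_second_row_nz[OF A] by (simp add: Q_def)
  have lin: "?v * poly (map_poly c [:q, p:]) (?u / ?v) = to_fract ([:p:] * P + [:q:] * Q)" for p q
    using v by (simp add: c.map_poly_pCons_hom c_def tf.hom_add tf.hom_mult field_simps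
        del: mult_pCons_left mult_pCons_right)
  have row: "[:p:] * P + [:q:] * Q = [:p * A $$ (0, 1) + q * A $$ (1, 1), p * A $$ (0, 0) + q * A $$ (1, 0):]" for p q
    by (simp add: P_def Q_def)
  have "to_fract (G_act A (G_act B h)) = ?v ^ ?d * poly (map_poly c (G_act B h)) (?u / ?v)"
    unfolding P_def Q_def c_def deg[symmetric] by (rule to_fract_G_act[OF A])
  also have "poly (map_poly c (G_act B h)) (?u / ?v) = (\<Sum>i\<le>?d. c (coeff h i) *
      (poly (map_poly c [:B $$ (0, 1), B $$ (0, 0):]) (?u / ?v) ^ i *
       poly (map_poly c [:B $$ (1, 1), B $$ (1, 0):]) (?u / ?v) ^ (?d - i)))"
    unfolding G_act_def mc.hom_sum mc.hom_mult mc.hom_power poly_sum poly_mult poly_power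
    by (intro sum.cong refl) (simp add: c.map_poly_pCons_hom)
  also have "?v ^ ?d * \<dots> = (\<Sum>i\<le>?d. c (coeff h i) *
      ((?v * poly (map_poly c [:B $$ (0, 1), B $$ (0, 0):]) (?u / ?v)) ^ i *
       (?v * poly (map_poly c [:B $$ (1, 1), B $$ (1, 0):]) (?u / ?v)) ^ (?d - i)))"
    unfolding sum_distrib_left
  proof (intro sum.cong refl)
    fix i assume "i \<in> {..?d}"
    then have "?v ^ ?d = ?v ^ i * ?v ^ (?d - i)" by (simp flip: power_add)
    then show "?v ^ ?d * (c (coeff h i) *
      (poly (map_poly c [:B $$ (0, 1), B $$ (0, 0):]) (?u / ?v) ^ i *
       poly (map_poly c [:B $$ (1, 1), B $$ (1, 0):]) (?u / ?v) ^ (?d - i))) = c (coeff h i) *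
      ((?v * poly (map_poly c [:B $$ (0, 1), B $$ (0, 0):]) (?u / ?v)) ^ i *
       (?v * poly (map_poly c [:B $$ (1, 1), B $$ (1, 0):]) (?u / ?v)) ^ (?d - i))"
      by (simp only: power_mult_distrib mult_ac)
  qed
  also have "\<dots> = to_fract (\<Sum>i\<le>?d. [:coeff h i:] *
      (([:B $$ (0, 0):] * P + [:B $$ (0, 1):] * Q) ^ i * ([:B $$ (1, 0):] * P + [:B $$ (1, 1):] * Q) ^ (?d - i)))"
    unfolding lin c_def by (simp only: tf.hom_sum tf.hom_mult tf.hom_power)
  also have "\<dots> = to_fract (G_act (B * A) h)"
  proof -
    have lt: "(0::nat) < 2" "(1::nat) < 2" by simp_all
    show ?thesis
      unfolding G_act_def row mult_index_2[OF B Ac lt(1) lt(1)] mult_index_2[OF B Ac lt(1) lt(2)]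
        mult_index_2[OF B Ac lt(2) lt(1)] mult_index_2[OF B Ac lt(2) lt(2)]
      unfolding One_nat_def ..
  qed
  finally show ?thesis by simp
qed

lemma G_act_translation: "G_act (mat2 1 b 0 1) h = h \<circ>\<^sub>p [:b, 1:]"
  by (simp add: G_act_def pcompose_altdef poly_altdef coeff_map_poly degree_map_poly flip: one_pCons)

lemma G_act_swap: "coeff h 0 \<noteq> 0 \<Longrightarrow> G_act (mat2 0 1 1 0) h = reflect_poly h"
proof -
  have *: "G_act (mat2 0 1 1 0) h = (\<Sum>i\<le>degree h. monom (coeff h i) (degree h - i))"
    unfolding G_act_def by (intro sum.cong refl) (simp add: monom_altdef flip: one_pCons)
  also have "\<dots> = (\<Sum>i<Suc (degree h). monom (coeff h (degree h - i)) i)"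
    unfolding lessThan_Suc_atMost[symmetric]
    by (subst sum.nat_diff_reindex[symmetric]) (intro sum.cong refl, simp)
  also have "\<dots> = reflect_poly h"
    by (rule poly_eqI) (auto simp: coeff_sum coeff_reflect_poly)
  finally show ?thesis .
qed

lemma G_act_scalar: "G_act (mat2 [:s:] 0 0 [:s:]) h = smult [:s ^ degree h:] h"
proof -
  have "[:coeff h i:] * ([:0, [:s:]:] ^ i * [:[:s:]:] ^ (degree h - i)) = monom (s' * coeff h i) i"
    if "i \<le> degree h" "s' = [:s ^ degree h:]" for i s'
  proof -
    have "[:0, [:s:]:] = smult [:s:] [:0, 1:]" by simp
    then have "[:0, [:s:]:] ^ i = smult ([:s:] ^ i) ([:0, 1:] ^ i)" by (simp only: smult_power)
    moreover have "[:[:s:]:] ^ (degree h - i) = [:[:s:] ^ (degree h - i):]" by (simp add: poly_const_pow)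
    moreover have "[:s:] ^ i * [:s:] ^ (degree h - i) = [:s ^ degree h:]"
      using that by (simp add: poly_const_pow flip: power_add)
    ultimately show ?thesis using that(2) by (simp add: monom_altdef mult_ac)
  qed
  then have "G_act (mat2 [:s:] 0 0 [:s:]) h = (\<Sum>i\<le>degree h. monom ([:s ^ degree h:] * coeff h i) i)"
    unfolding G_act_def by (intro sum.cong refl) simp
  also have "\<dots> = smult [:s ^ degree h:] (\<Sum>i\<le>degree h. monom (coeff h i) i)"
    by (simp only: smult_sum2 smult_monom)
  also have "(\<Sum>i\<le>degree h. monom (coeff h i) i) = h" by (rule poly_as_sum_of_monoms)
  finally show ?thesis .
qed

section \<open>Translation and reversal\<close>

lemma fls_subdegree_prod:
  fixes g :: "'i \<Rightarrow> 'a::field fls"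
  assumes "finite I" "\<And>i. i \<in> I \<Longrightarrow> g i \<noteq> 0"
  shows "fls_subdegree (\<Prod>i\<in>I. g i) = (\<Sum>i\<in>I. fls_subdegree (g i))"
  using assms by (induction I rule: finite_induct) (auto simp: prod_zero_iff)

lemma sum_differences_image:
  assumes "inj_on \<phi> Z"
  shows "(\<Sum>y\<in>\<phi> ` Z. \<Sum>z\<in>\<phi> ` Z - {y}. s y z) = (\<Sum>y\<in>Z. \<Sum>z\<in>Z - {y}. s (\<phi> y) (\<phi> z))"
proof -
  have "\<phi> ` Z - {\<phi> y} = \<phi> ` (Z - {y})" if "y \<in> Z" for y using assms that by (auto simp: inj_on_def)
  moreover have "inj_on \<phi> (Z - {y})" for y using assms by (rule inj_on_subset) auto
  ultimately show ?thesis using assms by (simp add: sum.reindex cong: sum.cong)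
qed

text \<open>
  For invertible changes of variables \<open>\<psi>\<close>. Reversal of the coefficients, one of the two applications, is multiplicative but
  not additive, and it is an involution only on polynomials with nonzero constant coefficient; so the
  assumptions are restricted to factorizations of \<open>h'\<close>.
\<close>

lemma irreducible_pullback:
  fixes h' :: "'a::idom poly poly"
  assumes "irreducible (\<psi> h')" "h' \<noteq> 0"
    and "\<And>p q. h' = p * q \<Longrightarrow> \<psi> h' = \<psi> p * \<psi> q"
    and "\<And>p q. h' = p * q \<Longrightarrow> \<psi> p dvd 1 \<Longrightarrow> p dvd 1" and "h' dvd 1 \<Longrightarrow> \<psi> h' dvd 1"
  shows "irreducible h'"
proof (rule irreducibleI)
  show "h' \<noteq> 0" by fact
  show "\<not> h' dvd 1" using assms(1,5) irreducible_not_unit by blast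
  fix p q assume pq: "h' = p * q"
  then have "\<psi> p dvd 1 \<or> \<psi> q dvd 1" using assms(1,3) irreducibleD by metis
  then show "p dvd 1 \<or> q dvd 1" using assms(4)[of p q] assms(4)[of q p] pq by (auto simp: mult.commute)
qed

lemma pcompose_shift_inverse: "(h \<circ>\<^sub>p [:b, 1:]) \<circ>\<^sub>p [:-b, 1:] = (h :: 'a::comm_ring_1 poly)"
  by (simp add: pcompose_pCons flip: pcompose_assoc)

lemma dvd_1_pcompose: "p dvd 1 \<Longrightarrow> p \<circ>\<^sub>p r dvd 1" for p :: "'a::comm_ring_1 poly"
  by (metis dvdE dvdI pcompose_1 pcompose_mult)

lemma irreducible_translate:
  fixes h :: "'a::idom poly poly"
  assumes "irreducible h" shows "irreducible (h \<circ>\<^sub>p [:b, 1:])"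
proof (rule irreducible_pullback[where \<psi> = "\<lambda>p. p \<circ>\<^sub>p [:-b, 1:]"])
  show "irreducible ((h \<circ>\<^sub>p [:b, 1:]) \<circ>\<^sub>p [:-b, 1:])" using assms by (simp only: pcompose_shift_inverse)
  show "h \<circ>\<^sub>p [:b, 1:] \<noteq> 0" using assms by (metis pcompose_0 pcompose_shift_inverse not_irreducible_zero)
  fix p assume "p \<circ>\<^sub>p [:-b, 1:] dvd 1"
  then have "(p \<circ>\<^sub>p [:-b, 1:]) \<circ>\<^sub>p [:b, 1:] dvd 1" by (rule dvd_1_pcompose)
  then show "p dvd 1" using pcompose_shift_inverse[of p "-b"] by simp
qed (auto intro: dvd_1_pcompose simp: pcompose_mult)

lemma dvd_1_reflect_poly: "p dvd 1 \<Longrightarrow> reflect_poly p dvd 1" for p :: "'a::idom poly"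
  by (metis dvdE dvdI reflect_poly_1 reflect_poly_mult)

lemma irreducible_reflect_poly:
  fixes h :: "'a::idom poly poly"
  assumes "irreducible h" "coeff h 0 \<noteq> 0" shows "irreducible (reflect_poly h)"
proof (rule irreducible_pullback[where \<psi> = reflect_poly])
  have h0: "h \<noteq> 0" using assms by auto
  show "irreducible (reflect_poly (reflect_poly h))" using assms by simp
  show "reflect_poly h \<noteq> 0" using h0 by simp
  fix p q assume pq: "reflect_poly h = p * q" and "reflect_poly p dvd 1"
  from \<open>reflect_poly p dvd 1\<close> have "reflect_poly (reflect_poly p) dvd 1" by (rule dvd_1_reflect_poly)
  moreover have "coeff p 0 \<noteq> 0" using arg_cong[OF pq, of "\<lambda>p. coeff p 0"] h0 by (auto simp: coeff_mult_0)
  ultimately show "p dvd 1" by simp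
qed (auto intro: dvd_1_reflect_poly simp: reflect_poly_mult)

lemma irreducible_coeff_0_nz:
  fixes h :: "'a::idom poly poly"
  assumes "irreducible h" "degree h > 1" shows "coeff h 0 \<noteq> 0"
proof
  assume "coeff h 0 = 0"
  then have "h = [:0, 1:] * pCons (coeff h 0) 0 + [:0, 1:] * poly_shift 1 h"
    by (intro poly_eqI) (auto simp: coeff_pCons coeff_poly_shift split: nat.splits)
  then have h: "h = [:0, 1:] * poly_shift 1 h" using \<open>coeff h 0 = 0\<close> by simp
  then have "[:0, 1:] dvd (1 :: 'a poly poly) \<or> poly_shift 1 h dvd 1" using assms(1) irreducibleD by blast
  moreover have "\<not> [:0, 1:] dvd (1 :: 'a poly poly)" by (auto simp: poly_dvd_1)
  moreover have "degree h = Suc (degree (poly_shift 1 h))"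
    using assms(2) by (subst h, subst degree_mult_eq) (use h assms in auto)
  then have "\<not> poly_shift 1 h dvd 1" using assms(2) by (auto simp: poly_dvd_1)
  ultimately show False by blast
qed

context puiseux_roots
begin

lemma subdegree_e: "p \<noteq> 0 \<Longrightarrow> fls_subdegree (e p) = - (int n * int (degree p))"
  by (rule subdegree_embed_inf[OF n_pos])

lemma degree_disc:
  "int n * int (degree (disc_y f)) = 2 * int (d - 1) * (int n * int (degree (lead_coeff f)))
     - (\<Sum>y\<in>Z. \<Sum>z\<in>Z - {y}. fls_subdegree (y - z))"
proof -
  let ?D = "\<Prod>y\<in>Z. \<Prod>z\<in>Z - {y}. y - z"
  obtain s where s: "s \<in> {1, -1}" "e (disc_y f) = s * (e (lead_coeff f) ^ (2 * (d - 1)) * ?D)"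
    using disc_roots by blast
  have D0: "?D \<noteq> 0" by (auto simp: prod_zero_iff)
  have "fls_subdegree (e (disc_y f)) = fls_subdegree (e (lead_coeff f) ^ (2 * (d - 1)) * ?D)"
    using s by auto
  also have "\<dots> = 2 * int (d - 1) * fls_subdegree (e (lead_coeff f)) + fls_subdegree ?D"
    using D0 e_lc_nz by (subst fls_subdegree_mult) (auto simp: fls_subdegree_pow)
  also have "fls_subdegree ?D = (\<Sum>y\<in>Z. fls_subdegree (\<Prod>z\<in>Z - {y}. y - z))"
    by (rule fls_subdegree_prod) (auto simp: prod_zero_iff)
  also have "\<dots> = (\<Sum>y\<in>Z. \<Sum>z\<in>Z - {y}. fls_subdegree (y - z))"
    by (intro sum.cong refl fls_subdegree_prod) auto
  finally show ?thesis using f_nz subdegree_e[OF disc_nz] subdegree_e[of "lead_coeff f"] by simp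
qed

lemma degree_coeff_0:
  assumes "0 \<notin> Z"
  shows "int n * int (degree (coeff f 0)) = int n * int (degree (lead_coeff f)) - (\<Sum>y\<in>Z. fls_subdegree y)"
proof -
  have "e (coeff f 0) = ev f 0" by (simp add: ev_def poly_0_coeff_0)
  also have "\<dots> = e (lead_coeff f) * (\<Prod>y\<in>Z. - y)" by (simp add: ev_def F_prod poly_prod)
  finally have eq: "e (coeff f 0) = e (lead_coeff f) * (\<Prod>y\<in>Z. - y)" .
  have nz: "(\<Prod>y\<in>Z. - y) \<noteq> 0" using assms by (auto simp: prod_zero_iff)
  then have c0: "coeff f 0 \<noteq> 0" using eq e_lc_nz by auto
  have "fls_subdegree (\<Prod>y\<in>Z. - y) = (\<Sum>y\<in>Z. fls_subdegree (- y))"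
    using assms by (intro fls_subdegree_prod) auto
  then have "fls_subdegree (e (coeff f 0)) = fls_subdegree (e (lead_coeff f)) + (\<Sum>y\<in>Z. fls_subdegree y)"
    using nz e_lc_nz by (subst eq, subst fls_subdegree_mult) auto
  then show ?thesis using f_nz subdegree_e[OF c0] subdegree_e[of "lead_coeff f"] by simp
qed

lemma zero_notin_Z: "d > 1 \<Longrightarrow> 0 \<notin> Z"
  using irreducible_coeff_0_nz[OF irr] by (simp add: ev_f ev_def poly_0_coeff_0)

lemma puiseux_roots_translate: "puiseux_roots (f \<circ>\<^sub>p [:b, 1:]) n (map (\<lambda>z. z - e b) zs)"
proof (rule puiseux_rootsI)
  show "irreducible (f \<circ>\<^sub>p [:b, 1:])" using irr by (rule irreducible_translate)
  show "degree (f \<circ>\<^sub>p [:b, 1:]) > 0" using deg_pos by (simp add: degree_pcompose)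
  have "(prod_linear xs) \<circ>\<^sub>p [:c, 1:] = (prod_linear (map (\<lambda>z. z - c) xs))" for xs and c :: "'k fls"
    by (induction xs) (simp_all add: pcompose_mult pcompose_pCons del: mult_pCons_left)
  moreover have "map_poly e (f \<circ>\<^sub>p [:b, 1:]) = F \<circ>\<^sub>p [:e b, 1:]"
    by (simp only: e.map_poly_pcompose e.map_poly_pCons_hom e.hom_one map_poly_0)
  ultimately show "map_poly e (f \<circ>\<^sub>p [:b, 1:]) = smult (e (lead_coeff f)) (prod_linear (map (\<lambda>z. z - e b) zs))"
    by (simp only: split pcompose_smult)
qed (rule n_pos)

lemma puiseux_roots_reflect:
  assumes "d > 1" shows "puiseux_roots (reflect_poly f) n (map inverse zs)"
proof -
  have c0: "coeff f 0 \<noteq> 0" using irreducible_coeff_0_nz[OF irr assms] .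
  have "\<exists>c. reflect_poly (prod_linear xs) = smult c (prod_linear (map inverse xs))" if "0 \<notin> set xs" for xs :: "'k fls list"
    using that
  proof (induction xs)
    case (Cons a xs)
    then obtain c where c: "reflect_poly (prod_linear xs) = smult c (prod_linear (map inverse xs))" by auto
    have "reflect_poly [:-a, 1:] = smult (-a) [:- inverse a, 1:]"
      using Cons.prems by (simp add: reflect_poly_pCons)
    then have "reflect_poly (prod_linear (a # xs)) = smult (-a * c) (prod_linear (map inverse (a # xs)))"
      by (simp only: list.map prod_list.Cons reflect_poly_mult c mult_smult_left mult_smult_right smult_smult mult.commute)
    then show ?case by blast
  qed (auto intro!: exI[of _ 1])
  then obtain c where c: "reflect_poly (prod_linear zs) = smult c (prod_linear (map inverse zs))"
    using zero_notin_Z[OF assms] by blast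
  have "map_poly e (reflect_poly f) = reflect_poly F"
    by (rule poly_eqI) (simp add: coeff_reflect_poly)
  also have "\<dots> = smult (e (lead_coeff f) * c) (prod_linear (map inverse zs))"
    unfolding split reflect_poly_smult c by simp
  finally show ?thesis
    using irreducible_reflect_poly[OF irr c0] deg_pos c0 n_pos by (intro puiseux_rootsI) simp_all
qed

lemma degree_disc_translate: "degree (disc_y (f \<circ>\<^sub>p [:b, 1:])) = degree (disc_y f)"
proof -
  interpret T: puiseux_roots "f \<circ>\<^sub>p [:b, 1:]" n "map (\<lambda>z. z - e b) zs" by (rule puiseux_roots_translate)
  have "set (map (\<lambda>z. z - e b) zs) = (\<lambda>z. z - e b) ` Z" by simp
  moreover have "lead_coeff (f \<circ>\<^sub>p [:b, 1:]) = lead_coeff f" by (subst lead_coeff_comp) auto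
  moreover have "(\<Sum>y\<in>(\<lambda>z. z - e b) ` Z. \<Sum>z\<in>(\<lambda>z. z - e b) ` Z - {y}. fls_subdegree (y - z)) = (\<Sum>y\<in>Z. \<Sum>z\<in>Z - {y}. fls_subdegree (y - z))"
    by (subst sum_differences_image) (auto simp: inj_on_def)
  ultimately have "int n * int (degree (disc_y (f \<circ>\<^sub>p [:b, 1:]))) = int n * int (degree (disc_y f))"
    unfolding T.degree_disc degree_disc by (simp add: degree_pcompose)
  then show ?thesis using n_pos by simp
qed

text \<open>
  By \<open>1/y - 1/z = (z - y) / (y * z)\<close> the differences of the roots lose in degree what the leading
  coefficient gains, when it changes from \<open>lead_coeff f\<close> to \<open>coeff f 0\<close>.
\<close>

lemma degree_disc_reflect:
  assumes "d > 1" shows "degree (disc_y (reflect_poly f)) = degree (disc_y f)"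
proof -
  interpret T: puiseux_roots "reflect_poly f" n "map inverse zs" using assms by (rule puiseux_roots_reflect)
  have c0: "coeff f 0 \<noteq> 0" using irreducible_coeff_0_nz[OF irr assms] .
  have nz: "y \<noteq> 0" if "y \<in> Z" for y using zero_notin_Z[OF assms] that by auto
  have "set (map inverse zs) = inverse ` Z" by simp
  moreover have "lead_coeff (reflect_poly f) = coeff f 0" using c0 by (simp add: coeff_reflect_poly)
  moreover have "degree (reflect_poly f) = d" using c0 by simp
  moreover have S: "(\<Sum>y\<in>inverse ` Z. \<Sum>z\<in>inverse ` Z - {y}. fls_subdegree (y - z))
      = (\<Sum>y\<in>Z. \<Sum>z\<in>Z - {y}. fls_subdegree (y - z)) - 2 * int (d - 1) * (\<Sum>y\<in>Z. fls_subdegree y)"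
  proof -
  have "(\<Sum>y\<in>inverse ` Z. \<Sum>z\<in>inverse ` Z - {y}. fls_subdegree (y - z))
      = (\<Sum>y\<in>Z. \<Sum>z\<in>Z - {y}. fls_subdegree (inverse y - inverse z))"
    by (intro sum_differences_image) (auto simp: inj_on_def)
  also have "\<dots> = (\<Sum>y\<in>Z. \<Sum>z\<in>Z - {y}. fls_subdegree (y - z) - fls_subdegree y - fls_subdegree z)"
  proof (intro sum.cong refl)
    fix y z assume yz: "y \<in> Z" "z \<in> Z - {y}"
    then have "y \<noteq> 0" "z \<noteq> 0" "y \<noteq> z" using nz by auto
    then have "inverse y - inverse z = - ((y - z) * (inverse y * inverse z))" by (simp add: field_simps)
    then show "fls_subdegree (inverse y - inverse z) = fls_subdegree (y - z) - fls_subdegree y - fls_subdegree z"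
      using \<open>y \<noteq> 0\<close> \<open>z \<noteq> 0\<close> \<open>y \<noteq> z\<close> by (simp add: fls_subdegree_mult fls_inverse_subdegree)
  qed
  also have "\<dots> = (\<Sum>y\<in>Z. \<Sum>z\<in>Z - {y}. fls_subdegree (y - z)) - 2 * int (d - 1) * (\<Sum>y\<in>Z. fls_subdegree y)"
  proof -
    have "(\<Sum>z\<in>Z - {y}. fls_subdegree y + fls_subdegree z) = (int d - 2) * fls_subdegree y + (\<Sum>z\<in>Z. fls_subdegree z)"
      if "y \<in> Z" for y
      using that assms card_Z by (simp add: sum.distrib sum_diff1 card_Diff_singleton of_nat_diff algebra_simps)
    then have "(\<Sum>y\<in>Z. \<Sum>z\<in>Z - {y}. fls_subdegree y + fls_subdegree z)
        = (\<Sum>y\<in>Z. (int d - 2) * fls_subdegree y + (\<Sum>z\<in>Z. fls_subdegree z))" by (rule sum.cong[OF refl])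
    also have "\<dots> = (int d - 2) * (\<Sum>y\<in>Z. fls_subdegree y) + int (card Z) * (\<Sum>z\<in>Z. fls_subdegree z)"
      by (simp add: sum.distrib sum_distrib_left)
    also have "\<dots> = 2 * int (d - 1) * (\<Sum>y\<in>Z. fls_subdegree y)"
      using assms card_Z by (simp add: of_nat_diff algebra_simps)
    finally show ?thesis by (simp add: sum_subtractf diff_diff_eq)
  qed
  finally show ?thesis .
  qed
  moreover have E: "2 * int (d - 1) * (int n * int (degree (coeff f 0)))
      = 2 * int (d - 1) * (int n * int (degree (lead_coeff f))) - 2 * int (d - 1) * (\<Sum>y\<in>Z. fls_subdegree y)"
    unfolding degree_coeff_0[OF zero_notin_Z[OF assms]] by (simp add: algebra_simps)
  ultimately have "int n * int (degree (disc_y (reflect_poly f))) = int n * int (degree (disc_y f))"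
    unfolding T.degree_disc degree_disc
    using E by simp
  then show ?thesis using n_pos by simp
qed

end

text \<open>
  Along with the equivalence to \<open>f\<close> this records what makes \<open>h\<close> a minimal polynomial like \<open>f\<close>, so that all
  results on roots at infinity apply to every \<open>h\<close> that is reached by the moves below.
\<close>

definition orbit :: "'k::{alg_closed_field, field_char_0} poly poly \<Rightarrow> 'k poly poly set" where
  "orbit f = {h. irreducible h \<and> degree h = degree f \<and> degree (disc_y h) = degree (disc_y f) \<and> (\<exists>A\<in>GL2. f = G_act A h)}"

lemma orbit_refl: "irreducible f \<Longrightarrow> f \<in> orbit f"
proof -
  assume "irreducible f"
  moreover have "G_act (mat2 1 0 0 1) f = f" by (simp add: G_act_translation)
  moreover have "mat2 1 0 0 1 \<in> (GL2 :: 'a poly mat set)" by (rule mat2_GL2[of _ _ _ _ 1]) simp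
  ultimately show ?thesis unfolding orbit_def by (auto intro!: bexI[of _ "mat2 1 0 0 1"])
qed

lemma orbit_step:
  assumes "h \<in> orbit f" "irreducible h'" "degree h' = degree h" "degree (disc_y h') = degree (disc_y h)"
    and "B \<in> GL2" "h = G_act B h'"
  shows "h' \<in> orbit f"
proof -
  obtain A where A: "A \<in> GL2" "f = G_act A h" using assms(1) by (auto simp: orbit_def)
  have "f = G_act (B * A) h'"
    unfolding A(2) assms(6) by (rule G_act_G_act) (use A assms in \<open>auto simp: GL2_iff\<close>)
  then show ?thesis using assms GL2_mult[OF assms(5) A(1)] by (auto simp: orbit_def)
qed

lemma orbit_translate:
  assumes "h \<in> orbit f" "degree f > 1" shows "h \<circ>\<^sub>p [:b, 1:] \<in> orbit f"
proof -
  have h: "irreducible h" "degree h > 0" using assms by (auto simp: orbit_def)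
  then obtain n zs where "puiseux_roots h n zs" using ex_puiseux_roots by blast
  then interpret puiseux_roots h n zs .
  show ?thesis
  proof (rule orbit_step[OF assms(1)])
    show "h = G_act (mat2 1 (- b) 0 1) (h \<circ>\<^sub>p [:b, 1:])" by (simp only: G_act_translation pcompose_shift_inverse)
    show "mat2 1 (- b) 0 1 \<in> GL2" by (rule mat2_GL2[of _ _ _ _ 1]) simp
  qed (use irr in \<open>auto simp: irreducible_translate degree_pcompose degree_disc_translate\<close>)
qed

lemma orbit_reflect:
  assumes "h \<in> orbit f" "degree f > 1" shows "reflect_poly h \<in> orbit f"
proof -
  have h: "irreducible h" "degree h > 1" using assms by (auto simp: orbit_def)
  then obtain n zs where "puiseux_roots h n zs" using ex_puiseux_roots[of h] by auto
  then interpret puiseux_roots h n zs .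
  have c0: "coeff h 0 \<noteq> 0" using irreducible_coeff_0_nz[OF h] .
  have "h \<noteq> 0" using h by auto
  show ?thesis
  proof (rule orbit_step[OF assms(1)])
    show "h = G_act (mat2 0 1 1 0) (reflect_poly h)"
      using c0 \<open>h \<noteq> 0\<close> by (simp add: G_act_swap)
    show "mat2 0 1 1 0 \<in> (GL2 :: 'a poly mat set)" by (rule mat2_GL2[of _ _ _ _ "-1"]) simp
  qed (use h c0 in \<open>auto simp: irreducible_reflect_poly degree_disc_reflect\<close>)
qed

section \<open>Reduction to the normal form\<close>

text \<open>
  The coefficients of a polynomial whose roots have pole order at most \<open>\<rho>\<close> lie above a Newton polygon of
  slope \<open>\<rho>\<close>.
\<close>

lemma nth_coeff_prod_linear_lower:
  fixes zs :: "'a::idom fls list"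
  assumes "\<And>z k. z \<in> set zs \<Longrightarrow> k < - \<rho> \<Longrightarrow> fls_nth z k = 0"
  shows "m < - ((int (length zs) - int k) * \<rho>) \<Longrightarrow> fls_nth (coeff (prod_linear zs) k) m = 0"
  using assms
proof (induction zs arbitrary: k m)
  case Nil
  then show ?case by (cases k) auto
next
  case (Cons a zs)
  let ?P = "prod_linear zs"
  have IH: "fls_nth (coeff ?P k) m = 0" if "m < - ((int (length zs) - int k) * \<rho>)" for k m
    using Cons.IH[OF that] Cons.prems(2) by auto
  have 1: "fls_nth (a * coeff ?P k) m = 0"
  proof (rule nth_fls_mult_lower(1)[of "- \<rho>" _ "- ((int (length zs) - int k) * \<rho>)"])
    show "m < - \<rho> + - ((int (length zs) - int k) * \<rho>)" using Cons.prems(1) by (simp add: algebra_simps)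
  qed (use Cons.prems(2) IH in auto)
  have 2: "fls_nth (coeff (pCons 0 ?P) k) m = 0"
    using Cons.prems(1) by (cases k) (auto intro!: IH simp: algebra_simps)
  have "coeff (prod_linear (a # zs)) k = coeff (pCons 0 ?P) k - a * coeff ?P k" by simp
  then show ?case using 1 2 by (simp only: fls_minus_nth) simp
qed

context puiseux_roots
begin

lemma U_nz: "\<zeta> \<in> U \<Longrightarrow> \<zeta> \<noteq> 0" using n_pos by (auto simp: power_0_left)

lemma common_order:
  assumes "degree (disc_y f) + 1 = d"
  shows "\<exists>\<rho>. \<forall>y\<in>Z. fls_subdegree y = - \<rho>"
proof -
  obtain y0 where y0: "y0 \<in> Z" using Z_nonempty by (metis ex_in_conv)
  have "fls_subdegree y = - (- fls_subdegree y0)" if "y \<in> Z" for y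
    using rotations_transitive_on_roots[OF assms y0 that] U_nz by auto
  then show ?thesis by blast
qed

text \<open>
  The rotations permute the fibres of the map from roots to leading coefficients transitively, so all fibres have the same size,
  which divides the prime \<open>d\<close>. If all leading coefficients were equal, every rotation \<open>\<zeta>\<close> would satisfy
  \<open>\<zeta> powi \<rho> = 1\<close>, although \<open>n\<close> does not divide \<open>\<rho>\<close>.
\<close>

lemma leading_coeffs_distinct:
  assumes minimal: "degree (disc_y f) + 1 = d" and prime: "prime d"
    and \<rho>: "\<forall>y\<in>Z. fls_subdegree y = - \<rho>" and ndvd: "\<not> int n dvd \<rho>"
    and yz: "y \<in> Z" "z \<in> Z" "fls_nth y (- \<rho>) = fls_nth z (- \<rho>)"
  shows "y = z"
proof -
  define c where "c y = fls_nth y (- \<rho>)" for y :: "'k fls"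
  define B where "B a = {y \<in> Z. c y = a}" for a
  have c_rot: "c (fls_rotate \<zeta> y) = \<zeta> powi (- \<rho>) * c y" for \<zeta> y by (simp add: c_def)
  have card_B: "card (B (c u)) = card (B (c w))" if "u \<in> Z" "w \<in> Z" for u w
  proof -
    obtain \<zeta> where \<zeta>: "\<zeta> \<in> U" "w = fls_rotate \<zeta> u" using rotations_transitive_on_roots[OF minimal \<open>u \<in> Z\<close> \<open>w \<in> Z\<close>] by blast
    have inj: "inj_on (fls_rotate \<zeta>) (B (c u))"
      using bij_rotate[OF \<zeta>(1)] by (auto simp: bij_betw_def B_def intro: inj_on_subset)
    have "fls_rotate \<zeta> ` B (c u) = B (c w)"
    proof
      show "fls_rotate \<zeta> ` B (c u) \<subseteq> B (c w)" using rotate_Z[OF \<zeta>(1)] by (auto simp: B_def c_rot \<zeta>(2))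
      show "B (c w) \<subseteq> fls_rotate \<zeta> ` B (c u)"
      proof
        fix x assume "x \<in> B (c w)"
        then have x: "x \<in> Z" "c x = c w" by (auto simp: B_def)
        then obtain x' where x': "x' \<in> Z" "x = fls_rotate \<zeta> x'" using bij_rotate[OF \<zeta>(1)] by (auto simp: bij_betw_def)
        then have "c x' = c u" using x(2) U_nz[OF \<zeta>(1)] by (simp add: c_rot \<zeta>(2))
        then show "x \<in> fls_rotate \<zeta> ` B (c u)" using x' by (auto simp: B_def)
      qed
    qed
    then show ?thesis using card_image[OF inj] by simp
  qed
  define s where "s = card (B (c y))"
  have "d = (\<Sum>x\<in>Z. 1)" by (simp add: card_Z)
  also have "\<dots> = (\<Sum>a\<in>c ` Z. \<Sum>x\<in>B a. 1)" unfolding B_def by (rule sum.image_gen) simp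
  also have "\<dots> = (\<Sum>a\<in>c ` Z. s)" using card_B[OF _ yz(1)] by (intro sum.cong refl) (auto simp: s_def)
  finally have "d = card (c ` Z) * s" by simp
  then have "s dvd d" by simp
  then consider "s = 1" | "s = d" using prime by (auto simp: prime_nat_iff)
  then show ?thesis
  proof cases
    case 1
    then obtain b where "B (c y) = {b}" unfolding s_def by (rule card_1_singletonE)
    moreover have "y \<in> B (c y)" "z \<in> B (c y)" using yz by (auto simp: B_def c_def)
    ultimately show ?thesis by auto
  next
    case 2
    have "B (c y) \<subseteq> Z" by (auto simp: B_def)
    then have BZ: "B (c y) = Z" using 2 card_Z by (intro card_subset_eq) (auto simp: s_def)
    have "\<not> int n dvd (- \<rho>)" using ndvd by simp
    then obtain \<zeta> :: 'k where \<zeta>: "\<zeta> ^ n = 1" "\<zeta> powi (- \<rho>) \<noteq> 1"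
      using exists_root_of_unity_powi_neq_1[OF n_pos] by blast
    then have "fls_rotate \<zeta> y \<in> B (c y)" using BZ rotate_Z[of \<zeta> y] yz by simp
    then have "\<zeta> powi (- \<rho>) * c y = c y" by (simp add: B_def c_rot)
    moreover have "c y \<noteq> 0"
    proof -
      have "d > 1" using prime by (rule prime_gt_1_nat)
      then have "y \<noteq> 0" using zero_notin_Z yz(1) by auto
      then show ?thesis using \<rho> yz(1) unfolding c_def by (metis nth_fls_subdegree_nonzero)
    qed
    ultimately show ?thesis using \<zeta>(2) by simp
  qed
qed

text \<open>
  Since the leading coefficients differ, all differences of roots have pole order \<open>\<rho>\<close>, and the formula for the discriminant
  reads \<open>n * (d - 1) = (d - 1) * (2 * n * degree (lead_coeff f) + d * \<rho>)\<close>. So the leading coefficient is constant and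
  \<open>n = d * \<rho>\<close>. In terms of \<open>x\<close>, the roots grow like \<open>x^(1/d)\<close>, which bounds the degree of \<open>coeff f k\<close> by \<open>(d - k) / d\<close>.
\<close>

lemma normal_form_of_fractional_slope:
  assumes minimal: "degree (disc_y f) + 1 = d" and prime: "prime d"
    and \<rho>: "\<forall>y\<in>Z. fls_subdegree y = - \<rho>" and ndvd: "\<not> int n dvd \<rho>" and \<rho>_pos: "\<rho> > 0"
  shows "degree (coeff f 0) = 1 \<and> (\<forall>k\<ge>1. degree (coeff f k) = 0)"
proof -
  have d1: "d > 1" using prime by (rule prime_gt_1_nat)
  have "fls_subdegree (y - z) = - \<rho>" if "y \<in> Z" "z \<in> Z - {y}" for y z
  proof (rule fls_subdegree_eqI)
    show "fls_nth (y - z) (- \<rho>) \<noteq> 0"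
      using leading_coeffs_distinct[OF minimal prime \<rho> ndvd, of y z] that by auto
    show "fls_nth (y - z) k = 0" if "k < - \<rho>" for k
      using that \<rho> \<open>y \<in> Z\<close> \<open>z \<in> Z - {y}\<close> by (auto intro!: fls_eq0_below_subdegree)
  qed
  then have "(\<Sum>y\<in>Z. \<Sum>z\<in>Z - {y}. fls_subdegree (y - z)) = (\<Sum>y\<in>Z. \<Sum>z\<in>Z - {y}. - \<rho>)"
    by (intro sum.cong refl) auto
  also have "\<dots> = - (int d * int (d - 1) * \<rho>)" using card_Z by (simp add: card_Diff_singleton)
  finally have "int n * int (degree (disc_y f)) = 2 * int (d - 1) * (int n * int (degree (lead_coeff f))) + int d * int (d - 1) * \<rho>"
    unfolding degree_disc by simp
  moreover have "degree (disc_y f) = d - 1" using minimal by simp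
  ultimately have "int (d - 1) * int n = int (d - 1) * (2 * (int n * int (degree (lead_coeff f))) + int d * \<rho>)"
    by (simp add: algebra_simps)
  then have eq: "int n = 2 * (int n * int (degree (lead_coeff f))) + int d * \<rho>"
    using d1 by simp
  have d\<rho>: "int d * \<rho> > 0" using \<rho>_pos deg_pos by simp
  have lc0: "degree (lead_coeff f) = 0"
  proof (rule ccontr)
    assume "degree (lead_coeff f) \<noteq> 0"
    then have "int n * 1 \<le> int n * int (degree (lead_coeff f))" by (intro mult_left_mono) auto
    then show False using eq d\<rho> n_pos by linarith
  qed
  then have n: "int n = int d * \<rho>" using eq by simp
  have "int n * int (degree (coeff f 0)) = int n * 1"
    using degree_coeff_0[OF zero_notin_Z[OF d1]] lc0 \<rho> n card_Z by simp
  then have "degree (coeff f 0) = 1" using n_pos by simp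
  moreover have "degree (coeff f k) = 0" if "k \<ge> 1" for k
  proof -
    have "coeff (coeff f k) j = 0" if j: "j > 0" for j
    proof (cases "k \<le> d")
      case True
      obtain c where c: "lead_coeff f = [:c:]" using lc0 by (rule degree_eq_zeroE)
      have "e (coeff f k) = coeff F k" by simp
      also have "\<dots> = fls_const c * coeff (prod_linear zs) k" by (simp only: split coeff_smult c embed_inf_const)
      finally have ek: "e (coeff f k) = fls_const c * coeff (prod_linear zs) k" .
      have "coeff (coeff f k) j = fls_nth (e (coeff f k)) (- (int n * int j))"
        by (rule nth_embed_inf_mult[OF n_pos, symmetric])
      also have "\<dots> = c * fls_nth (coeff (prod_linear zs) k) (- (int n * int j))" by (simp add: ek)
      also have "fls_nth (coeff (prod_linear zs) k) (- (int n * int j)) = 0"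
      proof (rule nth_coeff_prod_linear_lower[where \<rho> = \<rho>])
        have "(int d - int k) * \<rho> < int d * \<rho>" using \<open>k \<ge> 1\<close> \<rho>_pos by (intro mult_strict_right_mono) auto
        also have "\<dots> \<le> int n * int j" using n j n_pos by (simp add: mult_le_cancel_left1)
        finally show "- (int n * int j) < - ((int (length zs) - int k) * \<rho>)" by (simp add: length_zs)
      qed (use \<rho> in \<open>auto intro!: fls_eq0_below_subdegree\<close>)
      finally show ?thesis by simp
    qed (simp add: coeff_eq_0)
    then show ?thesis using leading_coeff_0_iff[of "coeff f k"] by (cases "degree (coeff f k)") auto
  qed
  ultimately show ?thesis by blast
qed

text \<open>
  If \<open>\<rho> = n * k\<close>, rotations do not change the leading coefficients of the roots, so by transitivity they are all equal to
  one \<open>\<kappa>\<close>. Subtracting \<open>\<kappa> * x^k\<close> makes every root, and hence their product, smaller.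
\<close>

lemma translate_lowers_coeff_0:
  assumes minimal: "degree (disc_y f) + 1 = d" and d1: "d > 1"
    and \<rho>: "\<forall>y\<in>Z. fls_subdegree y = - \<rho>" and dvd: "int n dvd \<rho>" and \<rho>_nonneg: "\<rho> \<ge> 0"
  shows "\<exists>b. degree (coeff (f \<circ>\<^sub>p [:b, 1:]) 0) < degree (coeff f 0)"
proof -
  obtain k' where k': "\<rho> = int n * k'" using dvd by blast
  then have "k' \<ge> 0" using \<rho>_nonneg n_pos by (simp add: zero_le_mult_iff)
  define k where "k = nat k'"
  have k: "\<rho> = int n * int k" using k' \<open>k' \<ge> 0\<close> by (simp add: k_def)
  obtain y0 where y0: "y0 \<in> Z" using Z_nonempty by (metis ex_in_conv)
  define \<kappa> where "\<kappa> = fls_nth y0 (- \<rho>)"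
  have lead: "fls_nth y (- \<rho>) = \<kappa>" if y: "y \<in> Z" for y
  proof -
    obtain \<zeta> where \<zeta>: "\<zeta> \<in> U" "y = fls_rotate \<zeta> y0" using rotations_transitive_on_roots[OF minimal y0 y] by blast
    have "- \<rho> = int n * - int k" by (simp add: k)
    then have "\<zeta> powi (- \<rho>) = 1" using \<zeta>(1) by (simp only: power_int_mult) simp
    then show ?thesis by (simp add: \<zeta>(2) \<kappa>_def)
  qed
  define b where "b = monom \<kappa> k"
  have eb: "fls_nth (e b) m = (if m = - \<rho> then \<kappa> else 0)" for m
    by (simp add: b_def embed_inf_monom k)
  interpret T: puiseux_roots "f \<circ>\<^sub>p [:b, 1:]" n "map (\<lambda>z. z - e b) zs" by (rule puiseux_roots_translate)
  have dT: "degree (f \<circ>\<^sub>p [:b, 1:]) = d" by (simp add: degree_pcompose)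
  have nzT: "0 \<notin> T.Z" using d1 dT by (intro T.zero_notin_Z) simp
  have sub: "fls_subdegree (y - e b) \<ge> - \<rho> + 1" if y: "y \<in> Z" for y
  proof (rule fls_subdegree_geI)
    show "y - e b \<noteq> 0" using nzT y by auto
    fix m assume "m < - \<rho> + 1"
    then consider "m < - \<rho>" | "m = - \<rho>" by linarith
    then show "fls_nth (y - e b) m = 0"
      using \<rho> y lead[OF y] by cases (auto simp: eb intro!: fls_eq0_below_subdegree)
  qed
  have lcT: "lead_coeff (f \<circ>\<^sub>p [:b, 1:]) = lead_coeff f" by (subst lead_coeff_comp) auto
  have "int n * int (degree (coeff (f \<circ>\<^sub>p [:b, 1:]) 0)) = int n * int (degree (lead_coeff f)) - (\<Sum>y\<in>Z. fls_subdegree (y - e b))"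
  proof -
    have "(\<Sum>y\<in>T.Z. fls_subdegree y) = (\<Sum>y\<in>Z. fls_subdegree (y - e b))"
      by (simp add: sum.reindex inj_on_def)
    then show ?thesis using T.degree_coeff_0[OF nzT] lcT by simp
  qed
  also have "(\<Sum>y\<in>Z. fls_subdegree (y - e b)) \<ge> (\<Sum>y\<in>Z. - \<rho> + 1)" by (intro sum_mono sub)
  then have "int n * int (degree (lead_coeff f)) - (\<Sum>y\<in>Z. fls_subdegree (y - e b))
      < int n * int (degree (lead_coeff f)) + int d * \<rho>"
    using card_Z deg_pos by (simp add: algebra_simps)
  also have "\<dots> = int n * int (degree (coeff f 0))"
    using degree_coeff_0[OF zero_notin_Z[OF d1]] \<rho> card_Z by simp
  finally show ?thesis using n_pos by auto
qed

end

text \<open>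
  Minimise \<open>degree (lead_coeff h) + degree (coeff h 0)\<close> over the orbit. Reversing the coefficients if necessary, the roots have pole order
  \<open>\<rho> \<ge> 0\<close>. By minimality no translation lowers \<open>degree (coeff h 0)\<close>, so \<open>n\<close> does not divide \<open>\<rho>\<close>.
\<close>

theorem orbit_contains_normal_form:
  fixes f :: "'k::{alg_closed_field, field_char_0} poly poly"
  assumes "minimal_poly f" and "prime (degree f)"
  shows "\<exists>h\<in>orbit f. degree (coeff h 0) = 1 \<and> (\<forall>k\<ge>1. degree (coeff h k) = 0)"
proof -
  have irr: "irreducible f" and disc: "degree (disc_y f) + 1 = degree f"
    using assms(1) by (auto simp: minimal_poly_def)
  have d1: "degree f > 1" using assms(2) by (rule prime_gt_1_nat)
  define \<mu> where "\<mu> h = degree (lead_coeff h) + degree (coeff h 0)" for h :: "'k poly poly"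
  obtain h0 where h0: "h0 \<in> orbit f" and h0_min: "\<And>h. h \<in> orbit f \<Longrightarrow> \<mu> h0 \<le> \<mu> h"
    using ex_has_least_nat[of "\<lambda>h. h \<in> orbit f" f \<mu>] orbit_refl[OF irr] by blast
  have c0: "coeff h 0 \<noteq> 0" if "h \<in> orbit f" for h
    using irreducible_coeff_0_nz[of h] that d1 by (auto simp: orbit_def)
  obtain h where h: "h \<in> orbit f" and h_min: "\<And>h'. h' \<in> orbit f \<Longrightarrow> \<mu> h \<le> \<mu> h'"
    and le: "degree (lead_coeff h) \<le> degree (coeff h 0)"
  proof (cases "degree (lead_coeff h0) \<le> degree (coeff h0 0)")
    case True then show thesis using that h0 h0_min by blast
  next
    case False
    have "lead_coeff (reflect_poly h0) = coeff h0 0" "coeff (reflect_poly h0) 0 = lead_coeff h0"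
      using c0[OF h0] by (simp_all add: coeff_reflect_poly)
    then show thesis using that[of "reflect_poly h0"] False orbit_reflect[OF h0 d1] h0_min by (simp add: \<mu>_def add.commute)
  qed
  have deg_h: "degree h = degree f" and disc_h: "degree (disc_y h) + 1 = degree h" and irr_h: "irreducible h"
    using h disc by (auto simp: orbit_def)
  obtain n zs where "puiseux_roots h n zs" using ex_puiseux_roots[OF irr_h] d1 deg_h by auto
  then interpret puiseux_roots h n zs .
  obtain \<rho> where \<rho>: "\<forall>y\<in>Z. fls_subdegree y = - \<rho>" using common_order[OF disc_h] by blast
  have dh: "d > 1" "prime d" using d1 assms(2) deg_h by auto
  have "int n * int (degree (coeff h 0)) = int n * int (degree (lead_coeff h)) + int d * \<rho>"
    using degree_coeff_0[OF zero_notin_Z[OF dh(1)]] \<rho> card_Z by simp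
  moreover have "int n * int (degree (lead_coeff h)) \<le> int n * int (degree (coeff h 0))"
    using le by (intro mult_left_mono) auto
  ultimately have "int d * \<rho> \<ge> 0" by linarith
  then have \<rho>_nonneg: "\<rho> \<ge> 0" using deg_pos by (simp add: zero_le_mult_iff)
  have ndvd: "\<not> int n dvd \<rho>"
  proof
    assume "int n dvd \<rho>"
    then obtain b where b: "degree (coeff (h \<circ>\<^sub>p [:b, 1:]) 0) < degree (coeff h 0)"
      using translate_lowers_coeff_0[OF disc_h dh(1) \<rho> _ \<rho>_nonneg] by blast
    moreover have "lead_coeff (h \<circ>\<^sub>p [:b, 1:]) = lead_coeff h" by (subst lead_coeff_comp) auto
    ultimately have "\<mu> (h \<circ>\<^sub>p [:b, 1:]) < \<mu> h" by (simp add: \<mu>_def)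
    then show False using h_min[OF orbit_translate[OF h d1]] by (simp add: not_less[symmetric])
  qed
  then have "\<rho> > 0" using \<rho>_nonneg by (cases "\<rho> = 0") auto
  then show ?thesis using normal_form_of_fractional_slope[OF disc_h dh(2) \<rho> ndvd] h by blast
qed

lemma degree_poly_in_y_plus_x:
  fixes g :: "'k::field poly"
  assumes "degree g > 0"
  shows "coeff (poly_in_y g + bivar_x) i = (if i = 0 then [:coeff g 0, 1:] else [:coeff g i:])"
    and "degree (poly_in_y g + bivar_x) = degree g"
proof -
  show c: "coeff (poly_in_y g + bivar_x) i = (if i = 0 then [:coeff g 0, 1:] else [:coeff g i:])" for i
    by (cases i) (simp_all add: poly_in_y_def bivar_x_def coeff_map_poly)
  show "degree (poly_in_y g + bivar_x) = degree g"
  proof (intro antisym[OF degree_le le_degree] allI impI)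
    fix i assume "i > degree g"
    then show "coeff (poly_in_y g + bivar_x) i = 0" using assms by (simp only: c) (simp add: coeff_eq_0)
  next
    show "coeff (poly_in_y g + bivar_x) (degree g) \<noteq> 0" using assms by (simp only: c) auto
  qed
qed

text \<open>
  The partner is \<open>y\<close>: the algebra generated by \<open>g(y) + x\<close> and \<open>y\<close> contains \<open>x\<close>.
\<close>

lemma coordinate_poly_in_y_plus_x:
  fixes g :: "'k::field poly"
  shows "coordinate_poly (poly_in_y g + bivar_x)"
proof -
  let ?f = "poly_in_y g + bivar_x :: 'k poly poly" and ?h = "[:0, 1:] :: 'k poly poly"
  let ?c = "\<lambda>c :: 'k. [:[:c:]:]"
  define \<phi> where "\<phi> q = poly (map_poly ?c q) ?f" for q
  have m1: "?c (- 1) = - 1" by (simp add: one_pCons)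
  have x_eq: "[:[:0, 1:]:] = ?f + ?c (- 1) * poly_in_y g" unfolding m1 by (simp add: bivar_x_def)
  interpret c: comm_ring_hom ?c by unfold_locales (auto simp: one_pCons)
  interpret mc: map_poly_comm_ring_hom ?c ..
  interpret \<phi>: comm_ring_hom \<phi> by unfold_locales (auto simp: \<phi>_def mc.hom_add mc.hom_mult)
  interpret m\<phi>: map_poly_comm_ring_hom \<phi> ..
  have sub: "subst2 ?f ?h P = poly (map_poly \<phi> P) ?h" for P by (simp add: subst2_def \<phi>_def[abs_def])
  let ?R = "generated_subalgebra ?f ?h"
  have R_eq: "?R = range (\<lambda>P. poly (map_poly \<phi> P) ?h)" by (simp add: generated_subalgebra_def sub)
  have R_add: "p + q \<in> ?R" and R_mult: "p * q \<in> ?R" if pq: "p \<in> ?R" "q \<in> ?R" for p q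
  proof -
    obtain P Q where "p = poly (map_poly \<phi> P) ?h" "q = poly (map_poly \<phi> Q) ?h" using pq unfolding R_eq by blast
    then have "p + q = poly (map_poly \<phi> (P + Q)) ?h" "p * q = poly (map_poly \<phi> (P * Q)) ?h"
      by (simp_all only: m\<phi>.hom_add m\<phi>.hom_mult poly_add poly_mult)
    then show "p + q \<in> ?R" "p * q \<in> ?R" unfolding R_eq by blast+
  qed
  have \<phi>_const: "\<phi> [:a:] = ?c a" for a by (cases "a = 0") (simp_all add: \<phi>_def map_poly_pCons)
  have R_const: "?c a \<in> ?R" for a
  proof -
    have "?c a = poly (map_poly \<phi> [:[:a:]:]) ?h"
      by (cases "a = 0") (simp_all add: map_poly_pCons \<phi>_const)
    then show ?thesis unfolding R_eq by blast
  qed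
  have y: "[:0, 1:] \<in> ?R"
  proof -
    have "[:0, 1:] = poly (map_poly \<phi> [:0, 1:]) ?h" by (simp add: map_poly_pCons)
    then show ?thesis unfolding R_eq by blast
  qed
  have R_f: "?f \<in> ?R"
  proof -
    have "\<phi> [:0, 1:] = ?f" by (simp add: \<phi>_def map_poly_pCons flip: one_pCons)
    then have "?f = poly (map_poly \<phi> [:[:0, 1:]:]) ?h" by (simp add: map_poly_pCons)
    then show ?thesis unfolding R_eq by blast
  qed
  have R_y: "poly_in_y p \<in> ?R" for p
  proof (induction p)
    case 0 show ?case using R_const[of 0] by (simp add: poly_in_y_def)
  next
    case (pCons a p)
    have "poly_in_y (pCons a p) = ?c a + [:0, 1:] * poly_in_y p"
      by (rule poly_eqI) (simp add: poly_in_y_def coeff_map_poly coeff_pCons split: nat.split)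
    then show ?case by (simp only:) (intro R_add R_mult R_const y pCons.IH)
  qed
  have x: "[:[:0, 1:]:] \<in> ?R"
  proof -
    have "?f + ?c (- 1) * poly_in_y g \<in> ?R"
      using R_add[OF R_f R_mult[OF R_const R_y]] .
    then show ?thesis by (rule back_subst[OF _ x_eq[symmetric]])
  qed
  have R_x: "[:q:] \<in> ?R" for q
  proof (induction q)
    case 0 show ?case using R_const[of 0] by simp
  next
    case (pCons a q)
    have eq: "[:pCons a q:] = ?c a + [:[:0, 1:]:] * [:q:]" by simp
    show ?case by (subst eq) (intro R_add R_mult R_const x pCons.IH)
  qed
  have "P \<in> ?R" for P
  proof (induction P)
    case 0 show ?case using R_const[of 0] by simp
  next
    case (pCons q P)
    have eq: "pCons q P = [:q:] + [:0, 1:] * P" by simp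
    show ?case by (subst eq) (intro R_add R_mult R_x y pCons.IH)
  qed
  then show ?thesis unfolding coordinate_poly_def by blast
qed

theorem theorem1p6:
  fixes f :: "'k::{alg_closed_field, field_char_0} poly poly"
  assumes "minimal_poly f"
    and "prime (degree f)"
  shows "(\<exists>g :: 'k poly. degree g = degree f \<and> f \<equiv>\<^sub>G poly_in_y g + bivar_x)
    \<and> (\<exists>h :: 'k poly poly. monic_y h \<and> f \<equiv>\<^sub>G h)
    \<and> (\<exists>h :: 'k poly poly. coordinate_poly h \<and> f \<equiv>\<^sub>G h)"
proof -
  have irr: "irreducible f" using assms(1) by (simp add: minimal_poly_def)
  have d1: "degree f > 1" using assms(2) by (rule prime_gt_1_nat)
  obtain h where h: "h \<in> orbit f" "degree (coeff h 0) = 1" "\<And>k. k \<ge> 1 \<Longrightarrow> degree (coeff h k) = 0"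
    using orbit_contains_normal_form[OF assms] by blast
  have deg_h: "degree h = degree f" and irr_h: "irreducible h" using h(1) by (auto simp: orbit_def)
  obtain A where A: "A \<in> GL2" "f = G_act A h" using h(1) by (auto simp: orbit_def)
  define \<alpha> where "\<alpha> = coeff (coeff h 0) 1"
  have \<alpha>: "\<alpha> \<noteq> 0" using h(2) unfolding \<alpha>_def by (metis leading_coeff_neq_0 degree_0 zero_neq_one)
  define g where "g = smult (inverse \<alpha>) (map_poly (\<lambda>c. coeff c 0) h)"
  have coeff_g: "coeff g i = coeff (coeff h i) 0 / \<alpha>" for i
    by (simp add: g_def coeff_map_poly field_simps)
  have coeff_h: "coeff h i = (if i = 0 then [:\<alpha> * coeff g 0, \<alpha>:] else [:\<alpha> * coeff g i:])" for i
  proof (cases "i = 0")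
    case True
    have "coeff h 0 = [:coeff (coeff h 0) 0, \<alpha>:]"
      using h(2) by (intro poly_eqI) (auto simp: \<alpha>_def coeff_pCons coeff_eq_0 split: nat.splits)
    then show ?thesis using True \<alpha> by (simp add: coeff_g)
  next
    case False
    then obtain c where "coeff h i = [:c:]" using h(3)[of i] by (auto elim: degree_eq_zeroE)
    then show ?thesis using False \<alpha> by (simp add: coeff_g)
  qed
  have deg_g: "degree g = degree f"
  proof (intro antisym[OF degree_le le_degree] allI impI)
    fix i assume "i > degree f"
    then show "coeff g i = 0" by (simp add: coeff_g coeff_eq_0 deg_h)
  next
    have "coeff h (degree f) \<noteq> 0" using d1 deg_h by (metis leading_coeff_neq_0 degree_0 not_less_zero)
    then show "coeff g (degree f) \<noteq> 0" using d1 by (auto simp: coeff_h)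
  qed
  let ?k = "poly_in_y g + bivar_x :: 'k poly poly"
  have deg_g0: "degree g > 0" using deg_g d1 by simp
  note k = degree_poly_in_y_plus_x[OF deg_g0]
  have hk: "h = smult [:\<alpha>:] ?k" by (rule poly_eqI) (simp only: coeff_smult k(1) coeff_h, simp)
  \<comment> \<open>the scalar matrix with entry \<open>s\<close> multiplies a polynomial of degree \<open>degree f\<close> by \<open>\<alpha>\<close>\<close>
  obtain s where s: "s ^ degree f = \<alpha>" using nth_root_exists[of "degree f" \<alpha>] d1 by auto
  have s0: "s \<noteq> 0" using s \<alpha> d1 by (auto simp: power_0_left)
  have "G_act (mat2 [:s:] 0 0 [:s:]) ?k = h" unfolding G_act_scalar hk k(2) deg_g s ..
  moreover have GL: "mat2 [:s:] 0 0 [:s:] \<in> GL2" by (rule mat2_GL2[of _ _ _ _ "[:inverse (s * s):]"]) (use s0 in \<open>simp add: one_pCons field_simps\<close>)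
  ultimately have "f = G_act (mat2 [:s:] 0 0 [:s:] * A) ?k"
    using A G_act_G_act[OF A(1), of "mat2 [:s:] 0 0 [:s:]" ?k] k(2) deg_g deg_h by (simp add: mat2_carrier)
  moreover have "irreducible ?k"
  proof (rule irreducibleI)
    show "?k \<noteq> 0" using k(2) deg_g0 by auto
    show "\<not> ?k dvd 1" using k(2) deg_g0 by (auto simp: poly_dvd_1)
    fix p q assume "?k = p * q"
    then have "h = smult [:\<alpha>:] p * q" using hk by simp
    then have "smult [:\<alpha>:] p dvd 1 \<or> q dvd 1" using irr_h irreducibleD by blast
    then show "p dvd 1 \<or> q dvd 1"
      using dvd_trans[OF dvd_smult[OF dvd_refl]] by blast
  qed
  ultimately have equiv: "f \<equiv>\<^sub>G ?k"
    unfolding G_equivalent_def using irr d1 k(2) deg_g GL2_mult[OF GL A(1)] by auto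
  have "monic_y ?k"
    unfolding monic_y_def k(2) k(1) using deg_g0 by (intro exI[of _ "lead_coeff g"]) auto
  then show ?thesis using equiv deg_g coordinate_poly_in_y_plus_x[of g] by blast
qed

end
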